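(* Let $N\in\mathbb{N}$, $\boldsymbol{\nu}=(\nu_1,\dots,\nu_N)\in\overline{\mathbb{W}}_N$ and $\nu_N=\sum_{j=1}^N\delta_{\nu_j}$. (i) The noncolliding Brownian motion with drift $\nu_N$ started with all particles at the origin, $(\Xi(t),t\in[0,\infty),\mathbb{P}^{N\delta_0}_{\nu_N})$, is determinantal with the correlation kernel, for $s,t\in(0,\infty)$ and $x,y\in\mathbb{R}$, $$\mathbf{K}_{\nu_N}(s,x;t,y)=\frac{\sqrt{st}}{2\pi i}\oint_{\Gamma(\nu_N)}d\mu\,p(s,x|s\mu)\int_{\mathbb{R}}d\mu'\,p(t,-iy|t\mu')\,\frac{1}{i\mu'-\mu}\prod_{j=1}^N\Big(1-\frac{i\mu'-\mu}{\nu_j-\mu}\Big)-\mathbf{1}(s<t)\,p\Big(t-s,\sqrt{\tfrac st}\,y\,\Big|\,\sqrt{\tfrac ts}\,x\Big),$$ where $\Gamma(\nu_N)$ is a closed contour on the complex plane $\mathbb{C}$ encircling the points of $\mathrm{supp}\,\nu_N=\{\nu_1,\dots,\nu_N\}$ on the real line $\mathbb{R}$ once in the positive direction. (ii) If $\nu_1<\nu_2<\dots<\nu_N$ (that is, $\nu_N$ has no multiple points), then this correlation kernel is simplified as $$\mathbf{K}_{\nu_N}(s,x;t,y)=\sqrt{st}\sum_{j=1}^Np(s,x|s\nu_j)\int_{\mathbb{R}}d\mu'\,p(t,-iy|t\mu')\,\Phi(\nu_N,\nu_j,i\mu')-\mathbf{1}(s<t)\,p\Big(t-s,\sqrt{\tfrac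 st}\,y\,\Big|\,\sqrt{\tfrac ts}\,x\Big),$$ for $s,t\in(0,\infty)$ and $x,y\in\mathbb{R}$, where $\Phi(\nu_N,\nu_j,z)=\prod_{1\le k\le N,\,k\ne j}\Big(1-\frac{z-\nu_j}{\nu_k-\nu_j}\Big)$.
   Context: Notation. $\mathbb{W}_N=\{\boldsymbol{x}\in\mathbb{R}^N: x_1<\dots<x_N\}$, $\overline{\mathbb{W}}_N=\{\boldsymbol{x}\in\mathbb{R}^N: x_1\le\dots\le x_N\}$. $i=\sqrt{-1}$. For $t>0$ and $x,y\in\mathbb{C}$, $p(t,y|x)=\frac{1}{\sqrt{2\pi t}}e^{-(y-x)^2/2t}$. $q_N(t,\boldsymbol{y}|\boldsymbol{x})=\det_{1\le j,k\le N}[p(t,y_j|x_k)]$. $\mathbf{1}(\omega)$ is $1$ if the condition $\omega$ holds and $0$ otherwise. Process. For $\boldsymbol{x},\boldsymbol{y},\boldsymbol{\nu}\in\mathbb{W}_N$, $t>0$, the noncolliding Brownian motion with drift $\boldsymbol{\nu}$ has transition density $$p_N^{\boldsymbol{\nu}}(t,\boldsymbol{y}|\boldsymbol{x})=e^{-t|\boldsymbol{\nu}|^2/2}\,\frac{\det_{1\le j,k\le N}[e^{\nu_jy_k}]}{\det_{1\le j,k\le N}[e^{\nu_jx_k}]}\,q_N(t,\boldsymbol{y}|\boldsymbol{x}),$$ extended to $\boldsymbol{x},\boldsymbol{\nu}\in\overline{\mathbb{W}}_N$ by taking limits from $\mathbb{W}_N$. With $\nu_N=\sum_{j=1}^N\delta_{\nu_j}$,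 $\mathbb{P}^{N\delta_0}_{\nu_N}$ is the law of the Markov process $\Xi(t)=\sum_{j=1}^N\delta_{X_j(t)}$ of unlabeled configurations, started with all $N$ particles at $0$, whose joint density at times $0<t_1<\dots<t_M$ at $\boldsymbol{x}^{(1)},\dots,\boldsymbol{x}^{(M)}\in\mathbb{W}_N$ is $$p^{N\delta_0}_{\nu_N}(t_1,\boldsymbol{x}^{(1)};\dots;t_M,\boldsymbol{x}^{(M)})=p_N^{\boldsymbol{\nu}}(t_1,\boldsymbol{x}^{(1)}|\boldsymbol{0})\prod_{m=1}^{M-1}p_N^{\boldsymbol{\nu}}(t_{m+1}-t_m,\boldsymbol{x}^{(m+1)}|\boldsymbol{x}^{(m)});$$ being a function of unlabeled configurations, it is extended to almost all $\boldsymbol{x}^{(m)}\in\mathbb{R}^N$ so as to be symmetric in the $N$ coordinates of each $\boldsymbol{x}^{(m)}$. Correlation functions. For $1\le N_m\le N$ and $\boldsymbol{x}^{(m)}_{N_m}=(x^{(m)}_1,\dots,x^{(m)}_{N_m})$, $1\le m\le M$, the $(N_1,\dots,N_M)$-multitime correlation function is $$\rho(t_1,\boldsymbol{x}^{(1)}_{N_1};\dots;t_M,\boldsymbol{x}^{(M)}_{N_M})=\int_{\prod_{m=1}^M\mathbb{R}^{N-N_m}}\prod_{m=1}^M\prod_{j=N_m+1}^Ndx^{(m)}_j\;p^{N\delta_0}_{\nu_N}(t_1,\boldsymbol{x}^{(1)};\dots;t_M,\boldsymbol{x}^{(M)})\prod_{m=1}^M\frac{1}{(N-N_m)!}.$$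 The process is said to be determinantal with the correlation kernel $\mathbf{K}$ if $\mathbf{K}(s,x;t,y)$ is continuous in $(x,y)\in\mathbb{R}^2$ for each fixed $(s,t)$ and, for every $M\ge1$, all positive integers $N_1,\dots,N_M$ (each at most $N$) and all times $0<t_1<\dots<t_M<\infty$, $$\rho(t_1,\boldsymbol{x}^{(1)}_{N_1};\dots;t_M,\boldsymbol{x}^{(M)}_{N_M})=\det_{\substack{1\le j\le N_m,\,1\le k\le N_n\\1\le m,n\le M}}\Big[\mathbf{K}(t_m,x^{(m)}_j;t_n,x^{(n)}_k)\Big].$$
   Formalization: The displayed formula fails if Γ encloses part of the imaginary axis (pole μ=iμ'; N=1, ν=0 gives an extra −r/π). Proved: as displayed for Γ neither meeting nor encircling that axis; for all ν, with the μ-integral inside and contours Γ(μ') around supp ν leaving iμ' outside (μ'≠0). *)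

theory Defs
  imports
    "HOL-Complex_Analysis.Complex_Analysis"
    "Jordan_Normal_Form.Determinant"
begin

text \<open>
  A point of \<open>\<real>\<^sup>N\<close> is a function \<open>nat \<Rightarrow> real\<close> of which only the values at the indices
  \<open>0, \<dots>, N - 1\<close> matter; the coordinate written \<open>x\<^sub>j\<close> on paper is \<open>x (j - 1)\<close>.
  Times \<open>t\<^sub>m\<close> and the points \<open>x\<^sup>(\<^sup>m\<^sup>)\<close> are likewise indexed from 0.
  Both HOL-Analysis and Jordan_Normal_Form define \<open>det\<close> and \<open>mat\<close>; the
  variably sized matrices of the latter are used throughout.
\<close>

definition weyl :: "nat \<Rightarrow> (nat \<Rightarrow> real) set" where
  "weyl N = {x. strict_mono_on {..<N} x}"

definition weyl_closed :: "nat \<Rightarrow> (nat \<Rightarrow> real) set" where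
  "weyl_closed N = {x. mono_on {..<N} x}"

definition det_fun :: "nat \<Rightarrow> (nat \<Rightarrow> nat \<Rightarrow> 'a::comm_ring_1) \<Rightarrow> 'a" where
  "det_fun n f = Determinant.det (Matrix.mat n n (\<lambda>(j, k). f j k))"

text \<open>The Gaussian density \<open>p(t, y | x)\<close>, for real as well as for complex \<open>x\<close>, \<open>y\<close>.\<close>

definition gauss :: "real \<Rightarrow> 'a::{banach, real_normed_field} \<Rightarrow> 'a \<Rightarrow> 'a" where
  "gauss t y x = 1 / of_real (sqrt (2 * pi * t)) * exp (- ((y - x)\<^sup>2 / of_real (2 * t)))"

definition karlin_mcgregor :: "nat \<Rightarrow> real \<Rightarrow> (nat \<Rightarrow> real) \<Rightarrow> (nat \<Rightarrow> real) \<Rightarrow> real" where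
  "karlin_mcgregor N t y x = det_fun N (\<lambda>j k. gauss t (y j) (x k))"

definition transition_interior ::
    "nat \<Rightarrow> (nat \<Rightarrow> real) \<Rightarrow> real \<Rightarrow> (nat \<Rightarrow> real) \<Rightarrow> (nat \<Rightarrow> real) \<Rightarrow> real" where
  "transition_interior N \<nu> t y x =
     exp (- t * (\<Sum>j<N. (\<nu> j)\<^sup>2) / 2)
       * (det_fun N (\<lambda>j k. exp (\<nu> j * y k)) / det_fun N (\<lambda>j k. exp (\<nu> j * x k)))
       * karlin_mcgregor N t y x"

text \<open>
  The transition density \<open>p\<^sub>N\<^sup>\<nu>(t, y | x)\<close> for \<open>\<nu>\<close>, \<open>x\<close> in the closed chamber: the joint limit
  in \<open>(\<nu>, x)\<close> from the open chamber.  The topology on \<open>nat \<Rightarrow> real\<close> is the product topology; as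
  the function depends on finitely many coordinates, this is the limit in
  \<open>\<real>\<^sup>N \<times> \<real>\<^sup>N\<close>.
\<close>

definition transition ::
    "nat \<Rightarrow> (nat \<Rightarrow> real) \<Rightarrow> real \<Rightarrow> (nat \<Rightarrow> real) \<Rightarrow> (nat \<Rightarrow> real) \<Rightarrow> real" where
  "transition N \<nu> t y x =
     (if \<nu> \<in> weyl N \<and> x \<in> weyl N then transition_interior N \<nu> t y x
      else Lim (at (\<nu>, x) within weyl N \<times> weyl N)
             (\<lambda>(\<nu>', x'). transition_interior N \<nu>' t y x'))"

definition joint_density_weyl ::
    "nat \<Rightarrow> (nat \<Rightarrow> real) \<Rightarrow> nat \<Rightarrow> (nat \<Rightarrow> real) \<Rightarrow> (nat \<Rightarrow> nat \<Rightarrow> real) \<Rightarrow> real" where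
  "joint_density_weyl N \<nu> M t x =
     transition N \<nu> (t 0) (x 0) (\<lambda>_. 0)
       * (\<Prod>m<M - 1. transition N \<nu> (t (Suc m) - t m) (x (Suc m)) (x m))"

definition rearrange :: "nat \<Rightarrow> (nat \<Rightarrow> real) \<Rightarrow> nat \<Rightarrow> real" where
  "rearrange N x = (\<lambda>j. if j < N then sort (map x [0..<N]) ! j else 0)"

text \<open>
  The symmetric extension to points outside the chamber.  On the null set where two particles
  coincide at the same time the density is set to 0, its continuous extension.
\<close>

definition joint_density ::
    "nat \<Rightarrow> (nat \<Rightarrow> real) \<Rightarrow> nat \<Rightarrow> (nat \<Rightarrow> real) \<Rightarrow> (nat \<Rightarrow> nat \<Rightarrow> real) \<Rightarrow> real" where
  "joint_density N \<nu> M t x =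
     (if \<forall>m<M. inj_on (x m) {..<N}
      then joint_density_weyl N \<nu> M t (\<lambda>m. rearrange N (x m)) else 0)"

text \<open>
  In the multitime correlation function the coordinates \<open>x m j\<close> with \<open>j < Ns m\<close> are given and those
  with \<open>Ns m \<le> j < N\<close> are integrated out.  If there are none of the latter, the product
  measure is a point mass and the integral is the value of the integrand.
\<close>

definition correlation ::
    "nat \<Rightarrow> (nat \<Rightarrow> real) \<Rightarrow> nat \<Rightarrow> (nat \<Rightarrow> real) \<Rightarrow> (nat \<Rightarrow> nat) \<Rightarrow> (nat \<Rightarrow> nat \<Rightarrow> real) \<Rightarrow> real" where
  "correlation N \<nu> M t Ns x =
     (LINT z | (\<Pi>\<^sub>M mj \<in> (SIGMA m:{..<M}. {Ns m..<N}). lborel).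
        joint_density N \<nu> M t (\<lambda>m j. if j < Ns m then x m j else z (m, j))
          * (\<Prod>m<M. 1 / fact (N - Ns m)))"

definition block_indices :: "nat \<Rightarrow> (nat \<Rightarrow> nat) \<Rightarrow> (nat \<times> nat) list" where
  "block_indices M Ns = [(m, j). m \<leftarrow> [0..<M], j \<leftarrow> [0..<Ns m]]"

definition block_det ::
    "nat \<Rightarrow> (nat \<Rightarrow> nat) \<Rightarrow> (nat \<times> nat \<Rightarrow> nat \<times> nat \<Rightarrow> 'a::comm_ring_1) \<Rightarrow> 'a" where
  "block_det M Ns f =
     det_fun (length (block_indices M Ns))
       (\<lambda>a b. f (block_indices M Ns ! a) (block_indices M Ns ! b))"

text \<open>
  \<open>determinantal N \<nu> K\<close>: the noncolliding Brownian motion with drift \<open>\<nu>\<close>, started with all \<open>N\<close>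
  particles at 0, is determinantal with correlation kernel \<open>K(s, x; t, y) = K s x t y\<close>.
\<close>

definition determinantal ::
    "nat \<Rightarrow> (nat \<Rightarrow> real) \<Rightarrow> (real \<Rightarrow> real \<Rightarrow> real \<Rightarrow> real \<Rightarrow> complex) \<Rightarrow> bool" where
  "determinantal N \<nu> K \<longleftrightarrow>
     (\<forall>s>0. \<forall>t>0. continuous_on UNIV (\<lambda>(x, y). K s x t y)) \<and>
     (\<forall>M\<ge>1. \<forall>Ns t x.
        (\<forall>m<M. 1 \<le> Ns m \<and> Ns m \<le> N) \<longrightarrow> (\<forall>m<M. 0 < t m) \<longrightarrow> strict_mono_on {..<M} t \<longrightarrow>
        complex_of_real (correlation N \<nu> M t Ns x) =
          block_det M Ns (\<lambda>(m, j) (n, k). K (t m) (x m j) (t n) (x n k)))"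

definition supp_points :: "nat \<Rightarrow> (nat \<Rightarrow> real) \<Rightarrow> complex set" where
  "supp_points N \<nu> = (\<lambda>j. complex_of_real (\<nu> j)) ` {..<N}"

text \<open>
  A closed contour encircling the points of \<open>S\<close> once in the positive direction, and
  neither meeting nor encircling the points of \<open>P\<close>.
\<close>

definition encircles_once :: "(real \<Rightarrow> complex) \<Rightarrow> complex set \<Rightarrow> complex set \<Rightarrow> bool" where
  "encircles_once \<gamma> S P \<longleftrightarrow>
     valid_path \<gamma> \<and> pathfinish \<gamma> = pathstart \<gamma> \<and> path_image \<gamma> \<inter> (S \<union> P) = {} \<and>
     (\<forall>z\<in>S. winding_number \<gamma> z = 1) \<and> (\<forall>w\<in>P. winding_number \<gamma> w = 0)"

definition imaginary_axis :: "complex set" where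
  "imaginary_axis = {w. Re w = 0}"

definition kernel_tail :: "real \<Rightarrow> real \<Rightarrow> real \<Rightarrow> real \<Rightarrow> complex" where
  "kernel_tail s x t y =
     (if s < t then complex_of_real (gauss (t - s) (sqrt (s / t) * y) (sqrt (t / s) * x)) else 0)"

definition cauchy_factor :: "nat \<Rightarrow> (nat \<Rightarrow> real) \<Rightarrow> complex \<Rightarrow> complex \<Rightarrow> complex" where
  "cauchy_factor N \<nu> \<mu> z =
     1 / (z - \<mu>) * (\<Prod>j<N. 1 - (z - \<mu>) / (complex_of_real (\<nu> j) - \<mu>))"

text \<open>
  As a function of \<open>\<mu>\<close> the integrand of the kernel has, besides the points of the support,
  a pole with nonzero residue at \<open>\<i> \<mu>'\<close>.  The contour has to leave this pole outside (encircling
  part of the imaginary axis adds a spurious term; for \<open>N = 1\<close>, \<open>\<nu> = 0\<close> the kernel would then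
  no longer be the density of Brownian motion on the diagonal).
  In \<open>corr_kernel\<close> the contour is a single one, which then has to avoid the whole imaginary axis.
  In \<open>corr_kernel_swapped\<close> the \<open>\<mu>\<close>-integral is the inner one and its contour \<open>\<Gamma> \<mu>'\<close> may depend on
  \<open>\<mu>'\<close>; such contours exist for all \<open>\<nu>\<close>, also if 0 is in the support or
  if the drifts have different signs.
\<close>

definition corr_kernel ::
    "nat \<Rightarrow> (nat \<Rightarrow> real) \<Rightarrow> (real \<Rightarrow> complex) \<Rightarrow> real \<Rightarrow> real \<Rightarrow> real \<Rightarrow> real \<Rightarrow> complex" where
  "corr_kernel N \<nu> \<gamma> s x t y =
     complex_of_real (sqrt (s * t)) / (2 * complex_of_real pi * \<i>)
       * contour_integral \<gamma> (\<lambda>\<mu>. gauss s (complex_of_real x) (complex_of_real s * \<mu>)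
           * (LINT \<mu>' | lborel.
                gauss t (- \<i> * complex_of_real y) (complex_of_real (t * \<mu>'))
                  * cauchy_factor N \<nu> \<mu> (\<i> * complex_of_real \<mu>')))
     - kernel_tail s x t y"

definition corr_kernel_swapped ::
    "nat \<Rightarrow> (nat \<Rightarrow> real) \<Rightarrow> (real \<Rightarrow> real \<Rightarrow> complex) \<Rightarrow> real \<Rightarrow> real \<Rightarrow> real \<Rightarrow> real \<Rightarrow> complex" where
  "corr_kernel_swapped N \<nu> \<Gamma> s x t y =
     complex_of_real (sqrt (s * t)) / (2 * complex_of_real pi * \<i>)
       * (LINT \<mu>' | lborel.
            gauss t (- \<i> * complex_of_real y) (complex_of_real (t * \<mu>'))
              * contour_integral (\<Gamma> \<mu>') (\<lambda>\<mu>. gauss s (complex_of_real x) (complex_of_real s * \<mu>)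
                  * cauchy_factor N \<nu> \<mu> (\<i> * complex_of_real \<mu>')))
     - kernel_tail s x t y"

text \<open>The value \<open>\<mu>' = 0\<close> is exempted because 0 may itself be a point of the support.\<close>

definition contour_family :: "nat \<Rightarrow> (nat \<Rightarrow> real) \<Rightarrow> (real \<Rightarrow> real \<Rightarrow> complex) \<Rightarrow> bool" where
  "contour_family N \<nu> \<Gamma> \<longleftrightarrow>
     (\<forall>\<mu>'. \<mu>' \<noteq> 0 \<longrightarrow> encircles_once (\<Gamma> \<mu>') (supp_points N \<nu>) {\<i> * complex_of_real \<mu>'})"

definition Phi :: "nat \<Rightarrow> (nat \<Rightarrow> real) \<Rightarrow> nat \<Rightarrow> complex \<Rightarrow> complex" where
  "Phi N \<nu> j z =
     (\<Prod>k\<in>{..<N} - {j}. 1 - (z - complex_of_real (\<nu> j)) / complex_of_real (\<nu> k - \<nu> j))"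

definition corr_kernel_simple ::
    "nat \<Rightarrow> (nat \<Rightarrow> real) \<Rightarrow> real \<Rightarrow> real \<Rightarrow> real \<Rightarrow> real \<Rightarrow> complex" where
  "corr_kernel_simple N \<nu> s x t y =
     complex_of_real (sqrt (s * t))
       * (\<Sum>j<N. complex_of_real (gauss s x (s * \<nu> j))
           * (LINT \<mu>' | lborel.
                gauss t (- \<i> * complex_of_real y) (complex_of_real (t * \<mu>'))
                  * Phi N \<nu> j (\<i> * complex_of_real \<mu>')))
     - kernel_tail s x t y"

lemma contour_family_exists: "\<exists>\<Gamma>. contour_family N \<nu> \<Gamma>"
proof -
  define R where "R = 1 + (\<Sum>j<N. \<bar>\<nu> j\<bar>)"
  define \<Gamma> where "\<Gamma> = (\<lambda>u::real. rectpath (Complex (- R) (- (\<bar>u\<bar> / 2))) (Complex R (\<bar>u\<bar> / 2)))"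
  have R: "R > 0" by (simp add: R_def add_pos_nonneg sum_nonneg)
  have R': "\<bar>\<nu> j\<bar> < R" if "j < N" for j
  proof -
    have "\<bar>\<nu> j\<bar> \<le> (\<Sum>j<N. \<bar>\<nu> j\<bar>)"
      by (rule member_le_sum) (use that in auto)
    then show ?thesis by (simp add: R_def)
  qed
  have "encircles_once (\<Gamma> u) (supp_points N \<nu>) {\<i> * complex_of_real u}" if u: "u \<noteq> 0" for u
  proof -
    let ?a = "Complex (- R) (- (\<bar>u\<bar> / 2))" and ?b = "Complex R (\<bar>u\<bar> / 2)"
    have inner: "z \<in> box ?a ?b" if z: "z \<in> supp_points N \<nu>" for z
    proof -
      obtain j where j: "j < N" "z = complex_of_real (\<nu> j)"
        using z by (auto simp: supp_points_def)
      then show ?thesis using u R'[of j] by (auto simp: in_box_complex_iff)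
    qed
    have outer: "\<i> * complex_of_real u \<notin> cbox ?a ?b"
      using u by (auto simp: in_cbox_complex_iff)
    have im: "path_image (rectpath ?a ?b) = cbox ?a ?b - box ?a ?b"
      by (rule path_image_rectpath_cbox_minus_box) (use R in auto)
    have wn: "winding_number (rectpath ?a ?b) z = 1" if "z \<in> supp_points N \<nu>" for z
      by (rule winding_number_rectpath) (rule inner[OF that])
    have wn0: "winding_number (rectpath ?a ?b) (\<i> * complex_of_real u) = 0"
      by (rule winding_number_rectpath_outside) (use outer R in auto)
    show ?thesis
      unfolding encircles_once_def \<Gamma>_def using im inner outer wn wn0 by auto
  qed
  then show ?thesis unfolding contour_family_def by blast
qed

end

theory Submission
  imports Defs "HOL-Probability.Characteristic_Functions"
begin

text \<open>
  Telescoping writes the joint density as a product of determinants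
  \<open>det[R\<^sub>i(x\<^sup>(\<^sup>1\<^sup>))] \<Prod> det[P(x\<^sup>(\<^sup>m\<^sup>), x\<^sup>(\<^sup>m\<^sup>+\<^sup>1\<^sup>))] det[Q\<^sub>i(x\<^sup>(\<^sup>M\<^sup>))]\<close>, where after time inversion \<open>P\<close> is the heat
  semigroup, \<open>R\<^sub>i\<close> is the backward heat flow of the Newton polynomial with nodes \<open>\<nu>\<close>, and \<open>Q\<^sub>i\<close> is a divided
  difference of the heat kernel with respect to its starting point.  These families are biorthogonal, since
  divided differences are dual to Newton polynomials, so that the product equals \<open>det K\<close> for
  \<open>K = \<Sum> Q\<^sub>k R\<^sub>k - P\<close>, and the reproducing relations of \<open>Q\<close>, \<open>R\<close>, \<open>P\<close> allow one to integrate out one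
  particle at a time.  Writing the divided differences as contour integrals turns \<open>K\<close> into the kernel of the
  proposition; multiple drifts need no separate treatment, because the contour integrals
  depend continuously on the nodes.
\<close>

section \<open>Determinants over finite index sets\<close>

text \<open>Two obstacles shape the proof. (a) At the origin, and at coinciding drifts, the
  transition density is only a limit of quotients of determinants that tend to 0. Cancelling
  Vandermonde products turns the values at the nodes into divided differences over one fixed circle
  about 0, inside which the nodes may merge. The limit is then the value of a continuous function,
  provided that the remaining denominator is nonzero; this is why zeros of exponential sums have to
  be counted with multiplicity. (b) Joint integrability of the density in many variables is never
  estimated. One-dimensional Gaussian bounds suffice: the determinant over all indices is the joint
  density, hence nonnegative; the sign descends to fewer particles, and the iterated integrals are
  merged by Tonelli. Backward heat flow is harmless because it acts on polynomials only. The
  imaginary arguments \<open>- \<i> y\<close> and \<open>\<i> \<mu>'\<close> in the kernel come from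
  its representation as a Gaussian integral.\<close>

definition ldet :: "'i set \<Rightarrow> ('i \<Rightarrow> 'i \<Rightarrow> 'a::comm_ring_1) \<Rightarrow> 'a" where
  "ldet S f = (\<Sum>p | p permutes S. of_int (sign p) * (\<Prod>i\<in>S. f i (p i)))"

lemma ldet_cong:
  assumes "\<And>a b. a \<in> S \<Longrightarrow> b \<in> S \<Longrightarrow> f a b = g a b"
  shows "ldet S f = ldet S g"
  unfolding ldet_def
  by (intro sum.cong refl arg_cong2[where f="(*)"] prod.cong)
     (auto simp: assms permutes_in_image)

lemma det_fun_eq_ldet: "det_fun n f = ldet {..<n} f"
  unfolding det_fun_def ldet_def Determinant.det_def
  by (auto simp: atLeast0LessThan intro!: sum.cong prod.cong arg_cong2[where f="(*)"])

lemma det_fun_cong: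
  assumes "\<And>a b. a < n \<Longrightarrow> b < n \<Longrightarrow> f a b = g a b"
  shows "det_fun n f = det_fun n g"
  unfolding det_fun_eq_ldet by (rule ldet_cong) (auto intro: assms)

text \<open>Conjugation by \<open>h\<close> carries the permutations of \<open>S\<close> bijectively
  to those of \<open>T\<close> and preserves the sign.\<close>

lemma ldet_reindex:
  assumes h: "bij_betw h S T" and fin: "finite S"
  shows "ldet T f = ldet S (\<lambda>a b. f (h a) (h b))"
proof -
  let ?F = "\<lambda>p x. if x \<in> T then h (p (inv_into S h x)) else x"
  have eq: "of_int (sign (?F p)) * (\<Prod>i\<in>T. f i (?F p i)) =
        of_int (sign p) * (\<Prod>i\<in>S. f (h i) (h (p i)))" if p: "p permutes S" for p
  proof -
    interpret permutes_bij_finite p S T h "inv_into S h" "?F p"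
      by unfold_locales (use p h fin in \<open>auto simp: bij_betw_def fun_eq_iff\<close>)
    have "(\<Prod>i\<in>T. f i (?F p i)) = (\<Prod>i\<in>S. f (h i) (?F p (h i)))"
      by (rule prod.reindex_bij_betw[OF h, symmetric])
    also have "\<dots> = (\<Prod>i\<in>S. f (h i) (h (p i)))"
      using h by (intro prod.cong) (auto simp: bij_betw_def)
    finally show ?thesis using sign_p' by simp
  qed
  have "ldet T f = (\<Sum>p | p permutes S. of_int (sign (?F p)) * (\<Prod>i\<in>T. f i (?F p i)))"
    unfolding ldet_def by (rule sum.reindex_bij_betw[OF bij_betw_permutations[OF h], symmetric])
  also have "\<dots> = ldet S (\<lambda>a b. f (h a) (h b))"
    unfolding ldet_def by (intro sum.cong refl) (use eq in auto)
  finally show ?thesis .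
qed

lemma ldet_scale:
  assumes "finite S"
  shows "ldet S (\<lambda>a b. r a * f a b * c b) = (\<Prod>a\<in>S. r a) * (\<Prod>b\<in>S. c b) * ldet S f"
proof -
  have "(\<Prod>i\<in>S. r i * f i (p i) * c (p i)) = (\<Prod>a\<in>S. r a) * (\<Prod>b\<in>S. c b) * (\<Prod>i\<in>S. f i (p i))"
    if "p permutes S" for p
    using prod.permute[OF that, of c] by (simp add: prod.distrib o_def algebra_simps)
  then show ?thesis
    unfolding ldet_def sum_distrib_left by (intro sum.cong refl) (auto simp: algebra_simps)
qed

lemma ldet_of_real: "of_real (ldet S f) = ldet S (\<lambda>a b. of_real (f a b))"
  unfolding ldet_def by simp

lemma det_fun_transpose: "det_fun n f = det_fun n (\<lambda>a b. f b a)"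
proof -
  have "Matrix.mat n n (\<lambda>(a, b). f b a) = transpose_mat (Matrix.mat n n (\<lambda>(a, b). f a b))"
    by (rule eq_matI) auto
  then show ?thesis
    unfolding det_fun_def by (metis det_transpose mat_carrier)
qed

lemma det_fun_mult:
  "det_fun n (\<lambda>i j. \<Sum>k<n. f i k * g k j) = det_fun n f * det_fun n g"
proof -
  have "Matrix.mat n n (\<lambda>(i, j). \<Sum>k<n. f i k * g k j) =
      Matrix.mat n n (\<lambda>(i, j). f i j) * Matrix.mat n n (\<lambda>(i, j). g i j)"
    by (rule eq_matI) (auto simp: scalar_prod_def atLeast0LessThan intro!: sum.cong)
  then show ?thesis
    unfolding det_fun_def by (metis Determinant.det_mult mat_carrier)
qed

lemma det_fun_lower_triangular:
  assumes "\<And>i k. i < k \<Longrightarrow> k < n \<Longrightarrow> L i k = 0"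
  shows "det_fun n L = (\<Prod>i<n. L i i)"
proof -
  have "det_fun n L = prod_list (diag_mat (Matrix.mat n n (\<lambda>(j, k). L j k)))"
    unfolding det_fun_def by (rule det_lower_triangular[where n=n]) (use assms in auto)
  also have "\<dots> = (\<Prod>i<n. L i i)"
    by (simp add: diag_mat_def prod.list_conv_set_nth atLeast0LessThan)
  finally show ?thesis .
qed

text \<open>The form in which triangular changes of basis enter: from divided differences to values
  at the nodes, and from heat-evolved Newton polynomials to monomials.\<close>

lemma det_fun_triangular_mult:
  assumes "\<And>i k. i < k \<Longrightarrow> k < n \<Longrightarrow> L i k = 0"
  shows "det_fun n (\<lambda>i j. \<Sum>k<n. L i k * f k j) = (\<Prod>i<n. L i i) * det_fun n f"
  by (simp add: det_fun_mult det_fun_lower_triangular[OF assms])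

text \<open>Needed for configurations in which two particles occupy the same place at the same
  time.\<close>

lemma ldet_equal_rows:
  assumes "finite S" "a \<in> S" "b \<in> S" "a \<noteq> b" and eq: "\<And>c. c \<in> S \<Longrightarrow> f a c = f b c"
  shows "ldet S f = 0"
proof -
  obtain h where h: "bij_betw h {..<card S} S"
    using ex_bij_betw_nat_finite[OF assms(1)] by (auto simp: atLeast0LessThan)
  let ?n = "card S"
  let ?A = "Matrix.mat ?n ?n (\<lambda>(i, j). f (h i) (h j))"
  obtain i j where ij: "i < ?n" "j < ?n" "h i = a" "h j = b"
    using h assms(2,3) unfolding bij_betw_def by (metis imageE lessThan_iff)
  have "Determinant.det ?A = 0"
  proof (rule det_identical_rows[where n = ?n and i = i and j = j])
    show "row ?A i = row ?A j"
    proof (rule eq_vecI)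
      fix k assume "k < dim_vec (row ?A j)"
      then have k: "k < ?n" by simp
      then have "h k \<in> S" using h by (auto simp: bij_betw_def)
      then show "row ?A i $ k = row ?A j $ k" using k ij eq by simp
    qed simp
  qed (use ij assms in auto)
  then have "det_fun ?n (\<lambda>i j. f (h i) (h j)) = 0" by (simp add: det_fun_def)
  then show ?thesis by (simp add: ldet_reindex[OF h] det_fun_eq_ldet)
qed

text \<open>Each permutation of \<open>insert a S\<close> is uniquely \<open>transpose a b\<close>
  composed with a permutation \<open>p\<close> of \<open>S\<close>. For \<open>b = a\<close> the new
  index is a fixed point; otherwise it splits the arrow \<open>c \<mapsto> b\<close> of
  \<open>p\<close> into \<open>c \<mapsto> a \<mapsto> b\<close>, which flips the sign.\<close>

lemma ldet_insert:
  assumes fin: "finite S" and a: "a \<notin> S"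
  shows "ldet (insert a S) f = f a a * ldet S f
    - (\<Sum>p | p permutes S. of_int (sign p) *
         (\<Sum>c\<in>S. f c a * f a (p c) * (\<Prod>i\<in>S - {c}. f i (p i))))"
proof -
  let ?t = "\<lambda>p::'a \<Rightarrow> 'a. of_int (sign p) * (\<Prod>i\<in>insert a S. f i (p i))"
  have 1: "?t (Transposition.transpose a a \<circ> p) = f a a * (of_int (sign p) * (\<Prod>i\<in>S. f i (p i)))"
    if p: "p permutes S" for p
  proof -
    have "p a = a" using p a by (simp add: permutes_not_in)
    then show ?thesis using fin a by simp
  qed
  have 2: "?t (Transposition.transpose a (p c) \<circ> p) =
      - (of_int (sign p) * (f c a * f a (p c) * (\<Prod>i\<in>S - {c}. f i (p i))))"
    if p: "p permutes S" and c: "c \<in> S" for p c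
  proof -
    have pa: "p a = a" using p a by (simp add: permutes_not_in)
    have pc: "p c \<in> S" using p c by (simp add: permutes_in_image)
    have nm: "Transposition.transpose a (p c) (p i) = p i" if "i \<in> S - {c}" for i
    proof -
      have "p i \<in> S" using p that by (simp add: permutes_in_image)
      moreover have "p i \<noteq> p c" using permutes_inj[OF p] that by (auto dest: injD)
      ultimately show ?thesis using a by (auto simp: Transposition.transpose_def)
    qed
    have s: "sign (Transposition.transpose a (p c) \<circ> p) = - sign p"
      using pc a p fin
      by (subst sign_compose) (auto simp: sign_swap_id intro: permutation_swap_id permutation_permutes[THEN iffD2])
    have "(\<Prod>i\<in>insert a S. f i ((Transposition.transpose a (p c) \<circ> p) i)) =
        f a (p c) * (f c a * (\<Prod>i\<in>S - {c}. f i (p i)))"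
      unfolding prod.insert[OF fin a] prod.remove[OF fin c] using a c pa nm by simp
    then show ?thesis by (simp add: s algebra_simps)
  qed
  have "ldet (insert a S) f =
      (\<Sum>p | p permutes S. ?t (Transposition.transpose a a \<circ> p)) +
      (\<Sum>b\<in>S. \<Sum>p | p permutes S. ?t (Transposition.transpose a b \<circ> p))"
    unfolding ldet_def using fin a by (subst sum_over_permutations_insert) auto
  also have "(\<Sum>p | p permutes S. ?t (Transposition.transpose a a \<circ> p)) = f a a * ldet S f"
    unfolding ldet_def sum_distrib_left by (intro sum.cong refl) (use 1 in auto)
  also have "(\<Sum>b\<in>S. \<Sum>p | p permutes S. ?t (Transposition.transpose a b \<circ> p)) =
      (\<Sum>p | p permutes S. \<Sum>b\<in>S. ?t (Transposition.transpose a b \<circ> p))"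
    by (rule sum.swap)
  \<comment> \<open>The arrow that is split is now indexed by its source \<open>c\<close> instead of
    its target \<open>b = p c\<close>.\<close>
  also have "\<dots> = (\<Sum>p | p permutes S. \<Sum>c\<in>S. ?t (Transposition.transpose a (p c) \<circ> p))"
    by (intro sum.cong refl sum.reindex_bij_betw[symmetric]) (auto intro: permutes_imp_bij)
  also have "\<dots> = (\<Sum>p | p permutes S. - (of_int (sign p) *
         (\<Sum>c\<in>S. f c a * f a (p c) * (\<Prod>i\<in>S - {c}. f i (p i)))))"
    unfolding sum_distrib_left sum_negf[symmetric] by (intro sum.cong refl) (use 2 in auto)
  finally show ?thesis by (simp add: sum_negf)
qed

text \<open>By induction on the number of blocks: the last block row vanishes left of its diagonal
  block, so that block splits off as a factor.\<close>

lemma det_fun_block_triangular: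
  fixes f :: "nat \<Rightarrow> nat \<Rightarrow> 'a::idom"
  assumes "\<And>i j. i < K * N \<Longrightarrow> j < K * N \<Longrightarrow> j div N < i div N \<Longrightarrow> f i j = 0"
  shows "det_fun (K * N) f = (\<Prod>b<K. det_fun N (\<lambda>i j. f (b * N + i) (b * N + j)))"
  using assms
proof (induction K)
  case 0
  then show ?case by (simp add: det_fun_def Determinant.det_def)
next
  case (Suc K)
  let ?A = "Matrix.mat (K * N) (K * N) (\<lambda>(i, j). f i j)"
  let ?B = "Matrix.mat (K * N) N (\<lambda>(i, j). f i (K * N + j))"
  let ?D = "Matrix.mat N N (\<lambda>(i, j). f (K * N + i) (K * N + j))"
  have "Matrix.mat (Suc K * N) (Suc K * N) (\<lambda>(i, j). f i j) = four_block_mat ?A ?B (0\<^sub>m N (K * N)) ?D"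
  proof (rule eq_matI)
    fix i j assume "i < dim_row (four_block_mat ?A ?B (0\<^sub>m N (K * N)) ?D)"
      "j < dim_col (four_block_mat ?A ?B (0\<^sub>m N (K * N)) ?D)"
    then have ij: "i < K * N + N" "j < K * N + N" by auto
    have "f i j = 0" if "\<not> i < K * N" "j < K * N"
    proof (rule Suc.prems)
      have "N > 0" using that ij by (cases N) auto
      then have "K \<le> i div N" using that by (simp add: less_eq_div_iff_mult_less_eq)
      moreover have "j div N < K" using that by (simp add: less_mult_imp_div_less)
      ultimately show "j div N < i div N" by simp
    qed (use ij in auto)
    then show "Matrix.mat (Suc K * N) (Suc K * N) (\<lambda>(i, j). f i j) $$ (i, j) =
        four_block_mat ?A ?B (0\<^sub>m N (K * N)) ?D $$ (i, j)"
      using ij by (auto simp: algebra_simps)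
  qed (auto simp: algebra_simps)
  then have "det_fun (Suc K * N) f = Determinant.det (four_block_mat ?A ?B (0\<^sub>m N (K * N)) ?D)"
    unfolding det_fun_def by (rule arg_cong)
  also have "\<dots> = Determinant.det ?A * Determinant.det ?D"
    by (rule det_four_block_mat_lower_left_zero[where n = "K * N" and m = N]) auto
  also have "Determinant.det ?A = (\<Prod>b<K. det_fun N (\<lambda>i j. f (b * N + i) (b * N + j)))"
    unfolding det_fun_def[symmetric] by (rule Suc.IH) (use Suc.prems in auto)
  finally show ?case by (simp add: det_fun_def)
qed

text \<open>
  Both sides are the determinant of the bordered matrix with blocks \<open>1\<close>, \<open>r\<close>, \<open>q\<close>, \<open>T\<close>: the
  Schur complement of \<open>1\<close> gives the left hand side up to sign, and moving the border columns
  to the end makes the matrix block triangular.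
\<close>

lemma det_fun_bordered:
  fixes q r T :: "nat \<Rightarrow> nat \<Rightarrow> 'a::idom"
  assumes M: "M \<ge> 1"
    and T: "\<And>a b. a < M * N \<Longrightarrow> b < M * N \<Longrightarrow> b div N \<le> a div N \<Longrightarrow> T a b = 0"
  shows "det_fun (M * N) (\<lambda>a b. (\<Sum>k<N. q a k * r k b) - T a b) =
    det_fun N r * (\<Prod>m<M - 1. det_fun N (\<lambda>i j. T (m * N + i) (Suc m * N + j)))
      * det_fun N (\<lambda>i j. q ((M - 1) * N + i) j)"
proof -
  let ?n = "M * N"
  define R where "R = Matrix.mat N ?n (\<lambda>(k, b). r k b)"
  define Q where "Q = Matrix.mat ?n N (\<lambda>(a, k). q a k)"
  define X where "X = Matrix.mat ?n ?n (\<lambda>(a, b). T a b)"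
  define Y where "Y = Matrix.mat ?n ?n (\<lambda>(a, b). T a b - (\<Sum>k<N. q a k * r k b))"
  have dims: "R \<in> carrier_mat N ?n" "Q \<in> carrier_mat ?n N" "X \<in> carrier_mat ?n ?n" "Y \<in> carrier_mat ?n ?n"
    by (auto simp: R_def Q_def X_def Y_def)
  define G where "G = four_block_mat (1\<^sub>m N) R Q X"
  have G: "G \<in> carrier_mat (N + ?n) (N + ?n)" using dims by (auto simp: G_def)
  have "Q * R + Y = X"
    by (rule eq_matI)
       (auto simp: Q_def R_def X_def Y_def scalar_prod_def atLeast0LessThan intro!: sum.cong)
  \<comment> \<open>Block elimination with the identity as pivot. The Schur complement
    \<open>Y\<close> is minus the matrix of the claim, which produces the sign
    \<open>(-1) ^ ?n\<close> below.\<close>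
  then have "G = four_block_mat (1\<^sub>m N) (0\<^sub>m N ?n) Q (1\<^sub>m ?n) * four_block_mat (1\<^sub>m N) R (0\<^sub>m ?n N) Y"
    unfolding G_def using dims
    by (subst mult_four_block_mat) auto
  then have "Determinant.det G = Determinant.det (four_block_mat (1\<^sub>m N) (0\<^sub>m N ?n) Q (1\<^sub>m ?n))
      * Determinant.det (four_block_mat (1\<^sub>m N) R (0\<^sub>m ?n N) Y)"
    using dims by (simp only:) (rule Determinant.det_mult[where n = "N + ?n"], auto)
  also have "Determinant.det (four_block_mat (1\<^sub>m N) (0\<^sub>m N ?n) Q (1\<^sub>m ?n)) = 1"
    using dims by (subst det_four_block_mat_upper_right_zero[where n = N and m = "?n"]) auto
  also have "Determinant.det (four_block_mat (1\<^sub>m N) R (0\<^sub>m ?n N) Y) = Determinant.det Y"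
    using dims by (subst det_four_block_mat_lower_left_zero[where n = N and m = "?n"]) auto
  also have "Determinant.det Y = (-1) ^ ?n * det_fun ?n (\<lambda>a b. (\<Sum>k<N. q a k * r k b) - T a b)"
  proof -
    have "Y = (- 1) \<cdot>\<^sub>m Matrix.mat ?n ?n (\<lambda>(a, b). (\<Sum>k<N. q a k * r k b) - T a b)"
      by (rule eq_matI) (auto simp: Y_def)
    then show ?thesis by (simp add: det_fun_def)
  qed
  finally have 1: "Determinant.det G = (-1) ^ ?n * det_fun ?n (\<lambda>a b. (\<Sum>k<N. q a k * r k b) - T a b)"
    by simp
  \<comment> \<open>Row block 0 of \<open>g\<close> is the border and row block \<open>Suc m\<close>
    is time \<open>m\<close>; column block \<open>m\<close> is time \<open>m\<close> and the last
    column block is the border. This offset puts \<open>r\<close> at time 0, the one-step blocks of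
    \<open>T\<close> and \<open>q\<close> at the last time on the diagonal, and everything below it
    is 0.\<close>
  define g where "g = (\<lambda>i j. G $$ (i, if j < ?n then j + N else if j < N + ?n then j - ?n else j))"
  \<comment> \<open>The transpose turns the shift of columns into the shift of initial rows whose
    sign is available.\<close>
  have "Determinant.det G = Determinant.det (transpose_mat G)" using det_transpose[OF G] by simp
  also have "\<dots> = (-1) ^ (N * ?n) * det_fun (N + ?n) (\<lambda>i j. g j i)"
  proof -
    have "Matrix.mat (N + ?n) (N + ?n) (\<lambda>(i, j). transpose_mat G $$
          (if i < ?n then i + N else if i < N + ?n then i - ?n else i, j)) =
        Matrix.mat (N + ?n) (N + ?n) (\<lambda>(i, j). g j i)"
      using G by (intro eq_matI) (auto simp: g_def)
    then show ?thesis
      using det_swap_initial_rows[of "transpose_mat G" "N + ?n" N ?n] G by (simp add: det_fun_def)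
  qed
  also have "det_fun (N + ?n) (\<lambda>i j. g j i) = det_fun (Suc M * N) g"
    by (subst det_fun_transpose) simp
  also have "\<dots> = (\<Prod>b<Suc M. det_fun N (\<lambda>i j. g (b * N + i) (b * N + j)))"
  proof (rule det_fun_block_triangular)
    fix i j assume ij: "i < Suc M * N" "j < Suc M * N" "j div N < i div N"
    then have N: "N > 0" by (cases N) auto
    have "i div N < Suc M" using ij N by (simp add: less_mult_imp_div_less)
    then have "j div N < M" using ij by simp
    then have j: "j < ?n" using N by (simp add: div_less_iff_less_mult)
    have "i \<ge> N" using ij(3) by (rule contrapos_pp) simp
    then obtain i' where i': "i = i' + N" using le_Suc_ex[of N i] by (auto simp: add.commute)
    then have "i' < ?n" "j div N \<le> i' div N" using ij N by auto
    then have "T i' j = 0" using T j by blast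
    then show "g i j = 0" using i' \<open>i' < ?n\<close> j dims by (auto simp: g_def G_def X_def)
  qed
  also have "\<dots> = det_fun N r * (\<Prod>m<M - 1. det_fun N (\<lambda>i j. T (m * N + i) (Suc m * N + j)))
      * det_fun N (\<lambda>i j. q ((M - 1) * N + i) j)"
  proof -
    obtain L where L: "M = Suc L" using M by (cases M) auto
    have lt: "m * N + i < ?n" if "m < M" "i < N" for m i
    proof -
      have "m * N + i < Suc m * N" using that by simp
      also have "\<dots> \<le> M * N" using that by (intro mult_le_mono1) simp
      finally show ?thesis .
    qed
    have b0: "det_fun N (\<lambda>i j. g (0 * N + i) (0 * N + j)) = det_fun N r"
      using lt[of 0] M by (intro det_fun_cong) (auto simp: g_def G_def R_def X_def Q_def)
    have bm: "det_fun N (\<lambda>i j. g (Suc m * N + i) (Suc m * N + j)) =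
        det_fun N (\<lambda>i j. T (m * N + i) (Suc m * N + j))" if "m < L" for m
      using lt[of "Suc m"] lt[of m] that L
      by (intro det_fun_cong) (auto simp: g_def G_def R_def X_def Q_def algebra_simps)
    have bL: "det_fun N (\<lambda>i j. g (Suc L * N + i) (Suc L * N + j)) = det_fun N (\<lambda>i j. q (L * N + i) j)"
      using lt[of L] L by (intro det_fun_cong) (auto simp: g_def G_def R_def X_def Q_def algebra_simps)
    have "(\<Prod>b<Suc M. det_fun N (\<lambda>i j. g (b * N + i) (b * N + j))) =
      det_fun N (\<lambda>i j. g (0 * N + i) (0 * N + j)) *
      (\<Prod>m<L. det_fun N (\<lambda>i j. g (Suc m * N + i) (Suc m * N + j))) *
      det_fun N (\<lambda>i j. g (Suc L * N + i) (Suc L * N + j))"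
      unfolding L by (subst prod.lessThan_Suc_shift) (simp del: mult_Suc)
    then show ?thesis using b0 bm bL L by (simp del: mult_Suc)
  qed
  finally have 2: "Determinant.det G = (-1) ^ (N * ?n) *
     (det_fun N r * (\<Prod>m<M - 1. det_fun N (\<lambda>i j. T (m * N + i) (Suc m * N + j)))
      * det_fun N (\<lambda>i j. q ((M - 1) * N + i) j))" .
  \<comment> \<open>As \<open>?n\<close> is a multiple of \<open>N\<close>, it can be odd only if
    \<open>N\<close> is. Hence the sign of the column shift equals the sign of the Schur complement,
    and the two cancel.\<close>
  have "even (N * ?n) = even ?n" by auto
  then have s: "(-1::'a) ^ (N * ?n) = (-1) ^ ?n" by (simp add: minus_one_power_iff)
  have "(-1::'a) ^ ?n \<noteq> 0" by simp
  moreover have "(-1) ^ ?n * det_fun ?n (\<lambda>a b. (\<Sum>k<N. q a k * r k b) - T a b) = (-1) ^ ?n *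
     (det_fun N r * (\<Prod>m<M - 1. det_fun N (\<lambda>i j. T (m * N + i) (Suc m * N + j)))
      * det_fun N (\<lambda>i j. q ((M - 1) * N + i) j))"
    unfolding 1[symmetric] 2 s ..
  ultimately show ?thesis by (simp only: mult_cancel_left) simp
qed

section \<open>The Eynard-Mehta theorem\<close>

lemma bij_betw_divmod:
  assumes "N > (0::nat)"
  shows "bij_betw (\<lambda>a. (a div N, a mod N)) {..<M * N} ({..<M} \<times> {..<N})"
proof (rule bij_betw_byWitness[where f' = "\<lambda>(m, i). m * N + i"])
  show "(\<lambda>(m, i). m * N + i) ` ({..<M} \<times> {..<N}) \<subseteq> {..<M * N}"
  proof safe
    fix m i assume "m < M" "i < N"
    then have "m * N + i < Suc m * N" by simp
    also have "\<dots> \<le> M * N" using \<open>m < M\<close> by (intro mult_le_mono1) simp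
    finally show "m * N + i < M * N" .
  qed
qed (use assms in \<open>auto simp: less_mult_imp_div_less\<close>)

text \<open>\<open>P\<close> propagates \<open>R\<close> forward and \<open>Q\<close> backward in
  time, and the two families are biorthogonal at each time. All assumptions are integrals in one
  real variable and no sign is imposed; positivity enters later through
  \<open>nonneg_det\<close>.\<close>

locale eynard_mehta =
  fixes N M :: nat
    and Q R :: "nat \<Rightarrow> nat \<Rightarrow> real \<Rightarrow> complex"
    and P :: "nat \<Rightarrow> nat \<Rightarrow> real \<Rightarrow> real \<Rightarrow> complex"
  assumes measurable_Q: "m < M \<Longrightarrow> k < N \<Longrightarrow> Q m k \<in> borel_measurable borel"
    and measurable_R: "m < M \<Longrightarrow> k < N \<Longrightarrow> R m k \<in> borel_measurable borel"
    and measurable_P: "m < n \<Longrightarrow> n < M \<Longrightarrow>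
      (\<lambda>(x, y). P m n x y) \<in> borel_measurable (borel \<Otimes>\<^sub>M borel)"
    and RQ: "m < M \<Longrightarrow> k < N \<Longrightarrow> l < N \<Longrightarrow>
      has_bochner_integral lborel (\<lambda>z. R m k z * Q m l z) (if k = l then 1 else 0)"
    and RP: "m < n \<Longrightarrow> n < M \<Longrightarrow> k < N \<Longrightarrow>
      has_bochner_integral lborel (\<lambda>z. R m k z * P m n z y) (R n k y)"
    and PQ: "m < n \<Longrightarrow> n < M \<Longrightarrow> k < N \<Longrightarrow>
      has_bochner_integral lborel (\<lambda>z. P m n x z * Q n k z) (Q m k x)"
    and PP: "l < m \<Longrightarrow> m < n \<Longrightarrow> n < M \<Longrightarrow>
      has_bochner_integral lborel (\<lambda>z. P l m x z * P m n z y) (P l n x y)"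
begin

text \<open>The extended kernel. At equal times there is no \<open>P\<close> term, so that
  \<open>ker m m\<close> is the projection onto the span of the \<open>Q m k\<close> along the
  \<open>R m k\<close>.\<close>

definition ker :: "nat \<Rightarrow> nat \<Rightarrow> real \<Rightarrow> real \<Rightarrow> complex" where
  "ker m n x y = (\<Sum>k<N. Q m k x * R n k y) - (if m < n then P m n x y else 0)"

definition ker_det :: "(nat \<times> nat) set \<Rightarrow> (nat \<times> nat \<Rightarrow> real) \<Rightarrow> complex" where
  "ker_det S w = ldet S (\<lambda>a b. ker (fst a) (fst b) (w a) (w b))"

text \<open>Let \<open>?S\<close> be the sum part of the result. The four products of parts
  integrate to \<open>?S\<close>, to \<open>?S\<close> if \<open>m < n\<close>, to \<open>?S\<close>
  if \<open>l < m\<close>, and to \<open>P l n x y\<close> if \<open>l < m < n\<close>. This is the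
  claimed multiple of \<open>ker l n x y\<close>: if \<open>l < n\<close>, the factor is nonzero
  only for \<open>l < m < n\<close>, where it is -1.\<close>

lemma ker_compose:
  assumes "l < M" "m < M" "n < M"
  shows "has_bochner_integral lborel (\<lambda>z. ker l m x z * ker m n z y)
    (((if m \<le> l then 1 else 0) - (if m < n then 1 else 0)) * ker l n x y)"
proof -
  let ?S = "\<Sum>k<N. Q l k x * R n k y"
  \<comment> \<open>\<open>A\<close>, \<open>B\<close> stand for the sum and the \<open>P\<close>
    part of the left factor, \<open>C\<close>, \<open>D\<close> for those of the right
    factor.\<close>
  have AC: "has_bochner_integral lborel
      (\<lambda>z. \<Sum>k<N. \<Sum>k'<N. (Q l k x * R n k' y) * (R m k z * Q m k' z))
      (\<Sum>k<N. \<Sum>k'<N. (Q l k x * R n k' y) * (if k = k' then 1 else 0))"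
    by (intro has_bochner_integral_sum has_bochner_integral_mult_right RQ) (use assms in auto)
  have AD: "has_bochner_integral lborel
      (\<lambda>z. \<Sum>k<N. Q l k x * (R m k z * (if m < n then P m n z y else 0)))
      (\<Sum>k<N. Q l k x * (if m < n then R n k y else 0))"
    by (intro has_bochner_integral_sum has_bochner_integral_mult_right)
       (use assms RP in auto)
  have BC: "has_bochner_integral lborel
      (\<lambda>z. \<Sum>k<N. ((if l < m then P l m x z else 0) * Q m k z) * R n k y)
      (\<Sum>k<N. (if l < m then Q l k x else 0) * R n k y)"
    by (intro has_bochner_integral_sum has_bochner_integral_mult_left)
       (use assms PQ in auto)
  have BD: "has_bochner_integral lborel
      (\<lambda>z. (if l < m then P l m x z else 0) * (if m < n then P m n z y else 0))
      (if l < m \<and> m < n then P l n x y else 0)"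
    using assms PP by auto
  have "has_bochner_integral lborel
      (\<lambda>z. (\<Sum>k<N. \<Sum>k'<N. (Q l k x * R n k' y) * (R m k z * Q m k' z))
        - (\<Sum>k<N. Q l k x * (R m k z * (if m < n then P m n z y else 0)))
        - (\<Sum>k<N. ((if l < m then P l m x z else 0) * Q m k z) * R n k y)
        + (if l < m then P l m x z else 0) * (if m < n then P m n z y else 0))
      ((\<Sum>k<N. \<Sum>k'<N. (Q l k x * R n k' y) * (if k = k' then 1 else 0))
        - (\<Sum>k<N. Q l k x * (if m < n then R n k y else 0))
        - (\<Sum>k<N. (if l < m then Q l k x else 0) * R n k y)
        + (if l < m \<and> m < n then P l n x y else 0))"
    by (intro has_bochner_integral_add has_bochner_integral_diff AC AD BC BD)
  also have "(\<lambda>z. (\<Sum>k<N. \<Sum>k'<N. (Q l k x * R n k' y) * (R m k z * Q m k' z))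
        - (\<Sum>k<N. Q l k x * (R m k z * (if m < n then P m n z y else 0)))
        - (\<Sum>k<N. ((if l < m then P l m x z else 0) * Q m k z) * R n k y)
        + (if l < m then P l m x z else 0) * (if m < n then P m n z y else 0)) =
      (\<lambda>z. ker l m x z * ker m n z y)"
  proof
    fix z
    have "(\<Sum>k<N. \<Sum>k'<N. (Q l k x * R n k' y) * (R m k z * Q m k' z)) =
        (\<Sum>k<N. Q l k x * R m k z) * (\<Sum>k'<N. Q m k' z * R n k' y)"
      unfolding sum_product by (intro sum.cong refl) (simp add: algebra_simps)
    moreover have "(\<Sum>k<N. Q l k x * (R m k z * (if m < n then P m n z y else 0))) =
        (\<Sum>k<N. Q l k x * R m k z) * (if m < n then P m n z y else 0)"
      unfolding sum_distrib_right by (intro sum.cong refl) (simp add: algebra_simps)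
    moreover have "(\<Sum>k<N. ((if l < m then P l m x z else 0) * Q m k z) * R n k y) =
        (if l < m then P l m x z else 0) * (\<Sum>k<N. Q m k z * R n k y)"
      unfolding sum_distrib_left by (intro sum.cong refl) (simp add: algebra_simps)
    ultimately show "(\<Sum>k<N. \<Sum>k'<N. (Q l k x * R n k' y) * (R m k z * Q m k' z))
        - (\<Sum>k<N. Q l k x * (R m k z * (if m < n then P m n z y else 0)))
        - (\<Sum>k<N. ((if l < m then P l m x z else 0) * Q m k z) * R n k y)
        + (if l < m then P l m x z else 0) * (if m < n then P m n z y else 0) =
      ker l m x z * ker m n z y"
      unfolding ker_def by (simp only:) (simp add: algebra_simps)
  qed
  also have "(\<Sum>k<N. \<Sum>k'<N. (Q l k x * R n k' y) * (if k = k' then 1 else 0))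
        - (\<Sum>k<N. Q l k x * (if m < n then R n k y else 0))
        - (\<Sum>k<N. (if l < m then Q l k x else 0) * R n k y)
        + (if l < m \<and> m < n then P l n x y else 0) =
      ((if m \<le> l then 1 else 0) - (if m < n then 1 else 0)) * ker l n x y"
  proof -
    have "(\<Sum>k<N. \<Sum>k'<N. (Q l k x * R n k' y) * (if k = k' then 1 else 0)) = ?S"
      by (intro sum.cong refl) (simp add: if_distrib[of "\<lambda>c. _ * c"] cong: if_cong)
    moreover have "(\<Sum>k<N. Q l k x * (if m < n then R n k y else 0)) = (if m < n then ?S else 0)"
      by simp
    moreover have "(\<Sum>k<N. (if l < m then Q l k x else 0) * R n k y) = (if l < m then ?S else 0)"
      by simp
    ultimately show ?thesis by (simp add: ker_def)
  qed
  finally show ?thesis .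
qed

text \<open>
  In the Leibniz expansion the new index \<open>a\<close> is a fixed point or is inserted into an arrow \<open>c \<mapsto> p c\<close>.
  By \<open>ker_compose\<close> integration removes it from the arrow and leaves a factor depending on the times of
  \<open>c\<close> and \<open>p c\<close>; summed over \<open>c\<close>, these factors count the indices at the time of \<open>a\<close>.
\<close>

lemma ker_det_integral:
  assumes fin: "finite S" and a: "a \<notin> S" "fst a < M" and S: "\<And>b. b \<in> S \<Longrightarrow> fst b < M"
  shows "has_bochner_integral lborel (\<lambda>z. ker_det (insert a S) (w(a := z)))
    ((of_nat N - of_nat (card {b\<in>S. fst b = fst a})) * ker_det S w)"
proof -
  let ?m = "fst a"
  let ?f = "\<lambda>z b c. ker (fst b) (fst c) ((w(a := z)) b) ((w(a := z)) c)"
  let ?k = "\<lambda>b c. ker (fst b) (fst c) (w b) (w c)"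
  let ?chi = "\<lambda>b c. ((if ?m \<le> fst b then 1 else 0) - (if ?m < fst c then 1 else 0)) :: complex"
  have na: "b \<noteq> a" if "b \<in> S" for b using that a by auto
  have eq: "ker_det (insert a S) (w(a := z)) = ker ?m ?m z z * ker_det S w
    - (\<Sum>p | p permutes S. of_int (sign p) *
         (\<Sum>c\<in>S. (ker (fst c) ?m (w c) z * ker ?m (fst (p c)) z (w (p c))) * (\<Prod>i\<in>S - {c}. ?k i (p i))))"
    for z
  proof -
    have "ldet S (?f z) = ker_det S w"
      unfolding ker_det_def by (rule ldet_cong) (use na in auto)
    moreover have "(\<Sum>c\<in>S. ?f z c a * ?f z a (p c) * (\<Prod>i\<in>S - {c}. ?f z i (p i))) =
        (\<Sum>c\<in>S. (ker (fst c) ?m (w c) z * ker ?m (fst (p c)) z (w (p c))) * (\<Prod>i\<in>S - {c}. ?k i (p i)))"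
      if "p permutes S" for p
    proof (intro sum.cong refl arg_cong2[where f = "(*)"] prod.cong)
      have "p c \<noteq> a" if "c \<in> S" for c using na \<open>p permutes S\<close> that by (simp add: permutes_in_image)
      then show "?f z i (p i) = ?k i (p i)" if "c \<in> S" "i \<in> S - {c}" for c i
        using that na[of i] by simp
      show "?f z a (p c) = ker ?m (fst (p c)) z (w (p c))" if "c \<in> S" for c
        using that \<open>\<And>c. c \<in> S \<Longrightarrow> p c \<noteq> a\<close> by simp
    qed (use na in auto)
    ultimately show ?thesis
      unfolding ker_det_def ldet_insert[OF fin a(1)] by simp
  qed
  \<comment> \<open>The fixed point contributes the trace of the projection
    \<open>ker ?m ?m\<close>, that is, its rank.\<close>
  have trace: "has_bochner_integral lborel (\<lambda>z. ker ?m ?m z z) (of_nat N)"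
  proof -
    have "has_bochner_integral lborel (\<lambda>z. \<Sum>k<N. R ?m k z * Q ?m k z) (\<Sum>k<N. if k = k then 1 else 0)"
      by (intro has_bochner_integral_sum RQ) (use a in auto)
    then show ?thesis by (simp add: ker_def mult.commute)
  qed
  have "has_bochner_integral lborel (\<lambda>z. ker_det (insert a S) (w(a := z)))
    (of_nat N * ker_det S w - (\<Sum>p | p permutes S. of_int (sign p) *
         (\<Sum>c\<in>S. (?chi c (p c) * ?k c (p c)) * (\<Prod>i\<in>S - {c}. ?k i (p i)))))"
    unfolding eq
  proof (intro has_bochner_integral_diff has_bochner_integral_sum has_bochner_integral_mult_left
      has_bochner_integral_mult_right trace ker_compose a)
    fix p c assume "p \<in> {p. p permutes S}" "c \<in> S"
    then show "fst c < M" "fst (p c) < M" using S by (auto simp: permutes_in_image)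
  qed
  also have "(\<Sum>p | p permutes S. of_int (sign p) *
         (\<Sum>c\<in>S. (?chi c (p c) * ?k c (p c)) * (\<Prod>i\<in>S - {c}. ?k i (p i)))) =
      of_nat (card {b\<in>S. fst b = ?m}) * ker_det S w"
  proof -
    have "(\<Sum>c\<in>S. (?chi c (p c) * ?k c (p c)) * (\<Prod>i\<in>S - {c}. ?k i (p i))) =
        of_nat (card {b\<in>S. fst b = ?m}) * (\<Prod>i\<in>S. ?k i (p i))" if p: "p permutes S" for p
    proof -
      have "(\<Sum>c\<in>S. (?chi c (p c) * ?k c (p c)) * (\<Prod>i\<in>S - {c}. ?k i (p i))) =
          (\<Sum>c\<in>S. ?chi c (p c)) * (\<Prod>i\<in>S. ?k i (p i))"
        unfolding sum_distrib_right
        by (intro sum.cong refl) (simp add: prod.remove[OF fin] mult.assoc)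
      also have "(\<Sum>c\<in>S. ?chi c (p c)) =
          (\<Sum>c\<in>S. if ?m \<le> fst c then 1 else 0) - (\<Sum>c\<in>S. if ?m < fst (p c) then 1 else 0)"
        by (simp add: sum_subtractf)
      \<comment> \<open>Reindexing by \<open>p\<close> frees the sum from the permutation, so that
        it can be taken out of the Leibniz expansion.\<close>
      also have "(\<Sum>c\<in>S. if ?m < fst (p c) then 1 else 0 :: complex) =
          (\<Sum>c\<in>S. if ?m < fst c then 1 else 0)"
        by (rule sum.reindex_bij_betw[OF permutes_imp_bij[OF p], of "\<lambda>c. if ?m < fst c then 1 else 0"])
      also have "(\<Sum>c\<in>S. if ?m \<le> fst c then 1 else 0) - \<dots> =
          (\<Sum>c\<in>S. if fst c = ?m then 1 else 0)"
        unfolding sum_subtractf[symmetric] by (intro sum.cong refl) auto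
      also have "\<dots> = of_nat (card {b\<in>S. fst b = ?m})"
        using fin by (simp add: sum.If_cases Int_def)
      finally show ?thesis .
    qed
    then show ?thesis
      unfolding ker_det_def ldet_def sum_distrib_left[of "of_nat _"]
      by (intro sum.cong refl) (simp only: mem_Collect_eq mult.left_commute)
  qed
  finally show ?thesis by (simp only: left_diff_distrib)
qed

lemma measurable_ker [measurable]:
  assumes "m < M" "n < M"
    and [measurable]: "f \<in> borel_measurable A" "g \<in> borel_measurable A"
  shows "(\<lambda>z. ker m n (f z) (g z)) \<in> borel_measurable A"
proof -
  have 1: "(\<lambda>z. Q m k (f z)) \<in> borel_measurable A" "(\<lambda>z. R n k (g z)) \<in> borel_measurable A"
    if "k < N" for k
    using that assms by (auto intro: measurable_compose[OF _ measurable_Q] measurable_compose[OF _ measurable_R])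
  have 2: "(\<lambda>z. P m n (f z) (g z)) \<in> borel_measurable A" if "m < n"
  proof -
    have "(\<lambda>z. (f z, g z)) \<in> measurable A (borel \<Otimes>\<^sub>M borel)" by measurable
    from measurable_compose[OF this measurable_P[OF that assms(2)]] show ?thesis by simp
  qed
  show ?thesis
    unfolding ker_def
    by (intro borel_measurable_diff borel_measurable_sum borel_measurable_times 1; cases "m < n")
       (simp_all add: 2)
qed

lemma measurable_ker_det:
  assumes "finite J" "S \<union> J \<subseteq> {..<M} \<times> {..<N}"
  shows "(\<lambda>z. ker_det (S \<union> J) (\<lambda>b. if b \<in> S then w b else z b)) \<in> borel_measurable (Pi\<^sub>M J (\<lambda>_. lborel))"
  unfolding ker_det_def ldet_def
proof (intro borel_measurable_sum borel_measurable_times borel_measurable_prod borel_measurable_const)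
  fix p b assume p: "p \<in> {p. p permutes S \<union> J}" and b: "b \<in> S \<union> J"
  then have pb: "p b \<in> S \<union> J" by (simp only: mem_Collect_eq permutes_in_image)
  have "(\<lambda>z. if c \<in> S then w c else z c) \<in> borel_measurable (Pi\<^sub>M J (\<lambda>_. lborel))" if "c \<in> S \<union> J" for c
    using that by (cases "c \<in> S") auto
  moreover have "fst b < M" "fst (p b) < M" using b pb assms(2) by auto
  ultimately show
    "(\<lambda>z. ker (fst b) (fst (p b)) (if b \<in> S then w b else z b) (if p b \<in> S then w (p b) else z (p b)))
      \<in> borel_measurable (Pi\<^sub>M J (\<lambda>_. lborel))"
    using b pb by (intro measurable_ker)
qed

text \<open>The substitute for joint integrability. For the full index set the property comes from
  the joint density; it is then inherited by subsets, one removed index at a time.\<close>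

definition nonneg_det :: "(nat \<times> nat) set \<Rightarrow> bool" where
  "nonneg_det S \<longleftrightarrow> (\<forall>w. \<exists>r\<ge>0. ker_det S w = complex_of_real r)"

text \<open>Makes the factor \<open>N - card {b\<in>S. fst b = fst a}\<close> of the integration
  step positive, so that the sign of the integral passes to the determinant over
  \<open>S\<close>.\<close>

lemma card_slice_less:
  assumes "a \<notin> S" "insert a S \<subseteq> {..<M} \<times> {..<N}"
  shows "card {b\<in>S. fst b = fst a} < N"
proof -
  have "finite S" by (rule finite_subset[of _ "{..<M} \<times> {..<N}"]) (use assms in auto)
  have "insert a {b\<in>S. fst b = fst a} \<subseteq> Pair (fst a) ` {..<N}"
    using assms(2) by (force simp: image_iff)
  then have "card (insert a {b\<in>S. fst b = fst a}) \<le> card (Pair (fst a) ` {..<N})"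
    by (rule card_mono[rotated]) simp
  also have "\<dots> \<le> N" by (metis card_image_le finite_lessThan card_lessThan)
  finally show ?thesis using assms(1) \<open>finite S\<close> by simp
qed

text \<open>By \<open>ker_det_integral\<close> the determinant over \<open>S\<close> is, up to a
  positive factor, the integral of a function that is real and nonnegative.\<close>

lemma nonneg_det_step:
  assumes "a \<notin> S" "insert a S \<subseteq> {..<M} \<times> {..<N}" "nonneg_det (insert a S)"
  shows "nonneg_det S"
    and "(\<integral>\<^sup>+ z. ennreal (Re (ker_det (insert a S) (w(a := z)))) \<partial>lborel) =
      ennreal (real (N - card {b\<in>S. fst b = fst a}) * Re (ker_det S w))"
proof -
  have fin: "finite S" by (rule finite_subset[of _ "{..<M} \<times> {..<N}"]) (use assms in auto)
  let ?c = "N - card {b\<in>S. fst b = fst a}"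
  have c: "?c > 0" using card_slice_less[OF assms(1,2)] by simp
  have hb: "has_bochner_integral lborel (\<lambda>z. ker_det (insert a S) (w(a := z))) (of_nat ?c * ker_det S w)" for w
  proof -
    have "fst a < M" "\<And>b. b \<in> S \<Longrightarrow> fst b < M" using assms(2) by auto
    moreover have "(of_nat ?c :: complex) = of_nat N - of_nat (card {b\<in>S. fst b = fst a})"
      using card_slice_less[OF assms(1,2)] by (simp add: of_nat_diff)
    ultimately show ?thesis using ker_det_integral[OF fin assms(1)] by simp
  qed
  have re: "has_bochner_integral lborel (\<lambda>z. Re (ker_det (insert a S) (w(a := z)))) (real ?c * Re (ker_det S w))"
    and im: "has_bochner_integral lborel (\<lambda>z. Im (ker_det (insert a S) (w(a := z)))) (real ?c * Im (ker_det S w))" for w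
    using has_bochner_integral_bounded_linear[OF bounded_linear_Re hb[of w]]
      has_bochner_integral_bounded_linear[OF bounded_linear_Im hb[of w]] by simp_all
  have pos: "Re (ker_det (insert a S) w) \<ge> 0" "Im (ker_det (insert a S) w) = 0" for w
  proof -
    obtain r where "r \<ge> 0" "ker_det (insert a S) w = complex_of_real r"
      using assms(3) unfolding nonneg_det_def by meson
    then show "Re (ker_det (insert a S) w) \<ge> 0" "Im (ker_det (insert a S) w) = 0" by simp_all
  qed
  have "real ?c * Re (ker_det S w) \<ge> 0" for w
    using has_bochner_integral_integral_eq[OF re[of w]] pos integral_nonneg_AE
    by (metis (no_types, lifting) AE_I2)
  moreover have "real ?c * Im (ker_det S w) = 0" for w
    using has_bochner_integral_integral_eq[OF im[of w]] pos by simp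
  ultimately have "Re (ker_det S w) \<ge> 0 \<and> Im (ker_det S w) = 0" for w
    using c by (simp add: zero_le_mult_iff)
  then show "nonneg_det S"
    unfolding nonneg_det_def by (intro allI exI[of _ "Re (ker_det S _)"]) (simp add: complex_eq_iff)
  show "(\<integral>\<^sup>+ z. ennreal (Re (ker_det (insert a S) (w(a := z)))) \<partial>lborel) =
      ennreal (real ?c * Re (ker_det S w))"
    using re[of w] pos
    by (subst nn_integral_eq_integral) (auto simp: has_bochner_integral_iff)
qed

text \<open>The factorial weights absorb the factors of the single steps: with \<open>n\<close>
  indices at the time of the removed one, \<open>fact (N - Suc n) * (N - n) = fact (N - n)\<close>.
  The identity thus keeps its shape, and the induction over \<open>J\<close> closes.\<close>

lemma nn_integral_ker_det:
  assumes "finite J" "J \<inter> S = {}" "S \<union> J \<subseteq> {..<M} \<times> {..<N}" "nonneg_det (S \<union> J)"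
  shows "nonneg_det S \<and> (\<forall>w. (\<integral>\<^sup>+ z. ennreal ((\<Prod>m<M. fact (N - card {b\<in>S \<union> J. fst b = m}))
      * Re (ker_det (S \<union> J) (\<lambda>b. if b \<in> S then w b else z b))) \<partial>Pi\<^sub>M J (\<lambda>_. lborel)) =
      ennreal ((\<Prod>m<M. fact (N - card {b\<in>S. fst b = m})) * Re (ker_det S w)))"
  using assms
proof (induction J)
  case empty
  have "ker_det S (\<lambda>b. if b \<in> S then w b else z b) = ker_det S w" for w z
    unfolding ker_det_def by (rule ldet_cong) auto
  then show ?case using empty by (simp add: PiM_empty nn_integral_count_space_finite)
next
  case (insert a J)
  interpret product_sigma_finite "\<lambda>_. lborel :: real measure" by unfold_locales
  let ?c = "N - card {b\<in>S \<union> J. fst b = fst a}"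
  let ?F = "\<lambda>S. (\<Prod>m<M. fact (N - card {b\<in>S. fst b = m})) :: real"
  have a: "a \<notin> S \<union> J" using insert by auto
  have sub: "insert a (S \<union> J) \<subseteq> {..<M} \<times> {..<N}" using insert.prems by auto
  have fin: "finite (S \<union> J)" by (rule finite_subset[of _ "{..<M} \<times> {..<N}"]) (use sub in auto)
  have step: "nonneg_det (S \<union> J)"
    "(\<integral>\<^sup>+ z. ennreal (Re (ker_det (insert a (S \<union> J)) (w(a := z)))) \<partial>lborel) =
      ennreal (real ?c * Re (ker_det (S \<union> J) w))" for w
    using nonneg_det_step[OF a sub] insert.prems by auto
  have IH: "nonneg_det S" "(\<integral>\<^sup>+ z. ennreal (?F (S \<union> J)
      * Re (ker_det (S \<union> J) (\<lambda>b. if b \<in> S then w b else z b))) \<partial>Pi\<^sub>M J (\<lambda>_. lborel)) =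
      ennreal (?F S * Re (ker_det S w))" for w
    using insert.IH insert.prems step by auto
  have F0: "?F S \<ge> 0" for S by (intro prod_nonneg) auto
  have F: "?F (insert a (S \<union> J)) * real ?c = ?F (S \<union> J)"
  proof -
    have m: "fst a < M" using sub by auto
    have e1: "{b\<in>insert a (S \<union> J). fst b = fst a} = insert a {b\<in>S \<union> J. fst b = fst a}" by auto
    have e2: "{b\<in>insert a (S \<union> J). fst b = m} = {b\<in>S \<union> J. fst b = m}" if "m \<noteq> fst a" for m
      using that by auto
    have c1: "card {b\<in>insert a (S \<union> J). fst b = fst a} = Suc (card {b\<in>S \<union> J. fst b = fst a})"
      unfolding e1 using a fin by (subst card_insert_disjoint) auto
    have "?c > 0" using card_slice_less[OF a sub] by simp
    then have fc: "fact (N - card {b\<in>insert a (S \<union> J). fst b = fst a}) * real ?c = fact ?c"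
      unfolding c1 by (cases ?c) (auto simp: algebra_simps diff_Suc)
    have rm: "?F T = fact (N - card {b\<in>T. fst b = fst a}) * (\<Prod>m\<in>{..<M} - {fst a}. fact (N - card {b\<in>T. fst b = m}))" for T
      using m by (subst prod.remove[of _ "fst a"]) auto
    have "(\<Prod>m\<in>{..<M} - {fst a}. fact (N - card {b\<in>insert a (S \<union> J). fst b = m}) :: real) =
        (\<Prod>m\<in>{..<M} - {fst a}. fact (N - card {b\<in>S \<union> J. fst b = m}))"
      by (intro prod.cong refl) (subst e2, auto)
    then show ?thesis unfolding rm fc[symmetric] by (simp only: mult_ac)
  qed
  have "(\<integral>\<^sup>+ z. ennreal (?F (S \<union> insert a J)
      * Re (ker_det (S \<union> insert a J) (\<lambda>b. if b \<in> S then w b else z b))) \<partial>Pi\<^sub>M (insert a J) (\<lambda>_. lborel)) =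
      ennreal (?F S * Re (ker_det S w))" for w
  proof -
    have "(\<integral>\<^sup>+ z. ennreal (?F (S \<union> insert a J)
        * Re (ker_det (S \<union> insert a J) (\<lambda>b. if b \<in> S then w b else z b))) \<partial>Pi\<^sub>M (insert a J) (\<lambda>_. lborel)) =
      (\<integral>\<^sup>+ z. \<integral>\<^sup>+ y. ennreal (?F (S \<union> insert a J)
        * Re (ker_det (S \<union> insert a J) (\<lambda>b. if b \<in> S then w b else (z(a := y)) b))) \<partial>lborel \<partial>Pi\<^sub>M J (\<lambda>_. lborel))"
    proof (rule product_nn_integral_insert)
      have "(\<lambda>z. ker_det (S \<union> insert a J) (\<lambda>b. if b \<in> S then w b else z b))
          \<in> borel_measurable (Pi\<^sub>M (insert a J) (\<lambda>_. lborel))"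
        by (rule measurable_ker_det) (use insert in auto)
      then show "(\<lambda>z. ennreal (?F (S \<union> insert a J) * Re (ker_det (S \<union> insert a J) (\<lambda>b. if b \<in> S then w b else z b))))
          \<in> borel_measurable (Pi\<^sub>M (insert a J) (\<lambda>_. lborel))"
        by measurable
    qed (use insert in auto)
    also have "\<dots> = (\<integral>\<^sup>+ z. ennreal (?F (S \<union> J)
        * Re (ker_det (S \<union> J) (\<lambda>b. if b \<in> S then w b else z b))) \<partial>Pi\<^sub>M J (\<lambda>_. lborel))"
    proof (rule nn_integral_cong)
      fix z :: "nat \<times> nat \<Rightarrow> real"
      let ?w = "\<lambda>b. if b \<in> S then w b else z b"
      have "(\<lambda>b. if b \<in> S then w b else (z(a := y)) b) = ?w(a := y)" for y
        using a by auto
      then have "(\<integral>\<^sup>+ y. ennreal (?F (S \<union> insert a J)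
          * Re (ker_det (S \<union> insert a J) (\<lambda>b. if b \<in> S then w b else (z(a := y)) b))) \<partial>lborel) =
          (\<integral>\<^sup>+ y. ennreal (?F (insert a (S \<union> J))) * ennreal (Re (ker_det (insert a (S \<union> J)) (?w(a := y)))) \<partial>lborel)"
        by (simp only: Un_insert_right ennreal_mult'[OF F0])
      also have "\<dots> = ennreal (?F (insert a (S \<union> J))) * ennreal (real ?c * Re (ker_det (S \<union> J) ?w))"
      proof (subst nn_integral_cmult)
        have "has_bochner_integral lborel (\<lambda>y. ker_det (insert a (S \<union> J)) (?w(a := y)))
           ((of_nat N - of_nat (card {b\<in>S \<union> J. fst b = fst a})) * ker_det (S \<union> J) ?w)"
          by (rule ker_det_integral) (use fin a sub in auto)
        from borel_measurable_has_bochner_integral[OF this]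
        show "(\<lambda>y. ennreal (Re (ker_det (insert a (S \<union> J)) (?w(a := y))))) \<in> borel_measurable lborel"
          by measurable
      qed (simp only: step)
      also have "\<dots> = ennreal (?F (S \<union> J) * Re (ker_det (S \<union> J) ?w))"
        using F by (simp only: ennreal_mult'[OF F0, symmetric] mult.assoc[symmetric])
      finally show "(\<integral>\<^sup>+ y. ennreal (?F (S \<union> insert a J)
          * Re (ker_det (S \<union> insert a J) (\<lambda>b. if b \<in> S then w b else (z(a := y)) b))) \<partial>lborel) =
          ennreal (?F (S \<union> J) * Re (ker_det (S \<union> J) ?w))" .
    qed
    also have "\<dots> = ennreal (?F S * Re (ker_det S w))" by (rule IH)
    finally show ?thesis .
  qed
  then show ?case using IH by simp
qed

text \<open>Enumerating the pairs lexicographically by \<open>div\<close> and \<open>mod\<close>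
  makes the times into blocks of size \<open>N\<close>; the \<open>P\<close> part is strictly block
  upper triangular, as \<open>det_fun_bordered\<close> requires.\<close>

lemma ker_det_full:
  assumes "M \<ge> 1" "N \<ge> 1"
  shows "ker_det ({..<M} \<times> {..<N}) w =
    det_fun N (\<lambda>i j. R 0 i (w (0, j)))
    * (\<Prod>m<M - 1. det_fun N (\<lambda>i j. P m (Suc m) (w (m, i)) (w (Suc m, j))))
    * det_fun N (\<lambda>i j. Q (M - 1) j (w (M - 1, i)))"
proof -
  let ?h = "\<lambda>a. (a div N, a mod N)"
  let ?T = "\<lambda>a b. if a div N < b div N then P (a div N) (b div N) (w (?h a)) (w (?h b)) else 0"
  have "ker_det ({..<M} \<times> {..<N}) w = det_fun (M * N) (\<lambda>a b.
      (\<Sum>k<N. Q (a div N) k (w (?h a)) * R (b div N) k (w (?h b))) - ?T a b)"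
    unfolding ker_det_def using assms
    by (subst ldet_reindex[OF bij_betw_divmod]) (auto simp: det_fun_eq_ldet ker_def)
  also have "\<dots> = det_fun N (\<lambda>k b. R (b div N) k (w (?h b)))
    * (\<Prod>m<M - 1. det_fun N (\<lambda>i j. ?T (m * N + i) (Suc m * N + j)))
    * det_fun N (\<lambda>i j. Q (((M - 1) * N + i) div N) j (w (?h ((M - 1) * N + i))))"
    by (rule det_fun_bordered) (use assms in auto)
  also have "\<dots> = det_fun N (\<lambda>i j. R 0 i (w (0, j)))
    * (\<Prod>m<M - 1. det_fun N (\<lambda>i j. P m (Suc m) (w (m, i)) (w (Suc m, j))))
    * det_fun N (\<lambda>i j. Q (M - 1) j (w (M - 1, i)))"
    by (intro arg_cong2[where f = "(*)"] prod.cong refl det_fun_cong) (auto simp del: mult_Suc)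
  finally show ?thesis .
qed

end

section \<open>Gaussian integrals and the heat flow of polynomials\<close>

lemma of_real_gauss: "complex_of_real (gauss t y x) = gauss t (complex_of_real y) (complex_of_real x)"
  by (simp add: gauss_def exp_of_real[symmetric])

lemma gauss_pos: "t > 0 \<Longrightarrow> gauss t (y::real) x > 0"
  by (simp add: gauss_def)

lemma continuous_on_gauss [continuous_intros]:
  fixes f g :: "'b::topological_space \<Rightarrow> complex"
  assumes "continuous_on A f" "continuous_on A g" "t > 0"
  shows "continuous_on A (\<lambda>x. gauss t (f x) (g x))"
  unfolding gauss_def using assms by (intro continuous_intros) auto

lemma measurable_gauss [measurable]:
  fixes f g :: "'b \<Rightarrow> complex"
  assumes [measurable]: "f \<in> borel_measurable A" "g \<in> borel_measurable A"
  shows "(\<lambda>x. gauss t (f x) (g x)) \<in> borel_measurable A"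
  unfolding gauss_def by measurable

text \<open>A single term of the exponential series controls the even powers, and
  \<open>\<bar>x\<bar> ^ n \<le> 1 + x\<^sup>2 ^ n\<close> reduces the other powers to them.\<close>

lemma power_exp_bound:
  fixes x b :: real
  assumes "b > 0"
  shows "\<bar>x\<bar> ^ n * exp (- (b * x\<^sup>2)) \<le> 1 + fact n / b ^ n"
proof -
  have e: "(b * x\<^sup>2) ^ n / fact n \<le> exp (b * x\<^sup>2)"
  proof -
    have "(\<Sum>k\<in>{n}. (b * x\<^sup>2) ^ k /\<^sub>R fact k) \<le> (\<Sum>k. (b * x\<^sup>2) ^ k /\<^sub>R fact k)"
      by (rule sum_le_suminf[OF summable_exp_generic]) (use assms in auto)
    then show ?thesis by (simp add: exp_def divide_inverse mult.commute)
  qed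
  have "x\<^sup>2 ^ n * exp (- (b * x\<^sup>2)) \<le> fact n / b ^ n"
    using e assms by (simp add: exp_minus field_simps power_mult_distrib)
  moreover have "\<bar>x\<bar> ^ n \<le> 1 + x\<^sup>2 ^ n"
  proof (cases "\<bar>x\<bar> \<le> 1")
    case True
    then show ?thesis by (intro order_trans[OF power_le_one]) auto
  next
    case False
    then have "\<bar>x\<bar> ^ n \<le> \<bar>x\<bar> ^ (2 * n)" by (intro power_increasing) auto
    then show ?thesis by (simp add: power_mult)
  qed
  then have "\<bar>x\<bar> ^ n * exp (- (b * x\<^sup>2)) \<le> (1 + x\<^sup>2 ^ n) * exp (- (b * x\<^sup>2))"
    by (rule mult_right_mono) simp
  moreover have "exp (- (b * x\<^sup>2)) \<le> 1" using assms by simp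
  ultimately show ?thesis unfolding distrib_right mult_1 by linarith
qed

text \<open>The additional power of \<open>\<bar>x\<bar>\<close> is for the induction: stripping one
  coefficient raises \<open>n\<close> by one.\<close>

lemma poly_exp_bound:
  fixes f :: "complex poly" and b :: real
  assumes "b > 0"
  shows "\<exists>B. \<forall>x::real. \<bar>x\<bar> ^ n * norm (poly f (of_real x)) * exp (- (b * x\<^sup>2)) \<le> B"
proof (induction f arbitrary: n)
  case 0
  then show ?case by auto
next
  case (pCons a g)
  obtain B where B: "\<bar>x\<bar> ^ Suc n * norm (poly g (of_real x)) * exp (- (b * x\<^sup>2)) \<le> B" for x :: real
    using pCons.IH[of "Suc n"] by blast
  have "\<bar>x\<bar> ^ n * norm (poly (pCons a g) (of_real x)) * exp (- (b * x\<^sup>2)) \<le> norm a * (1 + fact n / b ^ n) + B" for x :: real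
  proof -
    let ?e = "exp (- (b * x\<^sup>2))"
    have "norm (poly (pCons a g) (of_real x)) \<le> norm a + \<bar>x\<bar> * norm (poly g (of_real x))"
      using norm_triangle_ineq[of a "of_real x * poly g (of_real x)"] by (simp add: norm_mult)
    then have "\<bar>x\<bar> ^ n * norm (poly (pCons a g) (of_real x)) * ?e \<le>
        \<bar>x\<bar> ^ n * (norm a + \<bar>x\<bar> * norm (poly g (of_real x))) * ?e"
      by (intro mult_right_mono mult_left_mono) auto
    also have "\<dots> = norm a * (\<bar>x\<bar> ^ n * ?e) + \<bar>x\<bar> ^ Suc n * norm (poly g (of_real x)) * ?e"
      by (simp add: algebra_simps)
    also have "\<dots> \<le> norm a * (1 + fact n / b ^ n) + B"
      by (intro add_mono mult_left_mono power_exp_bound B assms) auto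
    finally show ?thesis .
  qed
  then show ?case by blast
qed

text \<open>Half of the decay is given up for uniformity in \<open>\<mu>\<close>:
  \<open>(x - 2 * Re \<mu>)\<^sup>2 \<ge> 0\<close> yields \<open>(x - Re \<mu>)\<^sup>2 \<ge>
  x\<^sup>2 / 2 - (Re \<mu>)\<^sup>2\<close>.\<close>

lemma norm_gauss_le:
  assumes "u > 0" "norm \<mu> \<le> r"
  shows "norm (gauss u (complex_of_real x) \<mu>) \<le> exp (r\<^sup>2 / (2 * u)) / sqrt (2 * pi * u) * exp (- (x\<^sup>2 / (4 * u)))"
proof -
  have "x\<^sup>2 / 2 \<le> (x - Re \<mu>)\<^sup>2 + (Re \<mu>)\<^sup>2"
    using sum_squares_ge_zero[of "x / 2 - Re \<mu>" 0] zero_le_power2[of "x - 2 * Re \<mu>"]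
    by (simp add: power2_eq_square algebra_simps)
  moreover have "(Re \<mu>)\<^sup>2 + (Im \<mu>)\<^sup>2 \<le> r\<^sup>2"
    using assms(2) power_mono[of "norm \<mu>" r 2] by (simp add: cmod_power2)
  ultimately have "(Im \<mu>)\<^sup>2 - (x - Re \<mu>)\<^sup>2 \<le> r\<^sup>2 - x\<^sup>2 / 2" by linarith
  then have "((Im \<mu>)\<^sup>2 - (x - Re \<mu>)\<^sup>2) / (2 * u) \<le> (r\<^sup>2 - x\<^sup>2 / 2) / (2 * u)"
    using assms(1) by (intro divide_right_mono) auto
  also have "\<dots> = r\<^sup>2 / (2 * u) + - (x\<^sup>2 / (4 * u))" by (simp add: diff_divide_distrib)
  finally have "exp (((Im \<mu>)\<^sup>2 - (x - Re \<mu>)\<^sup>2) / (2 * u)) \<le> exp (r\<^sup>2 / (2 * u)) * exp (- (x\<^sup>2 / (4 * u)))"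
    by (simp flip: exp_add)
  moreover have "Re (- ((complex_of_real x - \<mu>)\<^sup>2 / complex_of_real (2 * u))) = ((Im \<mu>)\<^sup>2 - (x - Re \<mu>)\<^sup>2) / (2 * u)"
  proof -
    have "Re (- ((complex_of_real x - \<mu>)\<^sup>2)) = (Im \<mu>)\<^sup>2 - (x - Re \<mu>)\<^sup>2"
      by (simp add: power2_eq_square algebra_simps)
    then show ?thesis by (simp only: minus_divide_left Re_divide_of_real)
  qed
  ultimately show ?thesis
    using assms(1) unfolding gauss_def norm_mult norm_exp_eq_Re
    by (simp add: norm_divide divide_right_mono)
qed

text \<open>Half of the rate \<open>1 / (4 * u)\<close> left by \<open>norm_gauss_le\<close> absorbs
  the polynomial; the other half, \<open>1 / (8 * u)\<close>, survives. The bound is uniform on a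
  disc of \<open>\<mu>\<close>, so that it can dominate integrals over a circle.\<close>

lemma gauss_poly_bound:
  assumes "u > 0"
  shows "\<exists>C. \<forall>\<mu> x. norm \<mu> \<le> r \<longrightarrow>
    norm (gauss u (complex_of_real x) \<mu> * poly f (complex_of_real x)) \<le> C * exp (- (x\<^sup>2 / (8 * u)))"
proof -
  obtain B where B: "norm (poly f (complex_of_real x)) * exp (- ((1 / (8 * u)) * x\<^sup>2)) \<le> B" for x
    using poly_exp_bound[of "1 / (8 * u)" 0 f] assms by auto
  define c where "c = exp (r\<^sup>2 / (2 * u)) / sqrt (2 * pi * u)"
  have c: "c \<ge> 0" using assms by (simp add: c_def)
  have "norm (gauss u (complex_of_real x) \<mu> * poly f (complex_of_real x)) \<le> c * B * exp (- (x\<^sup>2 / (8 * u)))"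
    if "norm \<mu> \<le> r" for \<mu> x
  proof -
    have "norm (gauss u (complex_of_real x) \<mu> * poly f (complex_of_real x)) \<le>
        (c * exp (- (x\<^sup>2 / (4 * u)))) * norm (poly f (complex_of_real x))"
      unfolding norm_mult c_def by (intro mult_right_mono norm_gauss_le assms that) simp
    also have "exp (- (x\<^sup>2 / (4 * u))) = exp (- ((1 / (8 * u)) * x\<^sup>2)) * exp (- (x\<^sup>2 / (8 * u)))"
      using assms by (simp flip: exp_add add: field_simps)
    also have "(c * (exp (- ((1 / (8 * u)) * x\<^sup>2)) * exp (- (x\<^sup>2 / (8 * u))))) * norm (poly f (complex_of_real x))
        = c * (norm (poly f (complex_of_real x)) * exp (- ((1 / (8 * u)) * x\<^sup>2))) * exp (- (x\<^sup>2 / (8 * u)))"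
      by (simp add: algebra_simps)
    also have "\<dots> \<le> c * B * exp (- (x\<^sup>2 / (8 * u)))"
      by (intro mult_right_mono mult_left_mono B c) simp
    finally show ?thesis .
  qed
  then show ?thesis by blast
qed

lemma integrable_exp_square:
  assumes "u > 0"
  shows "integrable lborel (\<lambda>x::real. C * exp (- (x\<^sup>2 / (8 * u))))"
proof -
  \<comment> \<open>The standard deviation \<open>sqrt (4 * u)\<close> is the one with twice the
    variance equal to \<open>8 * u\<close>.\<close>
  have "integrable lborel (\<lambda>x. (C * sqrt (2 * pi * (sqrt (4 * u))\<^sup>2)) * normal_density 0 (sqrt (4 * u)) x)"
    using assms by (intro integrable_mult_right integrable_normal_density) auto
  then show ?thesis using assms by (simp add: normal_density_def)
qed

lemma integrable_gauss_poly:
  assumes "u > 0"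
  shows "integrable lborel (\<lambda>x. gauss u (complex_of_real x) \<mu> * poly f (complex_of_real x))"
proof -
  obtain C where C: "norm \<nu> \<le> norm \<mu> \<Longrightarrow>
      norm (gauss u (complex_of_real x) \<nu> * poly f (complex_of_real x)) \<le> C * exp (- (x\<^sup>2 / (8 * u)))" for x \<nu>
    using gauss_poly_bound[OF assms, of "norm \<mu>" f] by blast
  show ?thesis
  proof (rule Bochner_Integration.integrable_bound[OF integrable_exp_square[OF assms, of C]])
    show "(\<lambda>x. gauss u (complex_of_real x) \<mu> * poly f (complex_of_real x)) \<in> borel_measurable lborel"
      by (simp, intro borel_measurable_continuous_onI continuous_intros assms)
    show "AE x in lborel. norm (gauss u (complex_of_real x) \<mu> * poly f (complex_of_real x)) \<le>
        norm (C * exp (- (x\<^sup>2 / (8 * u))))"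
      by (intro always_eventually allI order_trans[OF C]) auto
  qed
qed

text \<open>The real part of the mean is removed by translation. The imaginary part turns the
  integral into the characteristic function of the standard normal law at
  \<open>Im \<mu> / sqrt u\<close>, which cancels the factor that the square leaves behind.\<close>

lemma integral_gauss:
  assumes "u > 0"
  shows "(LINT x|lborel. gauss u (complex_of_real x) \<mu>) = 1"
proof -
  let ?s = "sqrt u" and ?m = "Re \<mu>" and ?w = "Im \<mu>"
  have s: "?s > 0" "?s * ?s = u" using assms by auto
  have mu: "\<mu> = complex_of_real ?m + \<i> * complex_of_real ?w" by (simp add: complex_eq)
  have su: "complex_of_real ?s * complex_of_real ?s = complex_of_real u" using s by (metis of_real_mult)
  have pw: "?s *\<^sub>R gauss u (complex_of_real (?m + ?s * x)) \<mu> =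
      exp (complex_of_real (?w\<^sup>2 / (2 * u))) * (std_normal_density x *\<^sub>R iexp (?w / ?s * x))" for x
  proof -
    have e: "- ((complex_of_real (?m + ?s * x) - \<mu>)\<^sup>2 / complex_of_real (2 * u)) =
        complex_of_real (?w\<^sup>2 / (2 * u)) + complex_of_real (- x\<^sup>2 / 2) + \<i> * complex_of_real (?w / ?s * x)"
    proof -
      have "(complex_of_real (?m + ?s * x) - \<mu>)\<^sup>2 = (complex_of_real (?s * x) - \<i> * complex_of_real ?w)\<^sup>2"
        by (subst (2) mu) simp
      also have "\<dots> = complex_of_real u * (complex_of_real x)\<^sup>2 - 2 * \<i> * complex_of_real ?s * complex_of_real (?w * x) - (complex_of_real ?w)\<^sup>2"
        by (simp add: power2_eq_square algebra_simps flip: su)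
      finally have 1: "(complex_of_real (?m + ?s * x) - \<mu>)\<^sup>2 = \<dots>" .
      show ?thesis unfolding 1 using assms s
        by (simp add: field_simps flip: su)
    qed
    show ?thesis using assms s unfolding gauss_def e exp_add
      by (simp add: std_normal_density_def scaleR_conv_of_real real_sqrt_mult exp_of_real[symmetric])
  qed
  have "(LINT x|lborel. gauss u (complex_of_real x) \<mu>) =
      ?s *\<^sub>R (LINT x|lborel. gauss u (complex_of_real (?m + ?s * x)) \<mu>)"
    using lborel_integral_real_affine[of ?s "\<lambda>x. gauss u (complex_of_real x) \<mu>" ?m] s by simp
  also have "\<dots> = (LINT x|lborel. ?s *\<^sub>R gauss u (complex_of_real (?m + ?s * x)) \<mu>)" by simp
  also have "\<dots> = exp (complex_of_real (?w\<^sup>2 / (2 * u))) * (LINT x|lborel. std_normal_density x *\<^sub>R iexp (?w / ?s * x))"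
    by (simp only: pw integral_mult_right_zero)
  also have "(LINT x|lborel. std_normal_density x *\<^sub>R iexp (?w / ?s * x)) = char std_normal_distribution (?w / ?s)"
    unfolding char_def by (subst integral_density) auto
  also have "\<dots> = exp (complex_of_real (- (?w\<^sup>2 / (2 * u))))"
  proof -
    have "(complex_of_real ?w / complex_of_real ?s)\<^sup>2 = (complex_of_real ?w)\<^sup>2 / complex_of_real u"
      by (simp add: power_divide power2_eq_square su)
    then show ?thesis by (simp add: char_std_normal_distribution exp_of_real[symmetric] mult.commute)
  qed
  finally show ?thesis by (simp flip: exp_add)
qed

lemma LINT_derivative_eq_0:
  fixes F f :: "real \<Rightarrow> complex"
  assumes "\<And>x. (F has_vector_derivative f x) (at x)" "continuous_on UNIV f" "integrable lborel f"
    and "(F \<longlongrightarrow> 0) at_top" "(F \<longlongrightarrow> 0) at_bot"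
  shows "(LINT x|lborel. f x) = 0"
proof -
  have "(LBINT x=-\<infinity>..\<infinity>. f x) = 0 - 0"
  proof (rule interval_integral_FTC_integrable[where F = F])
    show "isCont f x" for x using assms(2) by (simp add: continuous_on_eq_continuous_at)
    show "set_integrable lborel (einterval (-\<infinity>) \<infinity>) f"
      using assms(3) by (simp add: set_integrable_def einterval_def)
    show "((F \<circ> real_of_ereal) \<longlongrightarrow> 0) (at_right (-\<infinity>))" "((F \<circ> real_of_ereal) \<longlongrightarrow> 0) (at_left \<infinity>)"
      using assms(4,5) by (simp_all add: ereal_tendsto_simps)
  qed (use assms(1) in auto)
  then show ?thesis
    by (simp add: interval_lebesgue_integral_def set_lebesgue_integral_def einterval_def)
qed

text \<open>Gaussian integration by parts (Stein's identity).\<close>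

lemma integral_gauss_mult_poly:
  fixes f :: "complex poly"
  assumes u: "u > 0"
  shows "(LINT x|lborel. gauss u (complex_of_real x) \<mu> * (complex_of_real x * poly f (complex_of_real x))) =
    \<mu> * (LINT x|lborel. gauss u (complex_of_real x) \<mu> * poly f (complex_of_real x))
    + of_real u * (LINT x|lborel. gauss u (complex_of_real x) \<mu> * poly (pderiv f) (complex_of_real x))"
proof -
  let ?g = "\<lambda>x. gauss u (complex_of_real x) \<mu>"
  let ?F = "\<lambda>x. ?g x * poly f (complex_of_real x)"
  \<comment> \<open>Chosen so that the derivative of the Gaussian times \<open>f\<close> is the
    Gaussian times \<open>?p\<close>.\<close>
  let ?p = "pderiv f - Polynomial.smult (1 / of_real u) ([:- \<mu>, 1:] * f)"
  obtain C where C: "norm \<nu> \<le> norm \<mu> \<Longrightarrow>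
      norm (gauss u (complex_of_real x) \<nu> * poly f (complex_of_real x)) \<le> C * exp (- (x\<^sup>2 / (8 * u)))" for x \<nu>
    using gauss_poly_bound[OF assms, of "norm \<mu>" f] by blast
  have lim: "(?F \<longlongrightarrow> 0) at_top" "(?F \<longlongrightarrow> 0) at_bot"
  proof -
    have "((\<lambda>x::real. C * exp (- (x\<^sup>2 / (8 * u)))) \<longlongrightarrow> 0) at_top"
      "((\<lambda>x::real. C * exp (- (x\<^sup>2 / (8 * u)))) \<longlongrightarrow> 0) at_bot"
      using u by real_asymp+
    then show "(?F \<longlongrightarrow> 0) at_top" "(?F \<longlongrightarrow> 0) at_bot"
      by (auto elim!: Lim_null_comparison[rotated] intro!: always_eventually C)
  qed
  have "(LINT x|lborel. ?g x * poly ?p (complex_of_real x)) = 0"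
  proof (rule LINT_derivative_eq_0[OF _ _ integrable_gauss_poly[OF u] lim])
    show "continuous_on UNIV (\<lambda>x. ?g x * poly ?p (complex_of_real x))"
      by (intro continuous_intros u)
    fix x
    have "((\<lambda>z. gauss u z \<mu> * poly f z) has_field_derivative
        gauss u (complex_of_real x) \<mu> * poly ?p (complex_of_real x)) (at (complex_of_real x))"
      unfolding gauss_def using u
      by (auto intro!: derivative_eq_intros poly_DERIV simp: field_simps)
    from field_vector_diff_chain_at[OF has_vector_derivative_of_real[OF DERIV_ident] this]
    show "(?F has_vector_derivative ?g x * poly ?p (complex_of_real x)) (at x)"
      by (simp add: o_def)
  qed
  also have "(\<lambda>x. ?g x * poly ?p (complex_of_real x)) = (\<lambda>x. ?g x * poly (pderiv f) (complex_of_real x)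
      - (1 / of_real u) * (?g x * poly ([:0, 1:] * f) (complex_of_real x) - \<mu> * (?g x * poly f (complex_of_real x))))"
    by (auto simp: algebra_simps)
  also have "(LINT x|lborel. \<dots> x) = (LINT x|lborel. ?g x * poly (pderiv f) (complex_of_real x))
     - (1 / of_real u) * ((LINT x|lborel. ?g x * poly ([:0, 1:] * f) (complex_of_real x)) - \<mu> * (LINT x|lborel. ?F x))"
    by (subst Bochner_Integration.integral_diff integral_mult_right_zero;
        (intro Bochner_Integration.integrable_diff integrable_mult_right integrable_gauss_poly u)?)+ simp
  finally show ?thesis using u by (simp add: field_simps)
qed

text \<open>The operator \<open>exp (- u D\<^sup>2 / 2)\<close>, backward heat flow for time
  \<open>u\<close>; monomials become Hermite polynomials. The recursion is its commutation rule with
  multiplication by the variable \<open>X\<close>: \<open>X f\<close> goes to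
  \<open>X (heat u f) - u (heat u f)'\<close>.\<close>

definition heat :: "real \<Rightarrow> complex poly \<Rightarrow> complex poly" where
  "heat u f = fold_coeffs (\<lambda>a q. pCons a q - Polynomial.smult (of_real u) (pderiv q)) f 0"

lemma heat_0 [simp]: "heat u 0 = 0"
  by (simp add: heat_def)

lemma heat_pCons [simp]: "heat u (pCons a f) = pCons a (heat u f) - Polynomial.smult (of_real u) (pderiv (heat u f))"
  by (cases "a = 0 \<and> f = 0") (auto simp: heat_def fold_coeffs_pCons_not_0_0_eq)

lemma heat_add: "heat u (f + g) = heat u f + heat u g"
proof (induction f arbitrary: g)
  case (pCons a f)
  obtain b h where g: "g = pCons b h" by (cases g)
  show ?case unfolding g by (simp add: pCons.IH pderiv_add smult_add_right)
qed simp

lemma heat_pderiv: "heat u (pderiv f) = pderiv (heat u f)"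
  by (induction f) (simp_all add: pderiv_pCons heat_add pderiv_diff pderiv_smult pderiv_add)

lemma heat_smult: "heat u (Polynomial.smult c f) = Polynomial.smult c (heat u f)"
  by (induction f) (simp_all add: pderiv_smult smult_diff_right mult.commute)

lemma heat_diff: "heat u (f - g) = heat u f - heat u g"
  using heat_add[of u f "Polynomial.smult (-1) g"] heat_smult[of u "-1" g] by simp

lemma heat_heat: "heat u (heat v f) = heat (u + v) f"
  by (induction f) (simp_all add: heat_diff heat_smult heat_pderiv smult_add_left)

lemma heat_zero_time: "heat 0 f = f"
  by (induction f) simp_all

text \<open>The correction terms are derivatives and have lower degree. Hence the change from
  heat-evolved Newton polynomials to monomials is triangular with unit diagonal.\<close>

lemma degree_heat: "degree (heat u f) \<le> degree f \<and> coeff (heat u f) (degree f) = lead_coeff f"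
proof (induction f)
  case (pCons a f)
  show ?case
  proof (cases "f = 0")
    case False
    have d: "degree (pderiv (heat u f)) \<le> degree f"
      using pCons.IH degree_pderiv[of "heat u f"] by (metis diff_le_self le_trans)
    have "degree (pCons a (heat u f)) \<le> Suc (degree f)"
      using pCons.IH by (auto intro: order_trans[OF degree_pCons_le])
    then have "degree (heat u (pCons a f)) \<le> Suc (degree f)"
      using d by (auto intro!: degree_diff_le order_trans[OF degree_smult_le])
    moreover have "coeff (pderiv (heat u f)) (Suc (degree f)) = 0"
      using d by (intro coeff_eq_0) simp
    ultimately show ?thesis using False pCons.IH by simp
  qed simp
qed simp

text \<open>Averaging against a Gaussian is forward heat flow, hence \<open>heat\<close> at negative
  time: Stein's identity reproduces the recursion of \<open>heat\<close>. It also calls for the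
  claim at the derivative, so the induction is on the degree.\<close>

lemma integral_gauss_poly:
  assumes w: "w > 0"
  shows "(LINT x|lborel. gauss w (complex_of_real x) \<mu> * poly f (complex_of_real x)) = poly (heat (- w) f) \<mu>"
proof (induction "degree f" arbitrary: f rule: less_induct)
  case less
  obtain a g where f: "f = pCons a g" by (cases f)
  show ?case
  proof (cases "g = 0")
    case True
    then show ?thesis using f by (simp add: integral_gauss[OF w])
  next
    case False
    have d: "degree g < degree f" using False f by simp
    have d': "degree (pderiv g) < degree f"
      using d degree_pderiv[of g] by simp
    have "(LINT x|lborel. gauss w (complex_of_real x) \<mu> * poly f (complex_of_real x)) =
      (LINT x|lborel. gauss w (complex_of_real x) \<mu> * poly [:a:] (complex_of_real x)
        + gauss w (complex_of_real x) \<mu> * poly ([:0, 1:] * g) (complex_of_real x))"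
      by (simp add: f algebra_simps)
    also have "\<dots> = (LINT x|lborel. gauss w (complex_of_real x) \<mu> * poly [:a:] (complex_of_real x))
        + (LINT x|lborel. gauss w (complex_of_real x) \<mu> * poly ([:0, 1:] * g) (complex_of_real x))"
      by (rule Bochner_Integration.integral_add[OF integrable_gauss_poly[OF w] integrable_gauss_poly[OF w]])
    also have "\<dots> = a + (\<mu> * poly (heat (- w) g) \<mu> + of_real w * poly (heat (- w) (pderiv g)) \<mu>)"
      using integral_gauss_mult_poly[OF w, of \<mu> g] less[OF d] less[OF d']
      by (simp add: integral_gauss[OF w])
    finally show ?thesis by (simp add: f heat_pderiv)
  qed
qed

text \<open>Substituting \<open>\<i> x\<close> into the polynomial reverses the sign of the second
  derivative and so exchanges forward and backward flow. Hence a Gaussian average along the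
  imaginary axis realizes the backward flow.\<close>

lemma integral_gauss_poly_imaginary:
  assumes u: "u > 0"
  shows "(LINT x|lborel. gauss u (complex_of_real x) (- \<i> * \<eta>) * poly f (\<i> * complex_of_real x)) = poly (heat u f) \<eta>"
proof -
  have "heat (- u) (pcompose f [:0, \<i>:]) = pcompose (heat u f) [:0, \<i>:]"
  proof (induction f)
    case (pCons a f)
    have "heat (- u) (pcompose (pCons a f) [:0, \<i>:]) = heat (- u) ([:a:] + Polynomial.smult \<i> (pCons 0 (pcompose f [:0, \<i>:])))"
      by (simp add: pcompose_pCons)
    also have "\<dots> = pcompose (heat u (pCons a f)) [:0, \<i>:]"
      by (simp only: heat_add heat_smult heat_pCons pCons.IH)
         (simp add: pcompose_pCons pcompose_diff pcompose_smult pderiv_pcompose pderiv_pCons smult_diff_right smult_add_right algebra_simps)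
    finally show ?case .
  qed simp
  moreover have "(- \<i> * \<eta>) * \<i> = \<eta>"
    by (simp add: complex_eq_iff)
  ultimately have "poly (heat (- u) (pcompose f [:0, \<i>:])) (- \<i> * \<eta>) = poly (heat u f) \<eta>"
    by (simp only: poly_pcompose) simp
  moreover have "poly f (\<i> * complex_of_real x) = poly (pcompose f [:0, \<i>:]) (complex_of_real x)" for x
    by (simp add: poly_pcompose mult.commute)
  ultimately show ?thesis using integral_gauss_poly[OF u, of "- \<i> * \<eta>" "pcompose f [:0, \<i>:]"] by simp
qed

lemma integrable_gauss_poly_imaginary:
  assumes u: "u > 0"
  shows "integrable lborel (\<lambda>x. gauss u (complex_of_real x) \<mu> * poly f (\<i> * complex_of_real x))"
proof -
  have "poly f (\<i> * complex_of_real x) = poly (pcompose f [:0, \<i>:]) (complex_of_real x)" for x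
    by (simp add: poly_pcompose mult.commute)
  then show ?thesis using integrable_gauss_poly[OF u] by simp
qed

section \<open>Products and convolutions of Gaussians\<close>

lemma gauss_commute: "gauss t y x = gauss t x y"
  by (simp add: gauss_def power2_commute)

text \<open>Completing the square in \<open>y\<close>. The second factor on the right is the
  Gaussian of the intermediate point, centred at the weighted mean of \<open>x\<close> and
  \<open>\<mu>\<close>; integrating it out leaves the Chapman-Kolmogorov equation for complex end
  points.\<close>

lemma gauss_mult_gauss:
  fixes x y \<mu> :: complex
  assumes "a > 0" "b > 0"
  shows "gauss a x y * gauss b y \<mu> =
    gauss (a + b) x \<mu> * gauss (a * b / (a + b)) y ((of_real b * x + of_real a * \<mu>) / of_real (a + b))"
proof -
  have s: "sqrt (2 * pi * a) * sqrt (2 * pi * b) = sqrt (2 * pi * (a + b)) * sqrt (2 * pi * (a * b / (a + b)))"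
    using assms unfolding real_sqrt_mult[symmetric] by (simp add: field_simps)
  have e: "- ((x - y)\<^sup>2 / of_real (2 * a)) + - ((y - \<mu>)\<^sup>2 / of_real (2 * b)) =
    - ((x - \<mu>)\<^sup>2 / of_real (2 * (a + b)))
    + - ((y - (of_real b * x + of_real a * \<mu>) / of_real (a + b))\<^sup>2 / of_real (2 * (a * b / (a + b))))"
  proof -
    define A B S where "A = complex_of_real a" "B = complex_of_real b" "S = A + B"
    define d where "d = S * y - B * x - A * \<mu>"
    have nz: "A \<noteq> 0" "B \<noteq> 0" "S \<noteq> 0"
      using assms by (auto simp: A_B_S_def simp flip: of_real_add)
    have "(x - y)\<^sup>2 / (2 * A) + (y - \<mu>)\<^sup>2 / (2 * B) = (B * S * (x - y)\<^sup>2 + A * S * (y - \<mu>)\<^sup>2) / (2 * A * B * S)"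
      using nz by (simp add: field_simps)
    also have "B * S * (x - y)\<^sup>2 + A * S * (y - \<mu>)\<^sup>2 = A * B * (x - \<mu>)\<^sup>2 + d\<^sup>2"
      by (simp add: A_B_S_def(3) d_def power2_eq_square algebra_simps)
    also have "(A * B * (x - \<mu>)\<^sup>2 + d\<^sup>2) / (2 * A * B * S) = (x - \<mu>)\<^sup>2 / (2 * S) + (d / S)\<^sup>2 / (2 * (A * B / S))"
      using nz by (simp add: field_simps power2_eq_square)
    also have "d / S = y - (B * x + A * \<mu>) / S"
      using nz by (simp add: d_def field_simps)
    finally show ?thesis
      unfolding A_B_S_def of_real_mult of_real_add of_real_divide of_real_numeral minus_add_distrib[symmetric]
      by (simp only:)
  qed
  have "gauss a x y * gauss b y \<mu> = 1 / of_real (sqrt (2 * pi * a) * sqrt (2 * pi * b)) *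
      exp (- ((x - y)\<^sup>2 / of_real (2 * a)) + - ((y - \<mu>)\<^sup>2 / of_real (2 * b)))"
    by (simp only: gauss_def exp_add of_real_mult) simp
  also have "\<dots> = gauss (a + b) x \<mu> * gauss (a * b / (a + b)) y ((of_real b * x + of_real a * \<mu>) / of_real (a + b))"
    unfolding s e by (simp only: gauss_def exp_add of_real_mult) simp
  finally show ?thesis .
qed

lemma has_bochner_integral_gauss_gauss:
  fixes x \<mu> :: complex
  assumes "a > 0" "b > 0"
  shows "has_bochner_integral lborel (\<lambda>y. gauss a x (complex_of_real y) * gauss b (complex_of_real y) \<mu>)
    (gauss (a + b) x \<mu>)"
proof -
  let ?m = "(of_real b * x + of_real a * \<mu>) / of_real (a + b)" and ?c = "a * b / (a + b)"
  have c: "?c > 0" using assms by simp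
  have "has_bochner_integral lborel (\<lambda>y. gauss ?c (complex_of_real y) ?m) 1"
    using integrable_gauss_poly[OF c, of ?m 1] integral_gauss[OF c]
    by (simp add: has_bochner_integral_iff)
  from has_bochner_integral_mult_right[OF this, of "gauss (a + b) x \<mu>"]
  show ?thesis unfolding gauss_mult_gauss[OF assms] by simp
qed

section \<open>Divided differences as contour integrals\<close>

text \<open>The contour integral over the circle divided by \<open>2 \<pi> \<i>\<close>; the
  velocity of \<open>circlepath\<close> is \<open>2 \<pi> \<i>\<close> times its position. As an
  integral over a fixed parameter interval it is open to theorems on continuity in parameters and to
  Fubini.\<close>

definition cint :: "real \<Rightarrow> (complex \<Rightarrow> complex) \<Rightarrow> complex" where
  "cint R g = integral {0..1} (\<lambda>\<tau>. g (circlepath 0 R \<tau>) * circlepath 0 R \<tau>)"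

lemma contour_integral_circlepath_eq_cint:
  "contour_integral (circlepath 0 R) g = 2 * of_real pi * \<i> * cint R g"
proof -
  have "contour_integral (circlepath 0 R) g =
      integral {0..1} (\<lambda>\<tau>. (2 * of_real pi * \<i>) * (g (circlepath 0 R \<tau>) * circlepath 0 R \<tau>))"
    unfolding contour_integral_integral
    by (rule Henstock_Kurzweil_Integration.integral_cong)
       (simp add: vector_derivative_circlepath, simp add: circlepath mult_ac)
  then show ?thesis by (simp add: cint_def)
qed

lemma norm_circlepath_0: "R \<ge> 0 \<Longrightarrow> norm (circlepath 0 R \<tau>) = R"
  by (simp add: circlepath norm_mult)

lemma continuous_on_circlepath: "continuous_on A (circlepath 0 R)"
  unfolding circlepath by (intro continuous_intros)

lemma cint_cong:
  assumes "R \<ge> 0" "\<And>\<mu>. norm \<mu> = R \<Longrightarrow> f \<mu> = g \<mu>"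
  shows "cint R f = cint R g"
  unfolding cint_def by (rule Henstock_Kurzweil_Integration.integral_cong) (simp add: assms norm_circlepath_0)

lemma cint_mult_left: "cint R (\<lambda>\<mu>. c * f \<mu>) = c * cint R f"
  unfolding cint_def mult.assoc by simp

lemma cint_integrable:
  assumes "R \<ge> 0" "continuous_on (sphere 0 R) f"
  shows "(\<lambda>\<tau>. f (circlepath 0 R \<tau>) * circlepath 0 R \<tau>) integrable_on {0..1}"
  by (rule integrable_continuous_real)
     (intro continuous_intros continuous_on_circlepath continuous_on_compose2[OF assms(2)],
      use assms norm_circlepath_0 in auto)

lemma cint_add:
  assumes "R \<ge> 0" "continuous_on (sphere 0 R) f" "continuous_on (sphere 0 R) g"
  shows "cint R (\<lambda>\<mu>. f \<mu> + g \<mu>) = cint R f + cint R g"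
  unfolding cint_def distrib_right
  by (rule Henstock_Kurzweil_Integration.integral_add) (intro cint_integrable assms)+

lemma cint_sum:
  assumes "R \<ge> 0" "finite A" "\<And>a. a \<in> A \<Longrightarrow> continuous_on (sphere 0 R) (f a)"
  shows "cint R (\<lambda>\<mu>. \<Sum>a\<in>A. f a \<mu>) = (\<Sum>a\<in>A. cint R (f a))"
  unfolding cint_def sum_distrib_right
  by (rule Henstock_Kurzweil_Integration.integral_sum) (intro cint_integrable assms)+

lemma cint_Cauchy:
  assumes "f holomorphic_on cball 0 R" "norm z < R"
  shows "cint R (\<lambda>\<mu>. f \<mu> / (\<mu> - z)) = f z"
proof -
  have "((\<lambda>\<mu>. f \<mu> / (\<mu> - z)) has_contour_integral 2 * of_real pi * \<i> * f z) (circlepath 0 R)"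
    by (rule Cauchy_integral_circlepath_simple) (use assms in auto)
  from contour_integral_unique[OF this] show ?thesis
    by (simp add: contour_integral_circlepath_eq_cint)
qed

lemma cint_holomorphic:
  assumes "f holomorphic_on UNIV"
  shows "cint R f = 0"
proof -
  have "(f has_contour_integral 0) (circlepath 0 R)"
    by (rule Cauchy_theorem_convex_simple[OF assms]) auto
  from contour_integral_unique[OF this] show ?thesis
    by (simp add: contour_integral_circlepath_eq_cint)
qed

lemma continuous_on_cint:
  assumes "R \<ge> 0" "continuous_on (U \<times> sphere 0 R) (\<lambda>(x, \<mu>). g x \<mu>)"
  shows "continuous_on U (\<lambda>x. cint R (g x))"
proof -
  have "continuous_on (U \<times> cbox 0 1) (\<lambda>(x, \<tau>). g x (circlepath 0 R \<tau>) * circlepath 0 R \<tau>)"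
  proof -
    have "continuous_on (U \<times> cbox 0 1) (\<lambda>p. (\<lambda>(x, \<mu>). g x \<mu>) (fst p, circlepath 0 R (snd p)) * circlepath 0 R (snd p))"
      by (intro continuous_intros continuous_on_compose2[OF assms(2)]
            continuous_on_compose2[OF continuous_on_circlepath[of UNIV]])
         (use assms norm_circlepath_0 in auto)
    then show ?thesis by (simp add: case_prod_unfold)
  qed
  from integral_continuous_on_param[OF this] show ?thesis by (simp add: cint_def)
qed

text \<open>The mean value property, for the circle run backwards: this is the parametrization that
  the inversion of the circle produces.\<close>

lemma cint_reflect:
  assumes "R > 0" "g holomorphic_on cball 0 R"
  shows "integral {0..1} (\<lambda>\<tau>. g (circlepath 0 R (1 - \<tau>))) = g 0"
proof -
  have nz: "circlepath 0 R \<tau> \<noteq> 0" for \<tau> using assms by (simp add: circlepath)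
  have c: "continuous_on {0..1} (\<lambda>\<tau>. g (circlepath 0 R \<tau>))"
    by (intro continuous_on_compose2[OF holomorphic_on_imp_continuous_on[OF assms(2)]] continuous_on_circlepath)
       (use assms norm_circlepath_0 in auto)
  have "((\<lambda>\<tau>. g (circlepath 0 R \<tau>)) has_integral integral {0..1} (\<lambda>\<tau>. g (circlepath 0 R \<tau>))) (cbox 0 1)"
    using integrable_integral[OF integrable_continuous_real[OF c]] by simp
  from has_integral_affinity[OF this, of "-1" 1]
  have "((\<lambda>\<tau>. g (circlepath 0 R (1 - \<tau>))) has_integral integral {0..1} (\<lambda>\<tau>. g (circlepath 0 R \<tau>))) ((\<lambda>x. 1 - x) ` {0..1})"
    by (simp add: add.commute)
  moreover have "(\<lambda>x::real. 1 - x) ` {0..1} = {0..1}"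
    by (force simp: image_iff intro: bexI[of _ "1 - _"])
  ultimately have "integral {0..1} (\<lambda>\<tau>. g (circlepath 0 R (1 - \<tau>))) = integral {0..1} (\<lambda>\<tau>. g (circlepath 0 R \<tau>))"
    by (simp add: integral_unique)
  also have "\<dots> = cint R (\<lambda>\<mu>. g \<mu> / (\<mu> - 0))"
    unfolding cint_def by (rule Henstock_Kurzweil_Integration.integral_cong) (simp add: nz)
  also have "\<dots> = g 0" by (rule cint_Cauchy) (use assms in auto)
  finally show ?thesis .
qed

section \<open>Newton polynomials and divided differences\<close>

definition newton :: "(nat \<Rightarrow> real) \<Rightarrow> nat \<Rightarrow> complex poly" where
  "newton \<nu> k = (\<Prod>j<k. [:- complex_of_real (\<nu> j), 1:])"

lemma poly_newton: "poly (newton \<nu> k) z = (\<Prod>j<k. z - complex_of_real (\<nu> j))"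
  by (simp add: newton_def poly_prod)

lemma newton_Suc: "newton \<nu> (Suc k) = [:- complex_of_real (\<nu> k), 1:] * newton \<nu> k"
  by (simp add: newton_def)

lemma degree_newton: "degree (newton \<nu> k) = k" and coeff_newton: "coeff (newton \<nu> k) k = 1"
proof -
  have "degree (newton \<nu> k) = k \<and> lead_coeff (newton \<nu> k) = 1"
  proof (induction k)
    case (Suc k)
    then have "newton \<nu> k \<noteq> 0" by auto
    then have "degree (newton \<nu> (Suc k)) = Suc k"
      using Suc by (simp add: newton_Suc degree_mult_eq del: mult_pCons_left)
    moreover have "lead_coeff (newton \<nu> (Suc k)) = 1"
      unfolding newton_Suc lead_coeff_mult using Suc by auto
    ultimately show ?case by simp
  qed (simp add: newton_def)
  then show "degree (newton \<nu> k) = k" "coeff (newton \<nu> k) k = 1" by auto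
qed

lemma poly_newton_eq_0: "j < k \<Longrightarrow> poly (newton \<nu> k) (complex_of_real (\<nu> j)) = 0"
  by (auto simp: poly_newton)

text \<open>For entire \<open>f\<close> and nodes inside the circle, the divided difference at the
  \<open>k + 1\<close> nodes \<open>\<nu> 0, ..., \<nu> k\<close>, hence
  \<open>newton \<nu> (Suc k)\<close> in the denominator. At repeated nodes it involves derivatives
  of \<open>f\<close>.\<close>

definition divdiff :: "real \<Rightarrow> (nat \<Rightarrow> real) \<Rightarrow> nat \<Rightarrow> (complex \<Rightarrow> complex) \<Rightarrow> complex" where
  "divdiff R \<nu> k f = cint R (\<lambda>\<mu>. f \<mu> / poly (newton \<nu> (Suc k)) \<mu>)"

lemma poly_newton_nz:
  assumes "\<And>j. j < k \<Longrightarrow> \<bar>\<nu> j\<bar> < R" "norm \<mu> = R"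
  shows "poly (newton \<nu> k) \<mu> \<noteq> 0"
  using assms by (force simp: poly_newton)

text \<open>Each remainder splits into one more summand and the next remainder, because
  \<open>\<mu> - \<nu> n = (\<mu> - z) + (z - \<nu> n)\<close>.\<close>

lemma newton_expansion:
  assumes "\<mu> \<noteq> z" "\<And>j. j < n \<Longrightarrow> \<mu> \<noteq> complex_of_real (\<nu> j)"
  shows "1 / (\<mu> - z) = (\<Sum>k<n. poly (newton \<nu> k) z / poly (newton \<nu> (Suc k)) \<mu>)
    + poly (newton \<nu> n) z / (poly (newton \<nu> n) \<mu> * (\<mu> - z))"
  using assms(2)
proof (induction n)
  case 0
  then show ?case by (simp add: newton_def)
next
  case (Suc n)
  have nz: "poly (newton \<nu> n) \<mu> \<noteq> 0" "\<mu> - of_real (\<nu> n) \<noteq> 0" "\<mu> - z \<noteq> 0"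
    using Suc.prems assms(1) by (auto simp: poly_newton)
  have "poly (newton \<nu> n) z / (poly (newton \<nu> n) \<mu> * (\<mu> - z)) =
     poly (newton \<nu> n) z / poly (newton \<nu> (Suc n)) \<mu> +
     poly (newton \<nu> (Suc n)) z / (poly (newton \<nu> (Suc n)) \<mu> * (\<mu> - z))"
    using nz by (simp add: newton_Suc divide_simps) (simp add: algebra_simps)
  then show ?case using Suc by simp
qed

text \<open>\<open>newton_expansion\<close> inserted into Cauchy's formula: Newton's interpolation
  formula with Hermite's form of the remainder.\<close>

lemma newton_interpolation:
  assumes f: "f holomorphic_on UNIV" and z: "norm z < R" and \<nu>: "\<And>j. j < n \<Longrightarrow> \<bar>\<nu> j\<bar> < R"
  shows "f z = (\<Sum>k<n. poly (newton \<nu> k) z * divdiff R \<nu> k f)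
    + poly (newton \<nu> n) z * cint R (\<lambda>\<mu>. f \<mu> / (poly (newton \<nu> n) \<mu> * (\<mu> - z)))"
proof -
  have R: "R \<ge> 0" using z norm_ge_zero[of z] by linarith
  have nz: "poly (newton \<nu> k) \<mu> \<noteq> 0" if "k \<le> n" "norm \<mu> = R" for k \<mu>
    using that \<nu> by (intro poly_newton_nz) auto
  have cf: "continuous_on (sphere 0 R) f"
    using holomorphic_on_imp_continuous_on[OF f] continuous_on_subset by blast
  have "f z = cint R (\<lambda>\<mu>. f \<mu> / (\<mu> - z))" by (rule cint_Cauchy[OF holomorphic_on_subset[OF f] z, symmetric]) simp
  also have "\<dots> = cint R (\<lambda>\<mu>. (\<Sum>k<n. poly (newton \<nu> k) z * (f \<mu> / poly (newton \<nu> (Suc k)) \<mu>))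
    + poly (newton \<nu> n) z * (f \<mu> / (poly (newton \<nu> n) \<mu> * (\<mu> - z))))"
  proof (rule cint_cong[OF R])
    fix \<mu> :: complex assume \<mu>: "norm \<mu> = R"
    then have "\<mu> \<noteq> z" "\<mu> \<noteq> complex_of_real (\<nu> j)" if "j < n" for j using z \<nu>[OF that] by auto
    moreover have "\<mu> \<noteq> z" using \<mu> z by auto
    ultimately have "f \<mu> / (\<mu> - z) = f \<mu> * ((\<Sum>k<n. poly (newton \<nu> k) z / poly (newton \<nu> (Suc k)) \<mu>)
      + poly (newton \<nu> n) z / (poly (newton \<nu> n) \<mu> * (\<mu> - z)))"
      by (subst newton_expansion[symmetric]) auto
    then show "f \<mu> / (\<mu> - z) = (\<Sum>k<n. poly (newton \<nu> k) z * (f \<mu> / poly (newton \<nu> (Suc k)) \<mu>))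
      + poly (newton \<nu> n) z * (f \<mu> / (poly (newton \<nu> n) \<mu> * (\<mu> - z)))"
      by (simp add: distrib_left sum_distrib_left mult.commute)
  qed
  also have "\<dots> = cint R (\<lambda>\<mu>. \<Sum>k<n. poly (newton \<nu> k) z * (f \<mu> / poly (newton \<nu> (Suc k)) \<mu>))
    + cint R (\<lambda>\<mu>. poly (newton \<nu> n) z * (f \<mu> / (poly (newton \<nu> n) \<mu> * (\<mu> - z))))"
    by (intro cint_add[OF R] continuous_intros cf) (use nz z in auto)
  also have "cint R (\<lambda>\<mu>. \<Sum>k<n. poly (newton \<nu> k) z * (f \<mu> / poly (newton \<nu> (Suc k)) \<mu>)) =
      (\<Sum>k<n. cint R (\<lambda>\<mu>. poly (newton \<nu> k) z * (f \<mu> / poly (newton \<nu> (Suc k)) \<mu>)))"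
    by (intro cint_sum[OF R] continuous_intros cf) (use nz in auto)
  finally show ?thesis by (simp only: cint_mult_left divdiff_def)
qed

text \<open>The inversion \<open>\<mu> \<mapsto> R\<^sup>2 / \<mu>\<close> of the circle moves the only pole to 0.\<close>

lemma divdiff_poly:
  assumes \<nu>: "\<And>j. j \<le> k \<Longrightarrow> \<bar>\<nu> j\<bar> < R" and p: "degree p \<le> k"
  shows "divdiff R \<nu> k (poly p) = coeff p k"
proof -
  have R: "R > 0" using \<nu>[of k] by auto
  \<comment> \<open>For \<open>w = R\<^sup>2 / \<mu>\<close>, \<open>h w\<close> is
    \<open>poly p \<mu> / \<mu> ^ k\<close> and \<open>d w\<close> is
    \<open>poly (newton \<nu> (Suc k)) \<mu> / \<mu> ^ Suc k\<close>. The zeros of \<open>d\<close>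
    lie outside the closed disc, and \<open>h 0 / d 0\<close> is the coefficient sought.\<close>
  define h where "h = (\<lambda>w. (\<Sum>i\<le>k. coeff p i * (w / (of_real R)\<^sup>2) ^ (k - i)))"
  define d where "d = (\<lambda>w. \<Prod>j\<le>k. 1 - complex_of_real (\<nu> j) * (w / (of_real R)\<^sup>2))"
  have dnz: "d w \<noteq> 0" if "norm w \<le> R" for w
  proof -
    have "1 - complex_of_real (\<nu> j) * (w / (of_real R)\<^sup>2) \<noteq> 0" if j: "j \<le> k" for j
    proof
      assume "1 - complex_of_real (\<nu> j) * (w / (of_real R)\<^sup>2) = 0"
      then have "norm (complex_of_real (\<nu> j) * (w / (of_real R)\<^sup>2)) = 1" by simp
      then have "\<bar>\<nu> j\<bar> * norm w = R * R" using R by (simp add: norm_mult norm_divide norm_power power2_eq_square field_simps)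
      moreover have "\<bar>\<nu> j\<bar> * norm w \<le> \<bar>\<nu> j\<bar> * R" using \<open>norm w \<le> R\<close> by (intro mult_left_mono) auto
      moreover have "\<bar>\<nu> j\<bar> * R < R * R" using \<nu>[OF j] R by simp
      ultimately show False by simp
    qed
    then show ?thesis by (auto simp: d_def)
  qed
  let ?c = "circlepath 0 R"
  have cc: "?c \<tau> * ?c (1 - \<tau>) = (of_real R)\<^sup>2" for \<tau>
  proof -
    have "?c \<tau> * ?c (1 - \<tau>) = (of_real R)\<^sup>2 * (exp (2 * of_real pi * \<i> * of_real \<tau>) * exp (2 * of_real pi * \<i> * of_real (1 - \<tau>)))"
      by (simp add: circlepath power2_eq_square)
    also have "exp (2 * of_real pi * \<i> * of_real \<tau>) * exp (2 * of_real pi * \<i> * of_real (1 - \<tau>)) = exp (2 * of_real pi * \<i>)"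
      unfolding exp_add[symmetric] by (simp add: algebra_simps)
    finally show ?thesis by (simp add: exp_two_pi_i)
  qed
  have cnz: "?c \<tau> \<noteq> 0" for \<tau> using R by (simp add: circlepath)
  have *: "poly p (?c \<tau>) / poly (newton \<nu> (Suc k)) (?c \<tau>) * ?c \<tau> = h (?c (1 - \<tau>)) / d (?c (1 - \<tau>))" for \<tau>
  proof -
    have inv: "?c (1 - \<tau>) / (of_real R)\<^sup>2 = 1 / ?c \<tau>"
      using cc[of \<tau>] cnz[of \<tau>] R by (simp add: field_simps)
    have "poly p (?c \<tau>) = (\<Sum>i\<le>k. coeff p i * ?c \<tau> ^ i)"
      unfolding poly_altdef using p
      by (intro sum.mono_neutral_left) (auto intro: coeff_eq_0)
    also have "\<dots> = ?c \<tau> ^ k * h (?c (1 - \<tau>))"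
      unfolding h_def inv sum_distrib_left
      by (intro sum.cong refl) (simp add: cnz power_diff power_one_over field_simps)
    finally have 1: "poly p (?c \<tau>) = ?c \<tau> ^ k * h (?c (1 - \<tau>))" .
    have "poly (newton \<nu> (Suc k)) (?c \<tau>) = (\<Prod>j\<le>k. ?c \<tau> * (1 - complex_of_real (\<nu> j) * (?c (1 - \<tau>) / (of_real R)\<^sup>2)))"
      unfolding poly_newton inv lessThan_Suc_atMost
      by (intro prod.cong refl) (simp add: cnz field_simps)
    also have "\<dots> = ?c \<tau> ^ Suc k * d (?c (1 - \<tau>))"
      by (simp add: prod.distrib d_def)
    finally show ?thesis using 1 cnz[of \<tau>] by simp
  qed
  have "divdiff R \<nu> k (poly p) = integral {0..1} (\<lambda>\<tau>. h (?c (1 - \<tau>)) / d (?c (1 - \<tau>)))"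
    unfolding divdiff_def cint_def * ..
  also have "\<dots> = h 0 / d 0"
    by (rule cint_reflect[OF R, where g = "\<lambda>w. h w / d w"])
       (unfold h_def d_def, intro holomorphic_intros, use R dnz in \<open>auto simp: d_def\<close>)
  also have "\<dots> = coeff p k"
    by (simp add: h_def d_def power_0_left if_distrib[of "\<lambda>x. _ * x"] cong: if_cong)
  finally show ?thesis .
qed

text \<open>For \<open>k \<le> l\<close> this is the coefficient of order \<open>l\<close> of a
  monic polynomial of degree \<open>k\<close>. For \<open>k > l\<close> the denominator divides
  \<open>newton \<nu> k\<close>, and the integral over the circle vanishes by Cauchy's
  theorem.\<close>

lemma divdiff_newton:
  assumes \<nu>: "\<And>j. j < N \<Longrightarrow> \<bar>\<nu> j\<bar> < R" and "k < N" "l < N"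
  shows "divdiff R \<nu> l (poly (newton \<nu> k)) = (if k = l then 1 else 0)"
proof (cases "k \<le> l")
  case True
  have "divdiff R \<nu> l (poly (newton \<nu> k)) = coeff (newton \<nu> k) l"
    using True \<nu> assms(2,3) by (intro divdiff_poly) (auto simp: degree_newton)
  then show ?thesis using True coeff_newton[of \<nu> l]
    by (cases "k = l") (simp_all add: coeff_eq_0 degree_newton)
next
  case False
  have R: "R \<ge> 0" using \<nu>[OF assms(2)] by auto
  have "divdiff R \<nu> l (poly (newton \<nu> k)) = cint R (\<lambda>\<mu>. \<Prod>j\<in>{Suc l..<k}. \<mu> - of_real (\<nu> j))"
    unfolding divdiff_def
  proof (rule cint_cong[OF R])
    fix \<mu> :: complex assume \<mu>: "norm \<mu> = R"
    have nz: "poly (newton \<nu> (Suc l)) \<mu> \<noteq> 0" using \<mu> \<nu> assms by (intro poly_newton_nz) auto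
    have un: "{..<k} = {..<Suc l} \<union> {Suc l..<k}" using False by auto
    have "poly (newton \<nu> k) \<mu> = poly (newton \<nu> (Suc l)) \<mu> * (\<Prod>j\<in>{Suc l..<k}. \<mu> - of_real (\<nu> j))"
      unfolding poly_newton un by (rule prod.union_disjoint) auto
    then show "poly (newton \<nu> k) \<mu> / poly (newton \<nu> (Suc l)) \<mu> = (\<Prod>j\<in>{Suc l..<k}. \<mu> - of_real (\<nu> j))"
      using nz by simp
  qed
  also have "\<dots> = 0" by (intro cint_holomorphic holomorphic_intros)
  finally show ?thesis using False by auto
qed

text \<open>The poles lie in the support, where \<open>\<gamma>\<close> and the circle both have
  winding number 1; the residue theorem gives equal values.\<close>

lemma contour_integral_eq_divdiff:
  assumes f: "f holomorphic_on UNIV" and \<nu>: "\<And>j. j < N \<Longrightarrow> \<bar>\<nu> j\<bar> < R" and k: "k < N"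
    and \<gamma>: "encircles_once \<gamma> (supp_points N \<nu>) P"
  shows "contour_integral \<gamma> (\<lambda>\<mu>. f \<mu> / poly (newton \<nu> (Suc k)) \<mu>) = 2 * of_real pi * \<i> * divdiff R \<nu> k f"
proof -
  let ?F = "\<lambda>\<mu>. f \<mu> / poly (newton \<nu> (Suc k)) \<mu>" and ?S = "supp_points N \<nu>"
  have fin: "finite ?S" by (simp add: supp_points_def)
  have hol: "?F holomorphic_on UNIV - ?S"
    using k by (intro holomorphic_intros holomorphic_on_subset[OF f])
      (auto simp: poly_newton supp_points_def)
  have "contour_integral \<gamma> ?F = of_real (2 * pi) * \<i> * (\<Sum>p\<in>?S. winding_number \<gamma> p * residue ?F p)"
  proof (rule Residue_theorem[OF open_UNIV connected_UNIV fin hol])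
    show "valid_path \<gamma>" "pathfinish \<gamma> = pathstart \<gamma>" "path_image \<gamma> \<subseteq> UNIV - ?S"
      using \<gamma> unfolding encircles_once_def by blast+
  qed simp
  also have "\<dots> = of_real (2 * pi) * \<i> * (\<Sum>p\<in>?S. winding_number (circlepath 0 R) p * residue ?F p)"
  proof (intro arg_cong2[where f = "(*)"] refl sum.cong)
    fix p assume p: "p \<in> ?S"
    then have "norm (p - 0) < R" using \<nu> by (auto simp: supp_points_def)
    then show "winding_number \<gamma> p = winding_number (circlepath 0 R) p"
      using p \<gamma> by (simp add: encircles_once_def winding_number_circlepath)
  qed
  also have "\<dots> = contour_integral (circlepath 0 R) ?F"
  proof (rule Residue_theorem[OF open_UNIV connected_UNIV fin hol, symmetric])
    have "R > 0" using \<nu>[OF k] by auto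
    then show "path_image (circlepath 0 R) \<subseteq> UNIV - ?S"
      using \<nu> by (force simp: supp_points_def)
  qed simp_all
  finally show ?thesis by (simp only: contour_integral_circlepath_eq_cint divdiff_def)
qed

text \<open>By Newton interpolation the values at the nodes are a lower triangular transform of the
  divided differences, with the factors of the Vandermonde product on the diagonal. Holds for
  repeated nodes too, where both sides vanish.\<close>

lemma det_fun_newton:
  assumes f: "\<And>j. j < N \<Longrightarrow> f j holomorphic_on UNIV" and \<nu>: "\<And>j. j < N \<Longrightarrow> \<bar>\<nu> j\<bar> < R"
  shows "det_fun N (\<lambda>i j. f j (of_real (\<nu> i))) =
    (\<Prod>i<N. poly (newton \<nu> i) (of_real (\<nu> i))) * det_fun N (\<lambda>k j. divdiff R \<nu> k (f j))"
proof -
  have "det_fun N (\<lambda>i j. f j (of_real (\<nu> i))) =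
      det_fun N (\<lambda>i j. \<Sum>k<N. poly (newton \<nu> k) (of_real (\<nu> i)) * divdiff R \<nu> k (f j))"
  proof (rule det_fun_cong)
    fix i j assume "i < N" "j < N"
    then show "f j (of_real (\<nu> i)) = (\<Sum>k<N. poly (newton \<nu> k) (of_real (\<nu> i)) * divdiff R \<nu> k (f j))"
      using newton_interpolation[OF f[OF \<open>j < N\<close>], of "of_real (\<nu> i)" R N \<nu>] \<nu>
      by (simp add: poly_newton_eq_0)
  qed
  also have "\<dots> = (\<Prod>i<N. poly (newton \<nu> i) (of_real (\<nu> i))) * det_fun N (\<lambda>k j. divdiff R \<nu> k (f j))"
    by (rule det_fun_triangular_mult) (simp add: poly_newton_eq_0)
  finally show ?thesis .
qed

text \<open>The circle is fixed while nodes and integrand vary, and the denominator has no zero on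
  it. Nodes may therefore collide.\<close>

lemma continuous_on_divdiff:
  fixes f :: "'b::topological_space \<Rightarrow> complex \<Rightarrow> complex"
  assumes R: "R \<ge> 0" and f: "continuous_on (U \<times> sphere 0 R) (\<lambda>(x, \<mu>). f x \<mu>)"
    and \<nu>: "\<And>j. j \<le> k \<Longrightarrow> continuous_on U (\<lambda>x. \<nu> x j)" "\<And>x j. x \<in> U \<Longrightarrow> j \<le> k \<Longrightarrow> \<bar>\<nu> x j\<bar> < R"
  shows "continuous_on U (\<lambda>x. divdiff R (\<nu> x) k (f x))"
  unfolding divdiff_def
proof (rule continuous_on_cint[OF R])
  have "continuous_on (U \<times> sphere 0 R) (\<lambda>p. (\<lambda>(x, \<mu>). f x \<mu>) p / (\<Prod>j\<in>{..<Suc k}. snd p - of_real (\<nu> (fst p) j)))"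
  proof (intro continuous_on_divide f continuous_on_prod continuous_intros ballI
      continuous_on_compose2[OF \<nu>(1) continuous_on_fst[OF continuous_on_id]])
    fix p :: "'b \<times> complex" assume p: "p \<in> U \<times> sphere 0 R"
    show "(\<Prod>j\<in>{..<Suc k}. snd p - of_real (\<nu> (fst p) j)) \<noteq> 0"
      unfolding poly_newton[symmetric] by (rule poly_newton_nz[where R = R]) (use p \<nu>(2) in auto)
  qed auto
  then show "continuous_on (U \<times> sphere 0 R) (\<lambda>(x, \<mu>). f x \<mu> / poly (newton (\<nu> x) (Suc k)) \<mu>)"
    by (simp only: case_prod_unfold poly_newton)
qed

text \<open>Allows a second divided difference, now in \<open>z\<close>, as in
  \<open>biconf_det\<close>.\<close>

lemma holomorphic_divdiff_exp:
  assumes \<nu>: "\<And>j. j \<le> k \<Longrightarrow> \<bar>\<nu> j\<bar> < R"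
  shows "(\<lambda>z. divdiff R \<nu> k (\<lambda>\<mu>. exp (z * \<mu>))) holomorphic_on UNIV"
proof -
  let ?c = "circlepath 0 R"
  let ?w = "\<lambda>\<tau>. ?c \<tau> / poly (newton \<nu> (Suc k)) (?c \<tau>)"
  have R: "R \<ge> 0" using \<nu>[of k] by auto
  have nz: "poly (newton \<nu> (Suc k)) (?c \<tau>) \<noteq> 0" for \<tau>
    by (rule poly_newton_nz[where R = R]) (use \<nu> norm_circlepath_0[OF R] in auto)
  have cw: "continuous_on A ?w" for A
    by (intro continuous_intros continuous_on_circlepath) (use nz in auto)
  have "(\<lambda>z. integral (cbox 0 1) (\<lambda>\<tau>. exp (z * ?c \<tau>) * ?w \<tau>)) holomorphic_on UNIV"
  proof (rule leibniz_rule_holomorphic)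
    show "((\<lambda>z. exp (z * ?c \<tau>) * ?w \<tau>) has_field_derivative exp (z * ?c \<tau>) * ?c \<tau> * ?w \<tau>) (at z within UNIV)" for z \<tau>
      by (intro DERIV_cmult_right) (auto intro!: derivative_eq_intros)
    show "(\<lambda>\<tau>. exp (z * ?c \<tau>) * ?w \<tau>) integrable_on cbox 0 1" for z
      by (intro integrable_continuous continuous_intros cw continuous_on_circlepath)
    show "continuous_on (UNIV \<times> cbox 0 1) (\<lambda>(z, \<tau>). exp (z * ?c \<tau>) * ?c \<tau> * ?w \<tau>)"
      unfolding case_prod_unfold
      by (intro continuous_intros continuous_on_compose2[OF cw[of UNIV]]
          continuous_on_compose2[OF continuous_on_circlepath[of UNIV]]) auto
  qed auto
  then show ?thesis by (simp add: divdiff_def cint_def algebra_simps)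
qed

text \<open>Fubini for the circle and the real line. The gauge integral over the parameter is first
  rewritten as a Lebesgue integral with the indicator in \<open>H\<close>; the bound that is uniform
  on the circle makes \<open>H\<close> integrable on the product.\<close>

lemma has_bochner_integral_cint:
  fixes G :: "complex \<Rightarrow> real \<Rightarrow> complex"
  assumes R: "R \<ge> 0" and G: "continuous_on (sphere 0 R \<times> UNIV) (\<lambda>(\<mu>, x). G \<mu> x)"
    and bound: "\<And>\<mu> x. norm \<mu> = R \<Longrightarrow> norm (G \<mu> x) \<le> B x" and B: "integrable lborel B"
  shows "has_bochner_integral lborel (\<lambda>x. cint R (\<lambda>\<mu>. G \<mu> x)) (cint R (\<lambda>\<mu>. LINT x|lborel. G \<mu> x))"
proof -
  let ?c = "circlepath 0 R"
  define H where "H = (\<lambda>\<tau> x. indicator {0..1} \<tau> *\<^sub>R (G (?c \<tau>) x * ?c \<tau>))"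
  have cH: "continuous_on A (\<lambda>p. G (?c (fst p)) (snd p) * ?c (fst p))" for A
    using R by (intro continuous_intros continuous_on_compose2[OF continuous_on_circlepath[of UNIV]]
       continuous_on_compose2[OF G, of _ "\<lambda>p. (?c (fst p), snd p)", simplified])
      (auto simp: norm_circlepath_0)
  have mH: "(\<lambda>(\<tau>, x). H \<tau> x) \<in> borel_measurable (lborel \<Otimes>\<^sub>M lborel)"
  proof -
    have "(\<lambda>p. G (?c (fst p)) (snd p) * ?c (fst p)) \<in> borel_measurable (borel :: (real \<times> real) measure)"
      by (rule borel_measurable_continuous_onI[OF cH])
    then have [measurable]: "(\<lambda>p. G (?c (fst p)) (snd p) * ?c (fst p)) \<in> borel_measurable (lborel \<Otimes>\<^sub>M lborel)"
      by (simp add: lborel_prod)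
    show ?thesis unfolding H_def case_prod_unfold by measurable
  qed
  have nH: "norm (H \<tau> x) \<le> indicator {0..1} \<tau> * R * B x" for \<tau> x
  proof (cases "\<tau> \<in> {0..1}")
    case True
    then have "norm (H \<tau> x) = norm (G (?c \<tau>) x) * R"
      by (simp add: H_def norm_mult norm_circlepath_0[OF R])
    also have "\<dots> \<le> B x * R"
      by (intro mult_right_mono bound norm_circlepath_0 R)
    finally show ?thesis using True by (simp add: mult.commute)
  qed (simp add: H_def)
  have intHx: "integrable lborel (H \<tau>)" for \<tau>
  proof (rule Bochner_Integration.integrable_bound)
    show "integrable lborel (\<lambda>x. (indicator {0..1} \<tau> * R) * B x)" using B by simp
    show "H \<tau> \<in> borel_measurable lborel"
      using measurable_compose[OF measurable_Pair1'[of \<tau> lborel lborel] mH] by simp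
  qed (use nH in \<open>auto intro!: AE_I2 order_trans[OF _ abs_ge_self]\<close>)
  have int: "integrable (lborel \<Otimes>\<^sub>M lborel) (\<lambda>(\<tau>, x). H \<tau> x)"
  proof (rule lborel_pair.Fubini_integrable[OF mH])
    show "integrable lborel (\<lambda>\<tau>. LINT x|lborel. norm (case (\<tau>, x) of (\<tau>, x) \<Rightarrow> H \<tau> x))"
    proof (rule Bochner_Integration.integrable_bound)
      show "integrable lborel (\<lambda>\<tau>. indicator {0..1::real} \<tau> * (R * (LINT x|lborel. B x)))"
        by (intro integrable_mult_left integrable_real_indicator) auto
      have "(\<lambda>p. norm ((\<lambda>(\<tau>, x). H \<tau> x) p)) \<in> borel_measurable (lborel \<Otimes>\<^sub>M lborel)"
        using mH by measurable
      then have "(\<lambda>(\<tau>, x). norm (H \<tau> x)) \<in> borel_measurable (lborel \<Otimes>\<^sub>M lborel)"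
        by (simp add: case_prod_unfold)
      from lborel.borel_measurable_lebesgue_integral[OF this]
      show "(\<lambda>\<tau>. LINT x|lborel. norm (case (\<tau>, x) of (\<tau>, x) \<Rightarrow> H \<tau> x)) \<in> borel_measurable lborel" by simp
      show "AE \<tau> in lborel. norm (LINT x|lborel. norm (case (\<tau>, x) of (\<tau>, x) \<Rightarrow> H \<tau> x))
          \<le> norm (indicator {0..1} \<tau> * (R * (LINT x|lborel. B x)))"
      proof (rule AE_I2)
        fix \<tau>
        have "(LINT x|lborel. norm (H \<tau> x)) \<le> (LINT x|lborel. indicator {0..1} \<tau> * R * B x)"
          by (rule integral_mono[OF integrable_norm[OF intHx] integrable_mult_right[OF B] nH])
        then show "norm (LINT x|lborel. norm (case (\<tau>, x) of (\<tau>, x) \<Rightarrow> H \<tau> x))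
            \<le> norm (indicator {0..1} \<tau> * (R * (LINT x|lborel. B x)))" by (simp add: mult.assoc)
      qed
    qed
  qed (use intHx in auto)
  have 1: "(LINT \<tau>|lborel. H \<tau> x) = cint R (\<lambda>\<mu>. G \<mu> x)" for x
  proof -
    have "continuous_on {0..1} (\<lambda>\<tau>. G (?c \<tau>) x * ?c \<tau>)"
    proof -
      have "continuous_on {0..1} ((\<lambda>p. G (?c (fst p)) (snd p) * ?c (fst p)) \<circ> (\<lambda>\<tau>. (\<tau>, x)))"
        by (intro continuous_on_compose cH continuous_on_Pair continuous_on_id continuous_on_const)
      then show ?thesis by (simp only: o_def fst_conv snd_conv)
    qed
    from set_borel_integral_eq_integral(2)[OF borel_integrable_atLeastAtMost'[OF this]]
    show ?thesis by (simp add: set_lebesgue_integral_def H_def cint_def)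
  qed
  have 2: "(LINT x|lborel. H \<tau> x) = indicator {0..1} \<tau> *\<^sub>R ((LINT x|lborel. G (?c \<tau>) x) * ?c \<tau>)" for \<tau>
    by (simp add: H_def)
  have "integrable lborel (\<lambda>\<tau>. LINT x|lborel. H \<tau> x)"
    using lborel_pair.integrable_fst'[OF int] by simp
  then have "set_integrable lborel {0..1} (\<lambda>\<tau>. (LINT x|lborel. G (?c \<tau>) x) * ?c \<tau>)"
    unfolding 2 by (simp add: set_integrable_def)
  from set_borel_integral_eq_integral(2)[OF this]
  have 3: "(LINT \<tau>|lborel. LINT x|lborel. H \<tau> x) = cint R (\<lambda>\<mu>. LINT x|lborel. G \<mu> x)"
    unfolding 2 by (simp add: set_lebesgue_integral_def cint_def)
  have "integrable lborel (\<lambda>x. LINT \<tau>|lborel. H \<tau> x)"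
    using lborel_pair.integrable_snd[OF int] by simp
  moreover have "(LINT x|lborel. LINT \<tau>|lborel. H \<tau> x) = (LINT \<tau>|lborel. LINT x|lborel. H \<tau> x)"
    by (rule lborel_pair.Fubini_integral[OF int])
  ultimately show ?thesis by (simp add: has_bochner_integral_iff 1 3)
qed

lemma has_bochner_integral_divdiff:
  fixes G :: "complex \<Rightarrow> real \<Rightarrow> complex"
  assumes \<nu>: "\<And>j. j \<le> k \<Longrightarrow> \<bar>\<nu> j\<bar> < R" and G: "continuous_on (sphere 0 R \<times> UNIV) (\<lambda>(\<mu>, x). G \<mu> x)"
    and bound: "\<And>\<mu> x. norm \<mu> = R \<Longrightarrow> norm (G \<mu> x) \<le> B x" and B: "integrable lborel B"
  shows "has_bochner_integral lborel (\<lambda>x. divdiff R \<nu> k (\<lambda>\<mu>. G \<mu> x)) (divdiff R \<nu> k (\<lambda>\<mu>. LINT x|lborel. G \<mu> x))"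
proof -
  have R: "R \<ge> 0" using \<nu>[of k] by auto
  let ?N = "\<lambda>\<mu>. poly (newton \<nu> (Suc k)) \<mu>"
  have nz: "?N \<mu> \<noteq> 0" if "norm \<mu> = R" for \<mu>
    by (rule poly_newton_nz[where R = R]) (use \<nu> that in auto)
  have "compact ((\<lambda>\<mu>. norm (1 / ?N \<mu>)) ` sphere 0 R)"
    by (intro compact_continuous_image continuous_intros) (use nz in auto)
  from compact_imp_bounded[OF this] obtain C
    where C': "\<forall>y\<in>(\<lambda>\<mu>. norm (1 / ?N \<mu>)) ` sphere 0 R. norm y \<le> C"
    unfolding bounded_iff by blast
  have C: "norm (1 / ?N \<mu>) \<le> C" if "norm \<mu> = R" for \<mu>
    using bspec[OF C' imageI[of \<mu>]] that by simp
  have B0: "B x \<ge> 0" for x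
    by (rule order_trans[OF norm_ge_zero bound[of "of_real R" x]]) (use R in simp)
  have "has_bochner_integral lborel (\<lambda>x. cint R (\<lambda>\<mu>. G \<mu> x * (1 / ?N \<mu>)))
      (cint R (\<lambda>\<mu>. LINT x|lborel. G \<mu> x * (1 / ?N \<mu>)))"
  proof (rule has_bochner_integral_cint[OF R])
    show "continuous_on (sphere 0 R \<times> UNIV) (\<lambda>(\<mu>, x). G \<mu> x * (1 / ?N \<mu>))"
      using G unfolding case_prod_unfold
      by (intro continuous_on_mult continuous_intros) (use nz in auto)
    show "norm (G \<mu> x * (1 / ?N \<mu>)) \<le> B x * C" if "norm \<mu> = R" for \<mu> x
      unfolding norm_mult by (intro mult_mono bound C that B0) auto
    show "integrable lborel (\<lambda>x. B x * C)" using B by simp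
  qed
  then show ?thesis by (simp add: divdiff_def)
qed

section \<open>Nonvanishing of confluent exponential determinants\<close>

text \<open>
  Zeros are counted with multiplicity: an entry of the increasing sequence \<open>a\<close> stands for one more
  vanishing derivative than the equal entries before it.  Dividing by one exponential and
  applying Rolle's theorem lowers \<open>n\<close>.
\<close>

lemma exp_sum_eq_0_imp:
  fixes a b c :: "nat \<Rightarrow> real"
  assumes "inj_on b {..<n}" "mono_on {..<n} a"
    and "\<And>j i. j < n \<Longrightarrow> i \<le> card {l. l < j \<and> a l = a j} \<Longrightarrow>
      (\<Sum>k<n. c k * b k ^ i * exp (b k * a j)) = 0"
    and "k < n"
  shows "c k = 0"
  using assms
proof (induction n arbitrary: a b c k)
  case (Suc n)
  define d where "d = (\<lambda>k. b k - b n)"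
  \<comment> \<open>The \<open>i\<close>-th derivative of the exponential sum divided by
    \<open>exp (b n * u)\<close>. The term \<open>k = n\<close> becomes constant, and
    \<open>d n = 0\<close> removes it from all derivatives of positive order.\<close>
  define h where "h = (\<lambda>i u. \<Sum>k<Suc n. c k * d k ^ i * exp (d k * u))"
  have h0: "h i (a j) = 0" if "j < Suc n" "i \<le> card {l. l < j \<and> a l = a j}" for i j
  proof -
    have "h i (a j) = (\<Sum>k<Suc n. \<Sum>l\<le>i. (of_nat (i choose l) * (- b n) ^ (i - l) * exp (- b n * a j)) * (c k * b k ^ l * exp (b k * a j)))"
      unfolding h_def
    proof (intro sum.cong refl)
      fix k
      have "d k ^ i = (\<Sum>l\<le>i. of_nat (i choose l) * b k ^ l * (- b n) ^ (i - l))"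
        unfolding d_def diff_conv_add_uminus by (rule binomial_ring)
      moreover have "exp (d k * a j) = exp (b k * a j) * exp (- b n * a j)"
        unfolding exp_add[symmetric] by (simp add: d_def algebra_simps)
      ultimately show "c k * d k ^ i * exp (d k * a j) =
        (\<Sum>l\<le>i. (of_nat (i choose l) * (- b n) ^ (i - l) * exp (- b n * a j)) * (c k * b k ^ l * exp (b k * a j)))"
        by (simp only: sum_distrib_left sum_distrib_right mult_ac)
    qed
    also have "\<dots> = (\<Sum>l\<le>i. (of_nat (i choose l) * (- b n) ^ (i - l) * exp (- b n * a j)) * (\<Sum>k<Suc n. c k * b k ^ l * exp (b k * a j)))"
      by (subst sum.swap) (simp only: sum_distrib_left)
    also have "\<dots> = 0"
      using Suc.prems(3)[OF that(1)] that(2) by (intro sum.neutral) auto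
    finally show ?thesis .
  qed
  have hd: "(h i has_real_derivative h (Suc i) u) (at u)" for i u
    unfolding h_def by (auto intro!: derivative_eq_intros sum.cong)
  have mono: "a j \<le> a (Suc j)" if "j < n" for j
    using monotone_onD[OF Suc.prems(2), of j "Suc j"] that by auto
  have ex: "\<exists>z. a j < z \<and> z < a (Suc j) \<and> h 1 z = 0" if j: "j < n" "a j \<noteq> a (Suc j)" for j
  proof -
    have lt: "a j < a (Suc j)" using mono[OF j(1)] j(2) by simp
    have "h 0 (a j) = h 0 (a (Suc j))" using h0[of j 0] h0[of "Suc j" 0] j by simp
    then obtain z where "a j < z" "z < a (Suc j)" "(*) (h 1 z) = (\<lambda>v. 0)"
      using Rolle_deriv[OF lt, of "h 0" "\<lambda>z. (*) (h 1 z)"] hd[of 0]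
        DERIV_continuous_on[of "{a j..a (Suc j)}" "h 0" "h 1"]
      by (auto simp: has_field_derivative_def intro: has_derivative_at_withinI)
    then show ?thesis by (metis mult_1_right)
  qed
  \<comment> \<open>One zero of \<open>h 1\<close> for each adjacent pair: a repeated entry is kept,
    and two different neighbours yield a Rolle point strictly between them.\<close>
  define a' where "a' = (\<lambda>j. if a j = a (Suc j) then a j else SOME z. a j < z \<and> z < a (Suc j) \<and> h 1 z = 0)"
  have a'1: "a' j = a j" if "a j = a (Suc j)" for j using that by (simp add: a'_def)
  have a'2: "a j < a' j" "a' j < a (Suc j)" "h 1 (a' j) = 0" if "j < n" "a j \<noteq> a (Suc j)" for j
    using someI_ex[OF ex[OF that]] that by (simp_all add: a'_def)
  have le1: "a j \<le> a' j" "a' j \<le> a (Suc j)" if "j < n" for j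
    using a'1[of j] a'2[of j] that mono[OF that] by fastforce+
  have amono: "a i \<le> a j" if "i \<le> j" "j < Suc n" for i j
    using monotone_onD[OF Suc.prems(2), of i j] that by auto
  have mono': "mono_on {..<n} a'"
  proof (rule mono_onI)
    fix i j assume ij: "i \<in> {..<n}" "j \<in> {..<n}" "i \<le> j"
    show "a' i \<le> a' j"
    proof (cases "i = j")
      case False
      then have "a' i \<le> a (Suc i)" "a (Suc i) \<le> a j" "a j \<le> a' j"
        using ij le1 amono by auto
      then show ?thesis by simp
    qed simp
  qed
  \<comment> \<open>A kept entry at \<open>j\<close> is matched with entry \<open>Suc j\<close> of
    \<open>a\<close>, whose multiplicity count is one higher; this pays for the lost derivative. A
    Rolle point lies strictly above all earlier entries, so only \<open>i = 0\<close> is required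
    there.\<close>
  have z': "(\<Sum>k<n. (c k * d k) * d k ^ i * exp (d k * a' j)) = 0"
    if j: "j < n" and i: "i \<le> card {l. l < j \<and> a' l = a' j}" for i j
  proof -
    have "h (Suc i) (a' j) = 0"
    proof (cases "a j = a (Suc j)")
      case True
      have sub: "{l. l < j \<and> a' l = a' j} \<subseteq> {l. l < j \<and> a l = a j}"
      proof safe
        fix l assume l: "l < j" "a' l = a' j"
        show "a l = a j"
        proof (rule ccontr)
          assume ne: "a l \<noteq> a j"
          have "a (Suc l) \<le> a j" using l j by (intro amono) auto
          moreover have "a' l < a (Suc l) \<or> a l = a (Suc l)" using a'2[of l] l j by fastforce
          ultimately show False using l(2) a'1[OF True] a'1[of l] ne by fastforce
        qed
      qed
      have "{l. l < Suc j \<and> a l = a (Suc j)} = insert j {l. l < j \<and> a l = a j}"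
        using True by auto
      then have "card {l. l < Suc j \<and> a l = a (Suc j)} = Suc (card {l. l < j \<and> a l = a j})"
        by simp
      moreover have "card {l. l < j \<and> a' l = a' j} \<le> card {l. l < j \<and> a l = a j}"
        by (rule card_mono[OF _ sub]) simp
      ultimately have "h (Suc i) (a (Suc j)) = 0" using i j by (intro h0) auto
      then show ?thesis using True a'1 by simp
    next
      case False
      have e: "{l. l < j \<and> a' l = a' j} = {}"
      proof safe
        fix l assume l: "l < j" "a' l = a' j"
        have "a' l \<le> a (Suc l)" "a (Suc l) \<le> a j" using l(1) j le1(2)[of l] amono[of "Suc l" j] by simp_all
        then show "l \<in> {}" using a'2(1)[OF j False] l by simp
      qed
      have "i = 0" using i unfolding e by simp
      then show ?thesis using a'2(3)[OF j False] by simp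
    qed
    moreover have "d n = 0" by (simp add: d_def)
    ultimately show ?thesis by (simp add: h_def mult_ac)
  qed
  have inj': "inj_on d {..<n}" using Suc.prems(1) by (auto simp: inj_on_def d_def)
  have c0: "c k = 0" if "k < n" for k
  proof -
    have "c k * d k = 0" by (rule Suc.IH[OF inj' mono' z' that])
    moreover have "d k \<noteq> 0" using Suc.prems(1) that by (force simp: d_def inj_on_def)
    ultimately show ?thesis by simp
  qed
  have "(\<Sum>k<Suc n. c k * b k ^ 0 * exp (b k * a 0)) = 0" using Suc.prems(3)[of 0 0] by simp
  then have "c n = 0" using c0 by simp
  then show ?case using c0 Suc.prems(4) by (auto simp: less_Suc_eq)
qed simp

text \<open>Differentiating \<open>(z - a) ^ Suc m * K z\<close> leaves the factor
  \<open>(z - a) ^ m\<close>, so the \<open>i\<close>-th derivative is still divisible by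
  \<open>(z - a) ^ (n - i)\<close>.\<close>

lemma derivatives_vanish:
  fixes f :: "nat \<Rightarrow> complex \<Rightarrow> complex"
  assumes S: "open S" "a \<in> S" and H: "H holomorphic_on S"
    and eq: "\<And>z. z \<in> S \<Longrightarrow> f 0 z = (z - a) ^ n * H z"
    and f: "\<And>i z. (f i has_field_derivative f (Suc i) z) (at z)"
    and i: "i < n"
  shows "f i a = 0"
proof -
  have "\<exists>K. K holomorphic_on S \<and> (\<forall>z\<in>S. f i z = (z - a) ^ (n - i) * K z)" if "i \<le> n" for i
    using that
  proof (induction i)
    case 0
    then show ?case using H eq by auto
  next
    case (Suc i)
    then obtain K where K: "K holomorphic_on S" "\<And>z. z \<in> S \<Longrightarrow> f i z = (z - a) ^ (n - i) * K z"
      by auto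
    obtain m where m: "n - i = Suc m" "n - Suc i = m" using Suc.prems by (cases "n - i") auto
    define K' where "K' = (\<lambda>z. of_nat (Suc m) * K z + (z - a) * deriv K z)"
    have "f (Suc i) z = (z - a) ^ m * K' z" if z: "z \<in> S" for z
    proof -
      have Kd: "(K has_field_derivative deriv K z) (at z)"
        using K(1) S(1) z holomorphic_derivI by blast
      have "((\<lambda>z. (z - a) ^ Suc m * K z) has_field_derivative (z - a) ^ m * K' z) (at z)"
        by (rule derivative_eq_intros Kd refl | simp add: K'_def algebra_simps)+
      then have "(f i has_field_derivative (z - a) ^ m * K' z) (at z)"
        by (rule has_field_derivative_transform_within_open[OF _ S(1) z]) (use K(2) m in auto)
      then show ?thesis using f DERIV_unique by blast
    qed
    moreover have "K' holomorphic_on S"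
      unfolding K'_def using K(1) S(1) by (intro holomorphic_intros) auto
    ultimately show ?case using m by auto
  qed
  from this[of i] obtain K where "f i a = (a - a) ^ (n - i) * K a" using S i by auto
  then show ?thesis using i by simp
qed

text \<open>If all divided differences of \<open>f\<close> vanish, this cofactor exhibits
  \<open>f\<close> as a multiple of the Newton polynomial near the nodes.\<close>

lemma holomorphic_newton_remainder:
  assumes f: "f holomorphic_on UNIV" and \<nu>: "\<And>j. j < n \<Longrightarrow> \<bar>\<nu> j\<bar> < R" and R: "R > 0"
  shows "(\<lambda>z. cint R (\<lambda>\<mu>. f \<mu> / (poly (newton \<nu> n) \<mu> * (\<mu> - z)))) holomorphic_on ball 0 R"
proof -
  let ?c = "circlepath 0 R"
  let ?w = "\<lambda>\<tau>. f (?c \<tau>) * ?c \<tau> / poly (newton \<nu> n) (?c \<tau>)"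
  have nz: "poly (newton \<nu> n) (?c \<tau>) \<noteq> 0" for \<tau>
    by (rule poly_newton_nz[where R = R]) (use \<nu> norm_circlepath_0[of R] R in auto)
  have nz2: "?c \<tau> - z \<noteq> 0" if "z \<in> ball 0 R" for z \<tau>
    using that norm_circlepath_0[of R \<tau>] R by auto
  have cw: "continuous_on A ?w" for A
    by (intro continuous_intros continuous_on_circlepath continuous_on_compose2[OF holomorphic_on_imp_continuous_on[OF f]])
       (use nz in auto)
  have "(\<lambda>z. integral (cbox 0 1) (\<lambda>\<tau>. 1 / (?c \<tau> - z) * ?w \<tau>)) holomorphic_on ball 0 R"
  proof (rule leibniz_rule_holomorphic)
    show "((\<lambda>z. 1 / (?c \<tau> - z) * ?w \<tau>) has_field_derivative 1 / (?c \<tau> - z)\<^sup>2 * ?w \<tau>) (at z within ball 0 R)"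
      if "z \<in> ball 0 R" for z \<tau>
      using nz2[OF that, of \<tau>]
      by (intro DERIV_cmult_right) (auto intro!: derivative_eq_intros simp: power2_eq_square)
    show "(\<lambda>\<tau>. 1 / (?c \<tau> - z) * ?w \<tau>) integrable_on cbox 0 1" if "z \<in> ball 0 R" for z
      by (intro integrable_continuous continuous_on_mult cw continuous_intros continuous_on_circlepath)
         (use nz2[OF that] in auto)
    show "continuous_on (ball 0 R \<times> cbox 0 1) (\<lambda>(z, \<tau>). 1 / (?c \<tau> - z)\<^sup>2 * ?w \<tau>)"
      unfolding case_prod_unfold
      by (intro continuous_on_mult continuous_on_compose2[OF cw[of UNIV]] continuous_intros
          continuous_on_compose2[OF continuous_on_circlepath[of UNIV]]) (use nz2 in auto)
  qed auto
  then show ?thesis by (simp add: cint_def algebra_simps)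
qed

text \<open>A vector in the kernel of the matrix defines an exponential sum \<open>F 0\<close> with
  vanishing divided differences. It is then divisible by the Newton polynomial and vanishes at the
  drifts with their multiplicities; \<open>exp_sum_eq_0_imp\<close>, applied to real and imaginary
  parts, forces the vector to be 0.\<close>

lemma det_divdiff_exp_nz:
  assumes \<nu>: "\<nu> \<in> weyl_closed N" and y: "y \<in> weyl N" and R: "\<And>j. j < N \<Longrightarrow> \<bar>\<nu> j\<bar> < R"
  shows "det_fun N (\<lambda>k j. divdiff R \<nu> k (\<lambda>\<mu>. exp (of_real (y j) * \<mu>))) \<noteq> 0"
proof
  let ?A = "Matrix.mat N N (\<lambda>(k, j). divdiff R \<nu> k (\<lambda>\<mu>. exp (of_real (y j) * \<mu>)))"
  assume "det_fun N (\<lambda>k j. divdiff R \<nu> k (\<lambda>\<mu>. exp (of_real (y j) * \<mu>))) = 0"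
  then have "Determinant.det ?A = 0" by (simp add: det_fun_def)
  then obtain v where v: "v \<in> carrier_vec N" "v \<noteq> 0\<^sub>v N" "?A *\<^sub>v v = 0\<^sub>v N"
    using det_0_iff_vec_prod_zero[of ?A N] by auto
  have N: "N > 0" using v by (cases N) auto
  have R0: "R > 0" using R[OF N] by auto
  define F where "F = (\<lambda>i z. \<Sum>j<N. (v $ j) * of_real (y j) ^ i * exp (of_real (y j) * z))"
  have Fd: "(F i has_field_derivative F (Suc i) z) (at z)" for i z
    unfolding F_def by (auto intro!: derivative_eq_intros sum.cong)
  have Fhol: "F 0 holomorphic_on UNIV"
    unfolding F_def by (intro holomorphic_intros)
  have dd: "divdiff R \<nu> k (F 0) = 0" if k: "k < N" for k
  proof -
    have nz: "poly (newton \<nu> (Suc k)) \<mu> \<noteq> 0" if "norm \<mu> = R" for \<mu>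
      by (rule poly_newton_nz[where R = R]) (use R k that in auto)
    have "divdiff R \<nu> k (F 0) = cint R (\<lambda>\<mu>. \<Sum>j<N. (v $ j) * (exp (of_real (y j) * \<mu>) / poly (newton \<nu> (Suc k)) \<mu>))"
      unfolding divdiff_def F_def by (simp add: sum_divide_distrib)
    also have "\<dots> = (\<Sum>j<N. cint R (\<lambda>\<mu>. (v $ j) * (exp (of_real (y j) * \<mu>) / poly (newton \<nu> (Suc k)) \<mu>)))"
      by (intro cint_sum continuous_intros) (use R0 nz in auto)
    also have "\<dots> = (\<Sum>j<N. divdiff R \<nu> k (\<lambda>\<mu>. exp (of_real (y j) * \<mu>)) * (v $ j))"
      by (simp only: cint_mult_left divdiff_def mult.commute)
    also have "\<dots> = (?A *\<^sub>v v) $ k"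
      using k v(1) by (auto simp: scalar_prod_def atLeast0LessThan)
    finally show ?thesis using v(3) k by simp
  qed
  define h where "h = (\<lambda>z. cint R (\<lambda>\<mu>. F 0 \<mu> / (poly (newton \<nu> N) \<mu> * (\<mu> - z))))"
  have hhol: "h holomorphic_on ball 0 R"
    unfolding h_def by (rule holomorphic_newton_remainder[OF Fhol R R0])
  have Fh: "F 0 z = poly (newton \<nu> N) z * h z" if "z \<in> ball 0 R" for z
    using newton_interpolation[OF Fhol, of z R N \<nu>] R that dd by (simp add: h_def)
  have zero: "F i (of_real (\<nu> j)) = 0" if j: "j < N" and i: "i \<le> card {l. l < j \<and> \<nu> l = \<nu> j}" for i j
  proof -
    \<comment> \<open>Including \<open>j\<close> itself makes the order of the zero one more than
      the number of earlier equal drifts, so that derivatives up to and including that number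
      vanish.\<close>
    let ?M = "insert j {l. l < j \<and> \<nu> l = \<nu> j}"
    let ?n = "Suc (card {l. l < j \<and> \<nu> l = \<nu> j})"
    define K where "K = (\<lambda>z. (\<Prod>l\<in>{..<N} - ?M. z - complex_of_real (\<nu> l)) * h z)"
    have "F 0 z = (z - of_real (\<nu> j)) ^ ?n * K z" if "z \<in> ball 0 R" for z
    proof -
      have "poly (newton \<nu> N) z = (\<Prod>l\<in>?M. z - complex_of_real (\<nu> l)) * (\<Prod>l\<in>{..<N} - ?M. z - complex_of_real (\<nu> l))"
        unfolding poly_newton by (subst mult.commute, rule prod.subset_diff) (use j in auto)
      also have "(\<Prod>l\<in>?M. z - complex_of_real (\<nu> l)) = (\<Prod>l\<in>?M. z - complex_of_real (\<nu> j))"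
        by (intro prod.cong) auto
      also have "\<dots> = (z - of_real (\<nu> j)) ^ ?n" by simp
      finally show ?thesis using Fh[OF that] by (simp add: K_def)
    qed
    then show ?thesis
    proof (rule derivatives_vanish[where S = "ball 0 R" and H = K and n = ?n, rotated 3])
      show "K holomorphic_on ball 0 R" unfolding K_def by (intro holomorphic_intros hhol)
    qed (use Fd i j R in auto)
  qed
  have "v $ k = 0" if k: "k < N" for k
  proof -
    have inj: "inj_on y {..<N}"
      using y by (auto simp: weyl_def intro: strict_mono_on_imp_inj_on)
    have mono: "mono_on {..<N} \<nu>" using \<nu> by (simp add: weyl_closed_def)
    have e: "complex_of_real (y j) ^ i * exp (of_real (y j) * of_real (\<nu> l)) = of_real (y j ^ i * exp (y j * \<nu> l))" for i j l
      by (simp add: exp_of_real[symmetric])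
    have parts: "(\<Sum>k<N. Re (v $ k) * y k ^ i * exp (y k * \<nu> j)) = 0"
      "(\<Sum>k<N. Im (v $ k) * y k ^ i * exp (y k * \<nu> j)) = 0"
      if "j < N" "i \<le> card {l. l < j \<and> \<nu> l = \<nu> j}" for i j
    proof -
      have "(\<Sum>k<N. (v $ k) * of_real (y k ^ i * exp (y k * \<nu> j))) = 0"
        using zero[OF that] by (simp only: F_def mult.assoc e)
      then have "Re (\<Sum>k<N. (v $ k) * of_real (y k ^ i * exp (y k * \<nu> j))) = 0"
        "Im (\<Sum>k<N. (v $ k) * of_real (y k ^ i * exp (y k * \<nu> j))) = 0" by simp_all
      then show "(\<Sum>k<N. Re (v $ k) * y k ^ i * exp (y k * \<nu> j)) = 0"
        "(\<Sum>k<N. Im (v $ k) * y k ^ i * exp (y k * \<nu> j)) = 0"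
        by (simp_all add: Re_sum Im_sum mult.assoc)
    qed
    have "Re (v $ k) = 0" by (rule exp_sum_eq_0_imp[OF inj mono parts(1) k])
    moreover have "Im (v $ k) = 0" by (rule exp_sum_eq_0_imp[OF inj mono parts(2) k])
    ultimately show ?thesis by (simp add: complex_eq_iff)
  qed
  then have "v = 0\<^sub>v N" using v(1) by (intro eq_vecI) auto
  then show False using v(2) by simp
qed

section \<open>The transition density on the closed chamber\<close>

definition vand :: "nat \<Rightarrow> (nat \<Rightarrow> real) \<Rightarrow> real" where
  "vand N \<nu> = (\<Prod>i<N. \<Prod>j<i. \<nu> i - \<nu> j)"

lemma of_real_vand: "complex_of_real (vand N \<nu>) = (\<Prod>i<N. poly (newton \<nu> i) (of_real (\<nu> i)))"
  by (simp add: vand_def poly_newton)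

lemma vand_pos:
  assumes "\<nu> \<in> weyl N"
  shows "vand N \<nu> > 0"
proof -
  have "\<nu> j < \<nu> i" if "j < i" "i < N" for i j
    using assms that by (auto simp: weyl_def strict_mono_on_def)
  then show ?thesis unfolding vand_def by (intro prod_pos) auto
qed

definition exp_det :: "nat \<Rightarrow> (nat \<Rightarrow> real) \<Rightarrow> (nat \<Rightarrow> real) \<Rightarrow> real" where
  "exp_det N a b = det_fun N (\<lambda>j k. exp (a j * b k))"

text \<open>The confluent forms of \<open>exp_det N \<nu> y\<close> divided by one and by both Vandermonde products.\<close>

definition conf_det :: "real \<Rightarrow> nat \<Rightarrow> (nat \<Rightarrow> real) \<Rightarrow> (nat \<Rightarrow> real) \<Rightarrow> complex" where
  "conf_det R N \<nu> y = det_fun N (\<lambda>k j. divdiff R \<nu> k (\<lambda>\<mu>. exp (of_real (y j) * \<mu>)))"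

definition biconf_det :: "real \<Rightarrow> nat \<Rightarrow> (nat \<Rightarrow> real) \<Rightarrow> (nat \<Rightarrow> real) \<Rightarrow> complex" where
  "biconf_det R N \<nu> x = det_fun N (\<lambda>k l. divdiff R \<nu> k (\<lambda>z. divdiff R x l (\<lambda>w. exp (z * w))))"

lemma exp_det_commute: "exp_det N a b = exp_det N b a"
  unfolding exp_det_def by (subst det_fun_transpose) (simp add: mult.commute)

lemma of_real_det_fun: "complex_of_real (det_fun n f) = det_fun n (\<lambda>j k. complex_of_real (f j k))"
  by (simp add: det_fun_eq_ldet ldet_of_real)

lemma exp_det_eq_conf_det:
  assumes "\<And>j. j < N \<Longrightarrow> \<bar>\<nu> j\<bar> < R"
  shows "complex_of_real (exp_det N \<nu> y) = of_real (vand N \<nu>) * conf_det R N \<nu> y"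
proof -
  have "complex_of_real (exp_det N \<nu> y) = det_fun N (\<lambda>i j. exp (of_real (y j) * of_real (\<nu> i)))"
    by (simp add: exp_det_def of_real_det_fun exp_of_real[symmetric] mult.commute)
  also have "\<dots> = (\<Prod>i<N. poly (newton \<nu> i) (of_real (\<nu> i))) * conf_det R N \<nu> y"
    unfolding conf_det_def
    by (rule det_fun_newton[where f = "\<lambda>j \<mu>. exp (of_real (y j) * \<mu>)"])
       (auto intro!: holomorphic_intros assms)
  finally show ?thesis by (simp add: of_real_vand)
qed

lemma exp_det_eq_biconf_det:
  assumes \<nu>: "\<And>j. j < N \<Longrightarrow> \<bar>\<nu> j\<bar> < R" and x: "\<And>j. j < N \<Longrightarrow> \<bar>x j\<bar> < R"
  shows "complex_of_real (exp_det N \<nu> x) = of_real (vand N \<nu>) * of_real (vand N x) * biconf_det R N \<nu> x"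
proof -
  have "complex_of_real (exp_det N \<nu> x) = of_real (vand N x) * conf_det R N x \<nu>"
    by (subst exp_det_commute) (rule exp_det_eq_conf_det[OF x])
  also have "conf_det R N x \<nu> = det_fun N (\<lambda>i l. divdiff R x l (\<lambda>w. exp (of_real (\<nu> i) * w)))"
    unfolding conf_det_def by (subst det_fun_transpose) simp
  also have "\<dots> = of_real (vand N \<nu>) * biconf_det R N \<nu> x"
    unfolding biconf_det_def of_real_vand
    by (rule det_fun_newton[where f = "\<lambda>l z. divdiff R x l (\<lambda>w. exp (z * w))"])
       (auto intro!: holomorphic_divdiff_exp \<nu> x)
  finally show ?thesis by (simp add: mult_ac)
qed

lemma higher_deriv_exp_mult: "(deriv ^^ k) (\<lambda>w. exp (z * w)) = (\<lambda>w::complex. z ^ k * exp (z * w))"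
proof (induction k)
  case (Suc k)
  have "deriv (\<lambda>w. z ^ k * exp (z * w)) w = z ^ Suc k * exp (z * w)" for w
    by (rule DERIV_imp_deriv) (auto intro!: derivative_eq_intros)
  then show ?case using Suc by auto
qed simp

text \<open>At \<open>k + 1\<close> equal nodes the divided difference is a Taylor
  coefficient.\<close>

lemma divdiff_zero_nodes:
  assumes "R > 0"
  shows "divdiff R (\<lambda>_. 0) k (\<lambda>w. exp (z * w)) = z ^ k / fact k"
proof -
  have "((\<lambda>u. exp (z * u) / (u - 0) ^ Suc k) has_contour_integral
      (2 * pi * \<i>) / fact k * (deriv ^^ k) (\<lambda>w. exp (z * w)) 0) (circlepath 0 R)"
    by (rule Cauchy_has_contour_integral_higher_derivative_circlepath)
       (use assms in \<open>auto intro!: continuous_intros holomorphic_intros\<close>)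
  moreover have "(deriv ^^ k) (\<lambda>w. exp (z * w)) 0 = z ^ k"
    by (subst higher_deriv_exp_mult) simp
  ultimately have "((\<lambda>u. exp (z * u) / u ^ Suc k) has_contour_integral (2 * pi * \<i>) / fact k * z ^ k) (circlepath 0 R)"
    by simp
  from contour_integral_unique[OF this] show ?thesis
    by (simp add: contour_integral_circlepath_eq_cint divdiff_def poly_newton field_simps)
qed

text \<open>For \<open>x = 0\<close> the inner divided differences are the monomials
  \<open>z ^ l / fact l\<close>, on which those of order \<open>k > l\<close> vanish; the matrix is
  triangular.\<close>

lemma biconf_det_0:
  assumes R: "\<And>j. j < N \<Longrightarrow> \<bar>\<nu> j\<bar> < R" "R > 0"
  shows "biconf_det R N \<nu> (\<lambda>_. 0) = (\<Prod>k<N. 1 / fact k)"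
proof -
  have e: "divdiff R \<nu> k (\<lambda>z. z ^ l / fact l) = (if l = k then 1 / fact k else 0)" if "k < N" "l \<le> k" for k l
  proof -
    have "divdiff R \<nu> k (poly (monom (1 / fact l) l)) = coeff (monom (1 / fact l) l) k"
      using that by (intro divdiff_poly) (auto intro!: R order_trans[OF degree_monom_le])
    moreover have "poly (monom (1 / fact l) l) = (\<lambda>z::complex. z ^ l / fact l)"
      by (auto simp: poly_monom)
    ultimately show ?thesis by auto
  qed
  have "biconf_det R N \<nu> (\<lambda>_. 0) = det_fun N (\<lambda>l k. divdiff R \<nu> k (\<lambda>z. z ^ l / fact l))"
    unfolding biconf_det_def divdiff_zero_nodes[OF R(2)] by (rule det_fun_transpose)
  also have "\<dots> = (\<Prod>k<N. divdiff R \<nu> k (\<lambda>z. z ^ k / fact k))"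
    by (rule det_fun_lower_triangular) (use e in auto)
  also have "\<dots> = (\<Prod>k<N. 1 / fact k)" by (intro prod.cong) (use e in auto)
  finally show ?thesis .
qed

lemma conf_det_0:
  assumes "R > 0"
  shows "conf_det R N (\<lambda>_. 0) y = (\<Prod>k<N. 1 / fact k) * of_real (det_fun N (\<lambda>k j. y j ^ k))"
proof -
  have "conf_det R N (\<lambda>_. 0) y = ldet {..<N} (\<lambda>k j. 1 / fact k * of_real (y j ^ k) * 1)"
    unfolding conf_det_def divdiff_zero_nodes[OF assms] det_fun_eq_ldet by simp
  also have "\<dots> = (\<Prod>k<N. 1 / fact k) * of_real (det_fun N (\<lambda>k j. y j ^ k))"
    unfolding of_real_det_fun det_fun_eq_ldet by (subst ldet_scale) (auto simp: ldet_of_real)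
  finally show ?thesis .
qed

lemma continuous_on_det_fun:
  fixes f :: "'b::topological_space \<Rightarrow> nat \<Rightarrow> nat \<Rightarrow> complex"
  assumes "\<And>j k. j < n \<Longrightarrow> k < n \<Longrightarrow> continuous_on U (\<lambda>x. f x j k)"
  shows "continuous_on U (\<lambda>x. det_fun n (f x))"
  unfolding det_fun_eq_ldet ldet_def
proof (intro continuous_on_sum continuous_on_mult continuous_on_const continuous_on_prod)
  fix p i assume p: "p \<in> {p. p permutes {..<n}}" and i: "i \<in> {..<n}"
  then have "p i \<in> {..<n}" by (simp only: mem_Collect_eq permutes_in_image)
  then show "continuous_on U (\<lambda>x. f x i (p i))" using i assms by simp
qed

lemma continuous_on_conf_det:
  fixes \<nu> y :: "'b::topological_space \<Rightarrow> nat \<Rightarrow> real"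
  assumes R: "R \<ge> 0" and \<nu>: "\<And>j. j < N \<Longrightarrow> continuous_on U (\<lambda>p. \<nu> p j)" "\<And>p j. p \<in> U \<Longrightarrow> j < N \<Longrightarrow> \<bar>\<nu> p j\<bar> < R"
    and y: "\<And>j. j < N \<Longrightarrow> continuous_on U (\<lambda>p. y p j)"
  shows "continuous_on U (\<lambda>p. conf_det R N (\<nu> p) (y p))"
  unfolding conf_det_def
proof (intro continuous_on_det_fun continuous_on_divdiff[OF R])
  fix k j assume kj: "k < N" "j < N"
  show "continuous_on (U \<times> sphere 0 R) (\<lambda>(p, \<mu> :: complex). exp (of_real (y p j) * \<mu>))"
    unfolding case_prod_unfold
    by (intro continuous_intros continuous_on_compose2[OF y[OF kj(2)] continuous_on_fst[OF continuous_on_id]]) auto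
qed (use \<nu> in auto)

lemma continuous_on_biconf_det:
  fixes \<nu> x :: "'b::topological_space \<Rightarrow> nat \<Rightarrow> real"
  assumes R: "R \<ge> 0" and \<nu>: "\<And>j. j < N \<Longrightarrow> continuous_on U (\<lambda>p. \<nu> p j)" "\<And>p j. p \<in> U \<Longrightarrow> j < N \<Longrightarrow> \<bar>\<nu> p j\<bar> < R"
    and x: "\<And>j. j < N \<Longrightarrow> continuous_on U (\<lambda>p. x p j)" "\<And>p j. p \<in> U \<Longrightarrow> j < N \<Longrightarrow> \<bar>x p j\<bar> < R"
  shows "continuous_on U (\<lambda>p. biconf_det R N (\<nu> p) (x p))"
  unfolding biconf_det_def
proof (intro continuous_on_det_fun continuous_on_divdiff[OF R])
  fix k l assume kl: "k < N" "l < N"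
  have "continuous_on (U \<times> sphere 0 R) (\<lambda>q. divdiff R (x (fst q)) l (\<lambda>w. exp (snd q * w)))"
  proof (rule continuous_on_divdiff[OF R])
    show "continuous_on (U \<times> sphere 0 R) (\<lambda>q. x (fst q) j)" if "j \<le> l" for j
      using that kl by (intro continuous_on_compose2[OF x(1) continuous_on_fst[OF continuous_on_id]]) auto
  qed (use kl x(2) in \<open>auto simp: case_prod_unfold intro!: continuous_intros\<close>)
  then show "continuous_on (U \<times> sphere 0 R) (\<lambda>(p, z). divdiff R (x p) l (\<lambda>w. exp (z * w)))"
    by (simp add: case_prod_unfold)
qed (use \<nu> in auto)

lemma exists_bound:
  fixes \<nu> x :: "nat \<Rightarrow> real"
  obtains R where "R > 0" "\<And>j. j < N \<Longrightarrow> \<bar>\<nu> j\<bar> < R" "\<And>j. j < N \<Longrightarrow> \<bar>x j\<bar> < R"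
proof
  let ?R = "1 + (\<Sum>j<N. \<bar>\<nu> j\<bar>) + (\<Sum>j<N. \<bar>x j\<bar>)"
  have nn: "(\<Sum>j<N. \<bar>\<nu> j\<bar>) \<ge> 0" "(\<Sum>j<N. \<bar>x j\<bar>) \<ge> 0" by (auto intro: sum_nonneg)
  then show "?R > 0" by linarith
  fix j assume "j < N"
  then have "\<bar>\<nu> j\<bar> \<le> (\<Sum>j<N. \<bar>\<nu> j\<bar>)" "\<bar>x j\<bar> \<le> (\<Sum>j<N. \<bar>x j\<bar>)"
    by (auto intro!: member_le_sum)
  then show "\<bar>\<nu> j\<bar> < ?R" "\<bar>x j\<bar> < ?R" using nn by linarith+
qed

lemma weyl_imp_weyl_closed: "\<nu> \<in> weyl N \<Longrightarrow> \<nu> \<in> weyl_closed N"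
  by (auto simp: weyl_def weyl_closed_def intro: strict_mono_on_imp_mono_on)

lemma conf_det_nz:
  assumes "\<nu> \<in> weyl_closed N" "y \<in> weyl N" "\<And>j. j < N \<Longrightarrow> \<bar>\<nu> j\<bar> < R"
  shows "conf_det R N \<nu> y \<noteq> 0"
  unfolding conf_det_def by (rule det_divdiff_exp_nz[OF assms])

text \<open>
  Along \<open>s \<mapsto> exp_det N a (s b)\<close>, divided by the Vandermonde products, the determinant does not
  vanish, and at \<open>s = 0\<close> it is positive.
\<close>

lemma exp_det_pos:
  assumes a: "a \<in> weyl N" and b: "b \<in> weyl N"
  shows "exp_det N a b > 0"
proof -
  obtain R where R: "R > 0" "\<And>j. j < N \<Longrightarrow> \<bar>a j\<bar> < R" "\<And>j. j < N \<Longrightarrow> \<bar>b j\<bar> < R"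
    using exists_bound by metis
  \<comment> \<open>At \<open>s = 0\<close> the exponential determinant degenerates together with
    the Vandermonde product of \<open>s * b\<close>. The quotient \<open>h\<close> stays meaningful
    there and fixes the sign.\<close>
  define h where "h = (\<lambda>s. biconf_det R N a (\<lambda>j. s * b j))"
  have sb: "\<bar>s * b j\<bar> < R" if "s \<in> {0..1}" "j < N" for s j
  proof -
    have "\<bar>s * b j\<bar> \<le> 1 * \<bar>b j\<bar>" unfolding abs_mult using that by (intro mult_right_mono) auto
    then show ?thesis using R(3)[OF that(2)] by simp
  qed
  have cont: "continuous_on {0..1} (\<lambda>s. Re (h s))"
    unfolding h_def by (intro continuous_on_Re continuous_on_biconf_det continuous_intros) (use R sb in auto)
  have h0: "Re (h 0) > 0"
  proof -
    have "h 0 = of_real (\<Prod>k<N. 1 / fact k)"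
      using biconf_det_0[of N a R] R by (simp add: h_def)
    then show ?thesis by (simp del: of_real_prod add: prod_pos)
  qed
  have hs: "of_real (exp_det N a (\<lambda>j. s * b j)) = of_real (vand N a * vand N (\<lambda>j. s * b j)) * h s"
    if "s \<in> {0..1}" for s
    unfolding h_def of_real_mult by (rule exp_det_eq_biconf_det) (use R sb that in auto)
  have hr: "exp_det N a (\<lambda>j. s * b j) = vand N a * vand N (\<lambda>j. s * b j) * Re (h s)" if "s \<in> {0..1}" for s
    using arg_cong[OF hs[OF that], of Re] by (simp del: of_real_mult)
  have nz: "Re (h s) \<noteq> 0" if s: "s \<in> {0<..1}" for s
  proof
    assume "Re (h s) = 0"
    then have "exp_det N a (\<lambda>j. s * b j) = 0" using hr s by simp
    moreover have "(\<lambda>j. s * b j) \<in> weyl N"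
      using b s by (auto simp: weyl_def strict_mono_on_def)
    then have "conf_det R N a (\<lambda>j. s * b j) \<noteq> 0"
      by (intro conf_det_nz weyl_imp_weyl_closed a R)
    ultimately show False
      using exp_det_eq_conf_det[of N a R "\<lambda>j. s * b j"] R vand_pos[OF a] by simp
  qed
  have "Re (h 1) > 0"
  proof (rule ccontr)
    assume "\<not> Re (h 1) > 0"
    then obtain s where s: "0 \<le> s" "s \<le> 1" "Re (h s) = 0"
      using IVT2'[of "\<lambda>s. Re (h s)" 1 0 0] h0 cont by force
    then have "s \<in> {0<..1}" using h0 by (cases "s = 0") auto
    then show False using nz s by blast
  qed
  then show ?thesis using hr[of 1] vand_pos[OF a] vand_pos[OF b] by simp
qed

lemma gauss_factor:
  assumes "t > 0"
  shows "gauss t y x = gauss t y (0::real) * exp (x * (y / t)) * exp (- (x\<^sup>2 / (2 * t)))"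
proof -
  have "- ((y - x)\<^sup>2 / (2 * t)) = - (y\<^sup>2 / (2 * t)) + x * (y / t) + - (x\<^sup>2 / (2 * t))"
    using assms by (simp add: field_simps power2_eq_square)
  then have "exp (- ((y - x)\<^sup>2 / (2 * t))) = exp (- (y\<^sup>2 / (2 * t))) * exp (x * (y / t)) * exp (- (x\<^sup>2 / (2 * t)))"
    by (simp only: exp_add)
  then show ?thesis by (simp add: gauss_def)
qed

text \<open>Expanding the square leaves only the cross term coupled. The determinant thus vanishes
  like the Vandermonde product of \<open>x\<close>, which is what cancels the zero of the
  denominator of the transition density at the origin.\<close>

lemma karlin_mcgregor_eq:
  assumes "t > 0"
  shows "karlin_mcgregor N t y x =
    (\<Prod>j<N. gauss t (y j) 0) * (\<Prod>k<N. exp (- ((x k)\<^sup>2 / (2 * t)))) * exp_det N x (\<lambda>j. y j / t)"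
proof -
  have "karlin_mcgregor N t y x =
      ldet {..<N} (\<lambda>j k. gauss t (y j) 0 * exp (x k * (y j / t)) * exp (- ((x k)\<^sup>2 / (2 * t))))"
    unfolding karlin_mcgregor_def det_fun_eq_ldet by (simp only: gauss_factor[OF assms, symmetric])
  also have "\<dots> = (\<Prod>j<N. gauss t (y j) 0) * (\<Prod>k<N. exp (- ((x k)\<^sup>2 / (2 * t)))) *
      det_fun N (\<lambda>j k. exp (x k * (y j / t)))"
    unfolding det_fun_eq_ldet by (rule ldet_scale) simp
  also have "det_fun N (\<lambda>j k. exp (x k * (y j / t))) = exp_det N x (\<lambda>j. y j / t)"
    unfolding exp_det_def by (rule det_fun_transpose)
  finally show ?thesis .
qed

lemma transition_interior_nonneg:
  assumes "t > 0" "\<nu> \<in> weyl N" "x \<in> weyl N" "y \<in> weyl N"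
  shows "transition_interior N \<nu> t y x \<ge> 0"
proof -
  have "(\<lambda>j. y j / t) \<in> weyl N"
    using assms by (auto simp: weyl_def strict_mono_on_def divide_strict_right_mono)
  then have "karlin_mcgregor N t y x \<ge> 0"
    unfolding karlin_mcgregor_eq[OF assms(1)]
    by (intro mult_nonneg_nonneg prod_nonneg less_imp_le[OF exp_det_pos] assms)
       (auto intro: less_imp_le[OF gauss_pos] assms)
  then show ?thesis
    unfolding transition_interior_def exp_det_def[symmetric]
    by (intro mult_nonneg_nonneg divide_nonneg_nonneg less_imp_le[OF exp_det_pos] assms) auto
qed

section \<open>The limit from the open chamber\<close>

lemma filterlim_neq_bot: "filterlim f F G \<Longrightarrow> G \<noteq> bot \<Longrightarrow> F \<noteq> bot"
  by (auto simp: filterlim_def filtermap_bot_iff bot_unique)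

lemma weyl_at_within_neq_bot:
  assumes "\<nu> \<in> weyl_closed N" "x \<in> weyl_closed N"
  shows "at (\<nu>, x) within weyl N \<times> weyl N \<noteq> bot"
proof -
  \<comment> \<open>The multiples of \<open>Suc j\<close> separate equal coordinates. As coordinate
    0 moves too, it already witnesses \<open>f s \<noteq> (\<nu>, x)\<close>.\<close>
  define f where "f = (\<lambda>s::real. (\<lambda>j. \<nu> j + s * of_nat (Suc j), \<lambda>j. x j + s * of_nat (Suc j)))"
  have "continuous_on UNIV f"
    unfolding f_def by (intro continuous_intros)
  then have "isCont f 0" by (simp add: continuous_on_eq_continuous_at)
  moreover have f0: "f 0 = (\<nu>, x)" by (simp add: f_def)
  ultimately have lim: "(f \<longlongrightarrow> (\<nu>, x)) (at_right 0)"
    by (simp add: isCont_def filterlim_at_split)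
  have mem: "f s \<in> weyl N \<times> weyl N" "f s \<noteq> (\<nu>, x)" if s: "s > 0" for s
  proof -
    have "strict_mono_on {..<N} (\<lambda>j. z j + s * of_nat (Suc j))" if "mono_on {..<N} z" for z
    proof (rule strict_mono_onI)
      fix i j assume "i \<in> {..<N}" "j \<in> {..<N}" "i < j"
      then have "z i \<le> z j" using monotone_onD[OF that, of i j] by simp
      moreover have "s * of_nat (Suc i) < s * of_nat (Suc j)" using s \<open>i < j\<close> by simp
      ultimately show "z i + s * of_nat (Suc i) < z j + s * of_nat (Suc j)" by linarith
    qed
    then show "f s \<in> weyl N \<times> weyl N" using assms by (auto simp: f_def weyl_def weyl_closed_def)
    have "fst (f s) 0 \<noteq> \<nu> 0" using s by (simp add: f_def)
    then show "f s \<noteq> (\<nu>, x)" by auto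
  qed
  have "filterlim f (at (\<nu>, x) within weyl N \<times> weyl N) (at_right 0)"
    unfolding filterlim_at using lim mem by (auto intro!: eventually_at_right_less[THEN eventually_mono])
  then show ?thesis
    by (rule filterlim_neq_bot) (simp add: trivial_limit_at_right_real)
qed

text \<open>\<open>T\<close> is a continuous extension of the density of the open chamber, so it is
  the limit that defines \<open>transition\<close>; nonnegativity survives the limit.
  \<open>T\<close> may be complex valued, since a limit of real values has imaginary part 0.\<close>

lemma transition_eqI:
  assumes t: "t > 0" and y: "y \<in> weyl N" and closed: "\<nu> \<in> weyl_closed N" "x \<in> weyl_closed N"
    and U: "open U" "(\<nu>, x) \<in> U" and cont: "continuous_on U (\<lambda>(\<nu>, x). T \<nu> x)"
    and eq: "\<And>\<nu> x. (\<nu>, x) \<in> U \<Longrightarrow> \<nu> \<in> weyl N \<Longrightarrow> x \<in> weyl N \<Longrightarrow>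
      complex_of_real (transition_interior N \<nu> t y x) = T \<nu> x"
  shows "complex_of_real (transition N \<nu> t y x) = T \<nu> x" and "transition N \<nu> t y x \<ge> 0"
proof -
  have "complex_of_real (transition N \<nu> t y x) = T \<nu> x \<and> transition N \<nu> t y x \<ge> 0"
  proof (cases "\<nu> \<in> weyl N \<and> x \<in> weyl N")
    case True
    then show ?thesis
      using eq[OF U(2)] transition_interior_nonneg[OF t _ _ y, of \<nu> x] by (simp add: transition_def)
  next
    case False
    let ?F = "at (\<nu>, x) within weyl N \<times> weyl N"
    let ?g = "\<lambda>(\<nu>, x). transition_interior N \<nu> t y x"
    have nb: "?F \<noteq> bot" by (rule weyl_at_within_neq_bot[OF closed])
    have "isCont (\<lambda>(\<nu>, x). T \<nu> x) (\<nu>, x)"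
      using cont U continuous_on_eq_continuous_at by blast
    then have "((\<lambda>(\<nu>, x). T \<nu> x) \<longlongrightarrow> T \<nu> x) (at (\<nu>, x))"
      by (simp add: isCont_def)
    then have "((\<lambda>(\<nu>, x). T \<nu> x) \<longlongrightarrow> T \<nu> x) ?F" by (rule tendsto_within_subset) simp
    moreover have "\<forall>\<^sub>F p in ?F. (\<lambda>(\<nu>, x). T \<nu> x) p = complex_of_real (?g p)"
      using U eq unfolding eventually_at_topological by (auto intro!: exI[of _ U])
    ultimately have lim: "((\<lambda>p. complex_of_real (?g p)) \<longlongrightarrow> T \<nu> x) ?F"
      using tendsto_cong by fastforce
    have re: "(?g \<longlongrightarrow> Re (T \<nu> x)) ?F" using tendsto_Re[OF lim] by (simp add: case_prod_unfold)
    have "((\<lambda>p. 0) \<longlongrightarrow> Im (T \<nu> x)) ?F" using tendsto_Im[OF lim] by simp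
    then have im: "Im (T \<nu> x) = 0" using tendsto_unique[OF nb tendsto_const] by metis
    have L: "transition N \<nu> t y x = Re (T \<nu> x)"
      using False tendsto_Lim[OF nb re] unfolding transition_def by (simp only: if_False)
    have "\<forall>\<^sub>F p in ?F. ?g p \<ge> 0"
      unfolding eventually_at_topological
      using transition_interior_nonneg[OF t _ _ y] by (auto intro!: exI[of _ UNIV])
    then have "Re (T \<nu> x) \<ge> 0" using tendsto_lowerbound[OF re _ nb] by blast
    then show ?thesis using L im by (simp add: complex_eq_iff)
  qed
  then show "complex_of_real (transition N \<nu> t y x) = T \<nu> x" "transition N \<nu> t y x \<ge> 0" by auto
qed

definition polydisc :: "real \<Rightarrow> real \<Rightarrow> nat \<Rightarrow> ((nat \<Rightarrow> real) \<times> (nat \<Rightarrow> real)) set" where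
  "polydisc R R' N = {p. \<forall>j<N. \<bar>fst p j\<bar> < R \<and> \<bar>snd p j\<bar> < R'}"

lemma continuous_on_fst_coordinate: "continuous_on U (\<lambda>p. fst p j :: real)"
  and continuous_on_snd_coordinate: "continuous_on U (\<lambda>p. snd p j :: real)"
  by (rule continuous_on_product_then_coordinatewise, intro continuous_intros)+

lemma open_polydisc: "open (polydisc R R' N)"
proof -
  have "polydisc R R' N = (\<Inter>j\<in>{..<N}. {p. \<bar>fst p j\<bar> < R} \<inter> {p. \<bar>snd p j\<bar> < R'})"
    by (auto simp: polydisc_def)
  also have "open \<dots>"
    by (intro open_INT open_Int open_Collect_less ballI continuous_intros
        continuous_on_fst_coordinate continuous_on_snd_coordinate) auto
  finally show ?thesis .
qed

definition drift_factor :: "nat \<Rightarrow> real \<Rightarrow> (nat \<Rightarrow> real) \<Rightarrow> real" where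
  "drift_factor N t \<nu> = exp (- t * (\<Sum>j<N. (\<nu> j)\<^sup>2) / 2)"

text \<open>With \<open>x\<close> in the open chamber only the drifts can collide. The Vandermonde
  product of \<open>\<nu>\<close> cancels in the quotient of the two exponential determinants, and
  \<open>conf_det_nz\<close> keeps the denominator away from 0 near
  \<open>(\<nu>, x)\<close>.\<close>

lemma transition_weyl:
  assumes t: "t > 0" and \<nu>: "\<nu> \<in> weyl_closed N" and x: "x \<in> weyl N" and y: "y \<in> weyl N"
    and R: "\<And>j. j < N \<Longrightarrow> \<bar>\<nu> j\<bar> < R" "R > 0"
  shows "complex_of_real (transition N \<nu> t y x) =
      of_real (drift_factor N t \<nu>) * (conf_det R N \<nu> y / conf_det R N \<nu> x) * of_real (karlin_mcgregor N t y x)" (is ?th1)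
    and "transition N \<nu> t y x \<ge> 0" (is ?th2)
proof -
  obtain R' where R': "\<And>j. j < N \<Longrightarrow> \<bar>x j\<bar> < R'" using exists_bound[of N x x] by metis
  define T where "T = (\<lambda>\<nu> x. complex_of_real (drift_factor N t \<nu>) *
    (conf_det R N \<nu> y / conf_det R N \<nu> x) * of_real (karlin_mcgregor N t y x))"
  let ?f = "\<lambda>p. conf_det R N (fst p) (snd p)"
  define U where "U = polydisc R R' N \<inter> ?f -` (- {0})"
  note coord = continuous_on_fst_coordinate continuous_on_snd_coordinate
  have b: "\<bar>fst p j\<bar> < R" if "p \<in> polydisc R R' N" "j < N" for p j
    using that by (auto simp: polydisc_def)
  have cf: "continuous_on (polydisc R R' N) ?f"
    by (intro continuous_on_conf_det coord) (use R b in auto)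
  have oU: "open U"
    unfolding U_def by (rule continuous_open_preimage[OF cf open_polydisc]) auto
  have mU: "(\<nu>, x) \<in> U"
    unfolding U_def using R R' conf_det_nz[OF \<nu> x R(1)] by (auto simp: polydisc_def)
  have cont: "continuous_on U (\<lambda>(\<nu>, x). T \<nu> x)"
    unfolding T_def case_prod_unfold drift_factor_def karlin_mcgregor_def of_real_det_fun of_real_gauss
    by (intro continuous_on_mult continuous_on_divide continuous_on_subset[OF cf] continuous_on_conf_det
          continuous_on_det_fun continuous_on_gauss continuous_on_of_real continuous_intros coord)
       (use R b t in \<open>auto simp: U_def\<close>)
  have eq: "complex_of_real (transition_interior N \<nu> t y x) = T \<nu> x"
    if p: "(\<nu>, x) \<in> U" "\<nu> \<in> weyl N" for \<nu> x
  proof -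
    have "vand N \<nu> \<noteq> 0" using vand_pos[OF p(2)] by simp
    moreover have "\<bar>\<nu> j\<bar> < R" if "j < N" for j using p that by (auto simp: U_def polydisc_def)
    ultimately show ?thesis
      unfolding transition_interior_def exp_det_def[symmetric]
      by (simp add: T_def exp_det_eq_conf_det[of N \<nu> R] drift_factor_def)
  qed
  note main = transition_eqI[OF t y \<nu> weyl_imp_weyl_closed[OF x] oU mU cont eq]
  show ?th1 using main(1) unfolding T_def .
  show ?th2 using main(2) .
qed

text \<open>The denominator loses the Vandermonde products of \<open>\<nu>\<close> and of
  \<open>x\<close>: one cancels against the numerator, the other against the Karlin-McGregor
  determinant. At the origin the remaining denominator is the product of inverse factorials, which
  \<open>conf_det_0\<close> contains as well.\<close>

lemma transition_0:
  assumes t: "t > 0" and \<nu>: "\<nu> \<in> weyl_closed N" and y: "y \<in> weyl N"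
    and R: "\<And>j. j < N \<Longrightarrow> \<bar>\<nu> j\<bar> < R" "R > 0"
  shows "complex_of_real (transition N \<nu> t y (\<lambda>_. 0)) =
      of_real (drift_factor N t \<nu>) * conf_det R N \<nu> y *
      (of_real (\<Prod>j<N. gauss t (y j) 0) * of_real (det_fun N (\<lambda>k j. (y j / t) ^ k)))" (is ?th1)
    and "transition N \<nu> t y (\<lambda>_. 0) \<ge> 0" (is ?th2)
proof -
  define T where "T = (\<lambda>\<nu> x. complex_of_real (drift_factor N t \<nu>) * conf_det R N \<nu> y *
    (of_real (\<Prod>j<N. gauss t (y j) 0) * of_real (\<Prod>k<N. exp (- ((x k)\<^sup>2 / (2 * t))))
      * (conf_det R N x (\<lambda>j. y j / t) / biconf_det R N \<nu> x)))"
  let ?f = "\<lambda>p. biconf_det R N (fst p) (snd p)"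
  define U where "U = polydisc R R N \<inter> ?f -` (- {0})"
  note coord = continuous_on_fst_coordinate continuous_on_snd_coordinate
  have b: "\<bar>fst p j\<bar> < R" "\<bar>snd p j\<bar> < R" if "p \<in> polydisc R R N" "j < N" for p j
    using that by (auto simp: polydisc_def)
  have bi0: "biconf_det R N \<nu> (\<lambda>_. 0) = (\<Prod>k<N. 1 / fact k)"
    by (rule biconf_det_0[OF R])
  have fnz: "(\<Prod>k<N. 1 / fact k) \<noteq> (0 :: complex)" by simp
  have cf: "continuous_on (polydisc R R N) ?f"
    by (intro continuous_on_biconf_det coord) (use R b in auto)
  have oU: "open U"
    unfolding U_def by (rule continuous_open_preimage[OF cf open_polydisc]) auto
  have mU: "(\<nu>, \<lambda>_. 0) \<in> U"
    unfolding U_def using R bi0 by (auto simp: polydisc_def)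
  have cont: "continuous_on U (\<lambda>(\<nu>, x). T \<nu> x)"
    unfolding T_def case_prod_unfold drift_factor_def
    by (intro continuous_on_mult continuous_on_divide continuous_on_subset[OF cf] continuous_on_conf_det
          continuous_on_of_real continuous_intros coord)
       (use R b t in \<open>auto simp: U_def\<close>)
  have eq: "complex_of_real (transition_interior N \<nu> t y x) = T \<nu> x"
    if p: "(\<nu>, x) \<in> U" "\<nu> \<in> weyl N" "x \<in> weyl N" for \<nu> x
  proof -
    have nz: "vand N \<nu> \<noteq> 0" "vand N x \<noteq> 0" using vand_pos[OF p(2)] vand_pos[OF p(3)] by auto
    have bd: "\<bar>\<nu> j\<bar> < R" "\<bar>x j\<bar> < R" if "j < N" for j using p that by (auto simp: U_def polydisc_def)
    have bnz: "biconf_det R N \<nu> x \<noteq> 0" using p by (auto simp: U_def)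
    have "complex_of_real (transition_interior N \<nu> t y x) =
      of_real (drift_factor N t \<nu>) * (of_real (exp_det N \<nu> y) / of_real (exp_det N \<nu> x)) *
      (of_real (\<Prod>j<N. gauss t (y j) 0) * of_real (\<Prod>k<N. exp (- ((x k)\<^sup>2 / (2 * t)))) * of_real (exp_det N x (\<lambda>j. y j / t)))"
      unfolding transition_interior_def exp_det_def[symmetric] karlin_mcgregor_eq[OF t] drift_factor_def
      by (simp only: of_real_mult of_real_divide)
    also have "\<dots> = T \<nu> x"
    proof -
      have e: "complex_of_real (exp_det N \<nu> y) = of_real (vand N \<nu>) * conf_det R N \<nu> y"
        "complex_of_real (exp_det N x (\<lambda>j. y j / t)) = of_real (vand N x) * conf_det R N x (\<lambda>j. y j / t)"
        "complex_of_real (exp_det N \<nu> x) = of_real (vand N \<nu>) * of_real (vand N x) * biconf_det R N \<nu> x"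
        by (intro exp_det_eq_conf_det exp_det_eq_biconf_det bd; assumption)+
      have cancel: "d * (v * g / (v * w * b)) * (p * q * (w * h)) = d * g * (p * q * (h / b))"
        if "v \<noteq> 0" "w \<noteq> 0" "b \<noteq> 0" for d v g w b p q h :: complex
        using that by (simp add: field_simps)
      show ?thesis unfolding e T_def by (rule cancel) (use nz bnz in auto)
    qed
    finally show ?thesis .
  qed
  have wc: "(\<lambda>_. 0) \<in> weyl_closed N" by (auto simp: weyl_closed_def mono_on_def)
  note main = transition_eqI[OF t y \<nu> wc oU mU cont eq]
  show ?th2 using main(2) .
  have "T \<nu> (\<lambda>_. 0) = complex_of_real (drift_factor N t \<nu>) * conf_det R N \<nu> y *
    (of_real (\<Prod>j<N. gauss t (y j) 0) * (conf_det R N (\<lambda>_. 0) (\<lambda>j. y j / t) / biconf_det R N \<nu> (\<lambda>_. 0)))"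
    by (simp add: T_def)
  also have "conf_det R N (\<lambda>_. 0) (\<lambda>j. y j / t) / biconf_det R N \<nu> (\<lambda>_. 0) = of_real (det_fun N (\<lambda>k j. (y j / t) ^ k))"
    unfolding bi0 conf_det_0[OF R(2)] by (rule nonzero_mult_div_cancel_left[OF fnz])
  finally show ?th1 using main(1) by simp
qed

section \<open>The three forms of the kernel\<close>

text \<open>
  The time inversion \<open>s \<mapsto> 1 / s\<close>, \<open>x \<mapsto> x / s\<close> turns the drift into the starting point; in these
  coordinates the kernel is built from the heat flow alone.
\<close>

definition flow_Q :: "real \<Rightarrow> (nat \<Rightarrow> real) \<Rightarrow> real \<Rightarrow> nat \<Rightarrow> real \<Rightarrow> complex" where
  "flow_Q R \<nu> s k x = divdiff R \<nu> k (\<lambda>\<mu>. gauss (1 / s) (complex_of_real (x / s)) \<mu>) / complex_of_real (sqrt s)"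

definition flow_R :: "(nat \<Rightarrow> real) \<Rightarrow> real \<Rightarrow> nat \<Rightarrow> real \<Rightarrow> complex" where
  "flow_R \<nu> t k y = poly (heat (1 / t) (newton \<nu> k)) (complex_of_real (y / t)) / complex_of_real (sqrt t)"

text \<open>The inverted time runs backward: \<open>s < t\<close> makes the variance
  \<open>1 / s - 1 / t\<close> positive. The square roots split the Jacobian of
  \<open>z \<mapsto> z / t\<close> evenly between the two factors that meet at a time
  \<open>t\<close>.\<close>

definition flow_P :: "real \<Rightarrow> real \<Rightarrow> real \<Rightarrow> real \<Rightarrow> complex" where
  "flow_P s t x y = gauss (1 / s - 1 / t) (complex_of_real (x / s)) (complex_of_real (y / t))
     / complex_of_real (sqrt s * sqrt t)"

definition flow_kernel :: "real \<Rightarrow> nat \<Rightarrow> (nat \<Rightarrow> real) \<Rightarrow> real \<Rightarrow> real \<Rightarrow> real \<Rightarrow> real \<Rightarrow> complex" where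
  "flow_kernel R N \<nu> s x t y = (\<Sum>k<N. flow_Q R \<nu> s k x * flow_R \<nu> t k y) - (if s < t then flow_P s t x y else 0)"

lemma gauss_scale:
  fixes a b :: complex
  assumes "c > 0"
  shows "gauss (c\<^sup>2 * w) (of_real c * a) (of_real c * b) = gauss w a b / of_real c"
proof -
  have "sqrt (2 * pi * (c\<^sup>2 * w)) = c * sqrt (2 * pi * w)"
    using assms by (simp add: real_sqrt_mult)
  moreover have "(of_real c * a - of_real c * b)\<^sup>2 / of_real (2 * (c\<^sup>2 * w)) = (a - b)\<^sup>2 / of_real (2 * w)"
    using assms by (simp add: power2_eq_square flip: right_diff_distrib)
  ultimately show ?thesis using assms by (simp add: gauss_def)
qed

lemma gauss_invert:
  fixes a b :: complex
  assumes "t > 0"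
  shows "gauss t (of_real t * a) (of_real t * b) = gauss (1 / t) a b / of_real t"
  using gauss_scale[OF assms, of "1 / t" a b] assms by (simp add: power2_eq_square)

lemma gauss_invert_left:
  assumes "s > 0"
  shows "gauss s (complex_of_real x) (complex_of_real s * \<mu>) = gauss (1 / s) (complex_of_real (x / s)) \<mu> / of_real s"
  using gauss_invert[OF assms, of "complex_of_real (x / s)" \<mu>] assms by simp

lemma gauss_invert_right:
  assumes "t > 0"
  shows "gauss t (- \<i> * complex_of_real y) (complex_of_real (t * m)) =
    gauss (1 / t) (complex_of_real m) (- \<i> * complex_of_real (y / t)) / of_real t"
proof -
  have "- \<i> * complex_of_real y = complex_of_real t * (- \<i> * complex_of_real (y / t))"
    using assms by simp
  then show ?thesis
    using gauss_invert[OF assms, of "- \<i> * complex_of_real (y / t)" "complex_of_real m"]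
      gauss_commute[of "1 / t" "complex_of_real m"] by simp
qed

text \<open>Scaling space by \<open>sqrt s * sqrt t\<close> turns the variance
  \<open>1 / s - 1 / t\<close> into \<open>t - s\<close> and the inverted positions
  \<open>x / s\<close>, \<open>y / t\<close> into those of \<open>kernel_tail\<close>.\<close>

lemma kernel_tail_eq:
  assumes "s > 0" "t > 0"
  shows "kernel_tail s x t y = (if s < t then flow_P s t x y else 0)"
proof (cases "s < t")
  case True
  let ?c = "sqrt s * sqrt t"
  have c: "?c > 0" using assms by simp
  have e1: "?c\<^sup>2 * (1 / s - 1 / t) = t - s"
    using assms by (simp add: power_mult_distrib field_simps)
  have sq: "sqrt a / a = 1 / sqrt a" if "a > 0" for a
    using that by (simp add: field_simps)
  have e2: "?c * (y / t) = sqrt (s / t) * y"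
  proof -
    have "?c * (y / t) = sqrt s * (sqrt t / t) * y" by simp
    then show ?thesis unfolding sq[OF assms(2)] by (simp add: real_sqrt_divide)
  qed
  have e3: "?c * (x / s) = sqrt (t / s) * x"
  proof -
    have "?c * (x / s) = (sqrt s / s) * sqrt t * x" by simp
    then show ?thesis unfolding sq[OF assms(1)] by (simp add: real_sqrt_divide)
  qed
  have "kernel_tail s x t y = gauss (?c\<^sup>2 * (1 / s - 1 / t))
      (of_real ?c * complex_of_real (y / t)) (of_real ?c * complex_of_real (x / s))"
    unfolding kernel_tail_def of_real_gauss of_real_mult[symmetric] e1 e2 e3 using True by (simp only: if_True)
  also have "\<dots> = flow_P s t x y"
    unfolding gauss_scale[OF c] flow_P_def by (subst gauss_commute) simp
  finally show ?thesis using True by simp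
qed (simp add: kernel_tail_def)

lemma holomorphic_gauss: "u > 0 \<Longrightarrow> (\<lambda>\<mu>. gauss u a (c * \<mu>)) holomorphic_on A" for a c :: complex
  unfolding gauss_def by (intro holomorphic_intros) auto

lemma divdiff_divide: "divdiff R \<nu> k (\<lambda>\<mu>. f \<mu> / c) = divdiff R \<nu> k f / c"
  using cint_mult_left[of R "1 / c" "\<lambda>\<mu>. f \<mu> / poly (newton \<nu> (Suc k)) \<mu>"]
  by (simp add: divdiff_def mult.commute)

lemma divdiff_gauss:
  assumes "s > 0"
  shows "divdiff R \<nu> k (\<lambda>\<mu>. gauss s (complex_of_real x) (complex_of_real s * \<mu>)) =
    flow_Q R \<nu> s k x / complex_of_real (sqrt s)"
  unfolding gauss_invert_left[OF assms] divdiff_divide flow_Q_def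
  using assms by (simp flip: of_real_mult)

lemma integral_gauss_newton:
  assumes "t > 0"
  shows "integrable lborel (\<lambda>m. gauss t (- \<i> * complex_of_real y) (complex_of_real (t * m)) * poly f (\<i> * complex_of_real m))"
    and "(LINT m|lborel. gauss t (- \<i> * complex_of_real y) (complex_of_real (t * m)) * poly (newton \<nu> k) (\<i> * complex_of_real m))
      = flow_R \<nu> t k y / complex_of_real (sqrt t)"
proof -
  show "integrable lborel (\<lambda>m. gauss t (- \<i> * complex_of_real y) (complex_of_real (t * m)) * poly f (\<i> * complex_of_real m))"
    unfolding gauss_invert_right[OF assms]
    using integrable_gauss_poly_imaginary[of "1 / t"] assms by simp
  show "(LINT m|lborel. gauss t (- \<i> * complex_of_real y) (complex_of_real (t * m)) * poly (newton \<nu> k) (\<i> * complex_of_real m))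
      = flow_R \<nu> t k y / complex_of_real (sqrt t)"
    unfolding gauss_invert_right[OF assms] flow_R_def
    using integral_gauss_poly_imaginary[of "1 / t" "complex_of_real (y / t)" "newton \<nu> k"] assms
    by (simp flip: of_real_mult)
qed

text \<open>The product is \<open>poly (newton \<nu> N) z / poly (newton \<nu> N) \<mu>\<close>, so
  \<open>cauchy_factor\<close> is minus the remainder of \<open>newton_expansion\<close>. This
  isolates the pole at \<open>z\<close> from the terms whose poles lie in the support.\<close>

lemma cauchy_factor_eq:
  assumes "\<mu> \<noteq> z" "\<And>j. j < N \<Longrightarrow> \<mu> \<noteq> complex_of_real (\<nu> j)"
  shows "cauchy_factor N \<nu> \<mu> z = (\<Sum>k<N. poly (newton \<nu> k) z / poly (newton \<nu> (Suc k)) \<mu>) + 1 / (z - \<mu>)"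
proof -
  have "(\<Prod>j<N. 1 - (z - \<mu>) / (complex_of_real (\<nu> j) - \<mu>)) =
      (\<Prod>j<N. (z - complex_of_real (\<nu> j)) / (\<mu> - complex_of_real (\<nu> j)))"
  proof (rule prod.cong[OF refl])
    fix j assume "j \<in> {..<N}"
    then have "complex_of_real (\<nu> j) - \<mu> \<noteq> 0" "\<mu> - complex_of_real (\<nu> j) \<noteq> 0" using assms(2)[of j] by auto
    then show "1 - (z - \<mu>) / (complex_of_real (\<nu> j) - \<mu>) = (z - complex_of_real (\<nu> j)) / (\<mu> - complex_of_real (\<nu> j))"
      by (simp add: divide_simps) (simp add: algebra_simps)
  qed
  also have "\<dots> = poly (newton \<nu> N) z / poly (newton \<nu> N) \<mu>"
    by (simp add: poly_newton prod_dividef)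
  finally have P: "(\<Prod>j<N. 1 - (z - \<mu>) / (complex_of_real (\<nu> j) - \<mu>)) = poly (newton \<nu> N) z / poly (newton \<nu> N) \<mu>" .
  have M: "1 / (z - \<mu>) = - (1 / (\<mu> - z))"
    using assms(1) by (simp add: divide_simps)
  have "cauchy_factor N \<nu> \<mu> z = - (poly (newton \<nu> N) z / (poly (newton \<nu> N) \<mu> * (\<mu> - z)))"
    unfolding cauchy_factor_def P M by (simp add: mult.commute)
  then show ?thesis using newton_expansion[OF assms] M by simp
qed

lemma poly_newton_nz_path:
  assumes "\<mu> \<notin> supp_points N \<nu>" "k \<le> N"
  shows "poly (newton \<nu> k) \<mu> \<noteq> 0"
  using assms by (auto simp: poly_newton supp_points_def)

lemma contour_integral_newton_sum:
  assumes f: "f holomorphic_on UNIV" and \<nu>: "\<And>j. j < N \<Longrightarrow> \<bar>\<nu> j\<bar> < R"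
    and \<gamma>: "encircles_once \<gamma> (supp_points N \<nu>) P"
  shows "((\<lambda>\<mu>. f \<mu> * (\<Sum>k<N. c k / poly (newton \<nu> (Suc k)) \<mu>)) has_contour_integral
    2 * of_real pi * \<i> * (\<Sum>k<N. c k * divdiff R \<nu> k f)) \<gamma>"
proof -
  have hk: "((\<lambda>\<mu>. f \<mu> / poly (newton \<nu> (Suc k)) \<mu>) has_contour_integral 2 * of_real pi * \<i> * divdiff R \<nu> k f) \<gamma>"
    if "k < N" for k
  proof -
    have "(\<lambda>\<mu>. f \<mu> / poly (newton \<nu> (Suc k)) \<mu>) contour_integrable_on \<gamma>"
    proof (rule contour_integrable_holomorphic_simple)
      show "(\<lambda>\<mu>. f \<mu> / poly (newton \<nu> (Suc k)) \<mu>) holomorphic_on UNIV - supp_points N \<nu>"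
        by (intro holomorphic_intros holomorphic_on_subset[OF f])
           (use poly_newton_nz_path[of _ N \<nu> "Suc k"] that in auto)
      show "open (UNIV - supp_points N \<nu>)"
        by (intro open_Diff finite_imp_closed) (auto simp: supp_points_def)
    qed (use \<gamma> in \<open>auto simp: encircles_once_def\<close>)
    from has_contour_integral_integral[OF this] show ?thesis
      by (simp only: contour_integral_eq_divdiff[OF f \<nu> that \<gamma>])
  qed
  have "((\<lambda>\<mu>. \<Sum>k<N. c k * (f \<mu> / poly (newton \<nu> (Suc k)) \<mu>)) has_contour_integral
      (\<Sum>k<N. c k * (2 * of_real pi * \<i> * divdiff R \<nu> k f))) \<gamma>"
    by (intro has_contour_integral_sum has_contour_integral_lmul hk) auto
  moreover have "(\<lambda>\<mu>. \<Sum>k<N. c k * (f \<mu> / poly (newton \<nu> (Suc k)) \<mu>)) = (\<lambda>\<mu>. f \<mu> * (\<Sum>k<N. c k / poly (newton \<nu> (Suc k)) \<mu>))"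
    by (simp add: sum_distrib_left mult.commute)
  moreover have "(\<Sum>k<N. c k * (2 * of_real pi * \<i> * divdiff R \<nu> k f)) = 2 * of_real pi * \<i> * (\<Sum>k<N. c k * divdiff R \<nu> k f)"
    by (simp add: sum_distrib_left mult_ac)
  ultimately show ?thesis by simp
qed

text \<open>The winding number around \<open>z\<close> is 0, so the term with that pole drops out
  and the finite Newton sum remains.\<close>

lemma contour_integral_cauchy_factor:
  assumes f: "f holomorphic_on UNIV" and \<nu>: "\<And>j. j < N \<Longrightarrow> \<bar>\<nu> j\<bar> < R"
    and \<gamma>: "encircles_once \<gamma> (supp_points N \<nu>) {z}"
  shows "contour_integral \<gamma> (\<lambda>\<mu>. f \<mu> * cauchy_factor N \<nu> \<mu> z) =
    2 * of_real pi * \<i> * (\<Sum>k<N. poly (newton \<nu> k) z * divdiff R \<nu> k f)"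
proof -
  have "((\<lambda>\<mu>. f \<mu> / (\<mu> - z)) has_contour_integral of_real (2 * pi) * \<i> * winding_number \<gamma> z * f z) \<gamma>"
    by (rule Cauchy_integral_formula_convex_simple[OF convex_UNIV f])
       (use \<gamma> in \<open>auto simp: encircles_once_def\<close>)
  then have "((\<lambda>\<mu>. f \<mu> / (\<mu> - z)) has_contour_integral 0) \<gamma>"
    using \<gamma> by (simp add: encircles_once_def)
  from has_contour_integral_diff[OF contour_integral_newton_sum[OF f \<nu> \<gamma>, of "\<lambda>k. poly (newton \<nu> k) z"] this]
  have "((\<lambda>\<mu>. f \<mu> * (\<Sum>k<N. poly (newton \<nu> k) z / poly (newton \<nu> (Suc k)) \<mu>) - f \<mu> / (\<mu> - z)) has_contour_integral
    2 * of_real pi * \<i> * (\<Sum>k<N. poly (newton \<nu> k) z * divdiff R \<nu> k f)) \<gamma>" by simp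
  from contour_integral_unique[OF this] show ?thesis
  proof (rule trans[rotated], intro contour_integral_eq)
    fix \<mu> assume "\<mu> \<in> path_image \<gamma>"
    then have "\<mu> \<noteq> z" "\<mu> \<notin> supp_points N \<nu>" using \<gamma> by (auto simp: encircles_once_def)
    moreover have "\<mu> \<noteq> complex_of_real (\<nu> j)" if "j < N" for j
      using calculation(2) that by (auto simp: supp_points_def)
    moreover have "f \<mu> / (z - \<mu>) = - (f \<mu> / (\<mu> - z))"
      by (metis minus_diff_eq minus_divide_right)
    ultimately show "f \<mu> * cauchy_factor N \<nu> \<mu> z =
       f \<mu> * (\<Sum>k<N. poly (newton \<nu> k) z / poly (newton \<nu> (Suc k)) \<mu>) - f \<mu> / (\<mu> - z)"
      by (simp add: cauchy_factor_eq distrib_left)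
  qed
qed

lemma sqrt_mult_sum:
  assumes "s > 0" "t > 0"
  shows "complex_of_real (sqrt (s * t)) *
    (\<Sum>k<N. a k / complex_of_real (sqrt s) * (b k / complex_of_real (sqrt t))) = (\<Sum>k<N. a k * b k)"
  unfolding sum_distrib_left using assms by (intro sum.cong refl) (simp add: real_sqrt_mult)

lemma sqrt_mult_sum':
  assumes "s > 0" "t > 0"
  shows "complex_of_real (sqrt (s * t)) / (2 * complex_of_real pi * \<i>) * (2 * complex_of_real pi * \<i> *
    (\<Sum>k<N. a k / complex_of_real (sqrt s) * (b k / complex_of_real (sqrt t)))) = (\<Sum>k<N. a k * b k)"
proof -
  have c: "c / d * (d * X) = c * X" if "d \<noteq> 0" for c d X :: complex using that by simp
  have "2 * complex_of_real pi * \<i> \<noteq> 0" by simp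
  from c[OF this] show ?thesis by (simp only: sqrt_mult_sum[OF assms])
qed

lemma corr_kernel_swapped_eq:
  assumes \<nu>: "\<And>j. j < N \<Longrightarrow> \<bar>\<nu> j\<bar> < R" and \<Gamma>: "contour_family N \<nu> \<Gamma>" and st: "s > 0" "t > 0"
  shows "corr_kernel_swapped N \<nu> \<Gamma> s x t y = flow_kernel R N \<nu> s x t y"
proof -
  define f where "f = (\<lambda>\<mu>. gauss s (complex_of_real x) (complex_of_real s * \<mu>))"
  define g where "g = (\<lambda>m. gauss t (- \<i> * complex_of_real y) (complex_of_real (t * m)))"
  have f: "f holomorphic_on UNIV" unfolding f_def by (rule holomorphic_gauss[OF st(1)])
  have g: "integrable lborel (\<lambda>m. g m * poly p (\<i> * complex_of_real m))" for p
    unfolding g_def by (rule integral_gauss_newton(1)[OF st(2)])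
  let ?I = "\<lambda>m. g m * contour_integral (\<Gamma> m) (\<lambda>\<mu>. f \<mu> * cauchy_factor N \<nu> \<mu> (\<i> * complex_of_real m))"
  let ?J = "\<lambda>m. \<Sum>k<N. (2 * of_real pi * \<i> * divdiff R \<nu> k f) * (g m * poly (newton \<nu> k) (\<i> * complex_of_real m))"
  have eq: "?I m = ?J m" if "m \<noteq> 0" for m
  proof -
    have "encircles_once (\<Gamma> m) (supp_points N \<nu>) {\<i> * complex_of_real m}"
      using \<Gamma> that by (simp add: contour_family_def)
    from contour_integral_cauchy_factor[OF f \<nu> this] show ?thesis
      by (simp add: sum_distrib_left mult_ac)
  qed
  have intJ: "integrable lborel ?J"
    by (intro Bochner_Integration.integrable_sum integrable_mult_right g)
  \<comment> \<open>The contours may depend on \<open>m\<close> in any way. Measurability holds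
    because, off the single point 0, the integral does not depend on the choice of the
    contour.\<close>
  have meas: "?I \<in> borel_measurable lborel"
  proof -
    have "?I = (\<lambda>m. if m = 0 then ?I 0 else ?J m)" using eq by (intro ext) auto
    moreover have "(\<lambda>m. if m = 0 then ?I 0 else ?J m) \<in> borel_measurable lborel"
      using borel_measurable_integrable[OF intJ] by measurable
    ultimately show ?thesis by (simp only:)
  qed
  have "(LINT m|lborel. ?I m) = (LINT m|lborel. ?J m)"
  proof (rule integral_cong_AE[OF meas borel_measurable_integrable[OF intJ]])
    show "AE m in lborel. ?I m = ?J m"
      using AE_lborel_singleton[of 0] by eventually_elim (rule eq)
  qed
  also have "\<dots> = (\<Sum>k<N. (2 * of_real pi * \<i> * divdiff R \<nu> k f) * (LINT m|lborel. g m * poly (newton \<nu> k) (\<i> * complex_of_real m)))"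
    by (subst Bochner_Integration.integral_sum[OF integrable_mult_right[OF g]]) (simp only: integral_mult_right_zero)
  also have "\<dots> = 2 * of_real pi * \<i> * (\<Sum>k<N. flow_Q R \<nu> s k x / complex_of_real (sqrt s) * (flow_R \<nu> t k y / complex_of_real (sqrt t)))"
    unfolding f_def g_def integral_gauss_newton(2)[OF st(2)] divdiff_gauss[OF st(1)]
    by (simp only: sum_distrib_left mult.assoc)
  finally have 1: "(LINT m|lborel. ?I m) =
    2 * of_real pi * \<i> * (\<Sum>k<N. flow_Q R \<nu> s k x / complex_of_real (sqrt s) * (flow_R \<nu> t k y / complex_of_real (sqrt t)))" .
  show ?thesis
    unfolding corr_kernel_swapped_def 1[unfolded f_def g_def] kernel_tail_eq[OF st] flow_kernel_def sqrt_mult_sum'[OF st] ..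
qed

text \<open>The difference quotient is estimated directly: off the imaginary axis the Cauchy kernel
  is bounded by the inverse distance to the axis, uniformly in \<open>m\<close>.\<close>

lemma holomorphic_cauchy_transform:
  fixes h :: "real \<Rightarrow> complex"
  assumes h: "integrable lborel h" and A: "\<And>\<mu>. \<mu> \<in> A \<Longrightarrow> Re \<mu> \<noteq> 0"
  shows "(\<lambda>\<mu>. LINT m|lborel. h m * (1 / (\<i> * complex_of_real m - \<mu>))) holomorphic_on A"
proof (rule holomorphic_on_subset[of _ "{\<mu>. Re \<mu> \<noteq> 0}"])
  let ?k = "\<lambda>\<mu> m. 1 / (\<i> * complex_of_real m - \<mu>)"
  let ?F = "\<lambda>\<mu>. LINT m|lborel. h m * ?k \<mu> m"
  have bound: "norm (?k \<mu> m) \<le> 1 / d" if "d > 0" "d \<le> \<bar>Re \<mu>\<bar>" for \<mu> m d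
  proof -
    have "d \<le> norm (\<i> * complex_of_real m - \<mu>)"
      using that abs_Re_le_cmod[of "\<i> * complex_of_real m - \<mu>"] by simp
    then show ?thesis using that by (simp add: norm_divide divide_simps)
  qed
  have mk [measurable]: "?k \<mu> \<in> borel_measurable borel" for \<mu> by measurable
  have mh [measurable]: "h \<in> borel_measurable borel" using borel_measurable_integrable[OF h] by simp
  have int: "integrable lborel (\<lambda>m. h m * g m)"
    if "g \<in> borel_measurable borel" "\<And>m. norm (g m) \<le> C" for g C
  proof (rule Bochner_Integration.integrable_bound[of _ "\<lambda>m. norm (h m) * C"])
    show "integrable lborel (\<lambda>m. norm (h m) * C)" using h by simp
    show "(\<lambda>m. h m * g m) \<in> borel_measurable lborel" using that(1) by measurable
    show "AE m in lborel. norm (h m * g m) \<le> norm (norm (h m) * C)"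
      using that(2) order_trans[OF norm_ge_zero that(2)]
      by (auto simp: norm_mult intro!: mult_left_mono)
  qed
  show "?F holomorphic_on {\<mu>. Re \<mu> \<noteq> 0}"
    unfolding holomorphic_on_def
  proof
    fix \<mu> assume "\<mu> \<in> {\<mu>. Re \<mu> \<noteq> 0}"
    then have r: "\<bar>Re \<mu>\<bar> > 0" by simp
    \<comment> \<open>Half the distance to the axis: increments smaller than \<open>d\<close> keep
      the distance at least \<open>d\<close>.\<close>
    define d where "d = \<bar>Re \<mu>\<bar> / 2"
    have d: "d > 0" using r by (simp add: d_def)
    define D where "D = (LINT m|lborel. h m * (?k \<mu> m)\<^sup>2)"
    define C where "C = (LINT m|lborel. norm (h m)) * (1 / d) ^ 3"
    have k\<mu>: "norm (?k \<mu> m) \<le> 1 / d" for m by (rule bound) (use d in \<open>auto simp: d_def\<close>)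
    have est: "norm ((?F (\<mu> + e) - ?F \<mu>) / e - D) \<le> norm e * C" if e: "e \<noteq> 0" "norm e < d" for e
    proof -
      have ke: "norm (?k (\<mu> + e) m) \<le> 1 / d" for m
      proof (rule bound[OF d])
        have "\<bar>Re \<mu>\<bar> \<le> \<bar>Re \<mu> + Re e\<bar> + \<bar>Re e\<bar>"
          using abs_triangle_ineq[of "Re \<mu> + Re e" "- Re e"] by simp
        then show "d \<le> \<bar>Re (\<mu> + e)\<bar>" using e(2) abs_Re_le_cmod[of e] by (simp add: d_def)
      qed
      have i1: "integrable lborel (\<lambda>m. h m * ?k (\<mu> + e) m)" "integrable lborel (\<lambda>m. h m * ?k \<mu> m)"
        by (rule int[OF _ ke] int[OF _ k\<mu>], measurable)+
      have i2: "integrable lborel (\<lambda>m. h m * (?k \<mu> m)\<^sup>2)"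
        by (rule int[of _ "(1 / d)\<^sup>2"], measurable) (use k\<mu> in \<open>simp only: norm_power power_mono norm_ge_zero\<close>)
      have nz: "\<i> * complex_of_real m - \<mu> \<noteq> 0" "\<i> * complex_of_real m - (\<mu> + e) \<noteq> 0" for m
      proof -
        have "Re (\<i> * complex_of_real m - \<mu>) \<noteq> 0" "Re (\<i> * complex_of_real m - (\<mu> + e)) \<noteq> 0"
          using r e(2) abs_Re_le_cmod[of e] by (auto simp: d_def)
        then show "\<i> * complex_of_real m - \<mu> \<noteq> 0" "\<i> * complex_of_real m - (\<mu> + e) \<noteq> 0"
          by (metis zero_complex.sel(1))+
      qed
      \<comment> \<open>With \<open>a = \<i> m - \<mu>\<close>, this is \<open>(1 / (a - e) - 1 / a)
        / e - 1 / a\<^sup>2 = e / ((a - e) * a\<^sup>2)\<close>; the factor \<open>e\<close> makes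
        the error vanish.\<close>
      have pw: "(h m * ?k (\<mu> + e) m - h m * ?k \<mu> m) / e - h m * (?k \<mu> m)\<^sup>2 =
          e * (h m * (?k (\<mu> + e) m * (?k \<mu> m)\<^sup>2))" for m
      proof -
        define a where "a = \<i> * complex_of_real m - \<mu>"
        have a: "a \<noteq> 0" "a - e \<noteq> 0" "\<i> * complex_of_real m - (\<mu> + e) = a - e"
          using nz[of m] by (auto simp: a_def algebra_simps)
        show ?thesis unfolding a(3) a_def[symmetric] using a(1,2) e(1)
          by (simp add: field_simps power2_eq_square)
      qed
      have "(?F (\<mu> + e) - ?F \<mu>) / e - D =
          (LINT m|lborel. (h m * ?k (\<mu> + e) m - h m * ?k \<mu> m) / e - h m * (?k \<mu> m)\<^sup>2)"
        unfolding D_def using i1 i2 by simp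
      also have "\<dots> = e * (LINT m|lborel. h m * (?k (\<mu> + e) m * (?k \<mu> m)\<^sup>2))"
        by (simp only: pw integral_mult_right_zero)
      finally have "norm ((?F (\<mu> + e) - ?F \<mu>) / e - D) = norm e * norm (LINT m|lborel. h m * (?k (\<mu> + e) m * (?k \<mu> m)\<^sup>2))"
        by (simp add: norm_mult)
      also have "norm (LINT m|lborel. h m * (?k (\<mu> + e) m * (?k \<mu> m)\<^sup>2)) \<le> (LINT m|lborel. norm (h m) * (1 / d) ^ 3)"
      proof (rule order_trans[OF integral_norm_bound integral_mono])
        have kb: "norm (?k (\<mu> + e) m * (?k \<mu> m)\<^sup>2) \<le> (1 / d) ^ 3" for m
        proof -
          have "norm (?k (\<mu> + e) m) * (norm (?k \<mu> m))\<^sup>2 \<le> (1 / d) * (1 / d)\<^sup>2"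
            by (intro mult_mono ke power_mono k\<mu>) (use d in auto)
          then show ?thesis by (simp only: norm_mult norm_power power3_eq_cube power2_eq_square mult.assoc)
        qed
        show "integrable lborel (\<lambda>m. norm (h m * (?k (\<mu> + e) m * (?k \<mu> m)\<^sup>2)))"
          by (intro integrable_norm int[OF _ kb]) measurable
        show "integrable lborel (\<lambda>m. norm (h m) * (1 / d) ^ 3)"
          by (intro integrable_mult_left integrable_norm h)
        show "norm (h m * (?k (\<mu> + e) m * (?k \<mu> m)\<^sup>2)) \<le> norm (h m) * (1 / d) ^ 3" for m
          unfolding norm_mult[of "h m"] by (intro mult_left_mono kb) simp
      qed
      also have "(LINT m|lborel. norm (h m) * (1 / d) ^ 3) = C" by (simp add: C_def)
      finally show ?thesis by (simp only: mult_left_mono norm_ge_zero)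
    qed
    have "((\<lambda>e. (?F (\<mu> + e) - ?F \<mu>) / e - D) \<longlongrightarrow> 0) (at 0)"
    proof (rule Lim_null_comparison[of _ "\<lambda>e. norm e * C"])
      show "\<forall>\<^sub>F e in at 0. norm ((?F (\<mu> + e) - ?F \<mu>) / e - D) \<le> norm e * C"
        unfolding eventually_at using est d by (auto intro!: exI[of _ d])
      show "((\<lambda>e. norm e * C) \<longlongrightarrow> 0) (at 0)"
        by (auto intro!: tendsto_eq_intros)
    qed
    then have "(?F has_field_derivative D) (at \<mu>)"
      unfolding DERIV_def using LIM_zero_iff by blast
    then show "?F field_differentiable at \<mu> within {\<mu>. Re \<mu> \<noteq> 0}"
      using field_differentiable_def has_field_derivative_at_within by blast
  qed
qed (use A in auto)

text \<open>The inner integral is a Newton sum plus a Cauchy transform along the imaginary axis.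
  Being connected and disjoint from the axis, the contour lies in one open half plane, where the
  transform is holomorphic; Cauchy's theorem removes it.\<close>

lemma corr_kernel_eq:
  assumes \<nu>: "\<And>j. j < N \<Longrightarrow> \<bar>\<nu> j\<bar> < R" and \<gamma>: "encircles_once \<gamma> (supp_points N \<nu>) imaginary_axis"
    and st: "s > 0" "t > 0"
  shows "corr_kernel N \<nu> \<gamma> s x t y = flow_kernel R N \<nu> s x t y"
proof -
  define f where "f = (\<lambda>\<mu>. gauss s (complex_of_real x) (complex_of_real s * \<mu>))"
  define g where "g = (\<lambda>m. gauss t (- \<i> * complex_of_real y) (complex_of_real (t * m)))"
  let ?F = "\<lambda>\<mu>. LINT m|lborel. g m * (1 / (\<i> * complex_of_real m - \<mu>))"
  let ?c = "\<lambda>k. LINT m|lborel. g m * poly (newton \<nu> k) (\<i> * complex_of_real m)"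
  have fhol: "f holomorphic_on A" for A unfolding f_def by (rule holomorphic_gauss[OF st(1)])
  have gp: "integrable lborel (\<lambda>m. g m * poly p (\<i> * complex_of_real m))" for p
    unfolding g_def by (rule integral_gauss_newton(1)[OF st(2)])
  have intg: "integrable lborel g" using gp[of 1] by simp
  have inner: "(LINT m|lborel. g m * cauchy_factor N \<nu> \<mu> (\<i> * complex_of_real m)) =
      (\<Sum>k<N. ?c k / poly (newton \<nu> (Suc k)) \<mu>) + ?F \<mu>" if \<mu>: "\<mu> \<in> path_image \<gamma>" for \<mu>
  proof -
    have ax: "Re \<mu> \<noteq> 0" and sp: "\<mu> \<notin> supp_points N \<nu>"
      using \<gamma> \<mu> by (auto simp: encircles_once_def imaginary_axis_def)
    have e: "g m * cauchy_factor N \<nu> \<mu> (\<i> * complex_of_real m) =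
        (\<Sum>k<N. (g m * poly (newton \<nu> k) (\<i> * complex_of_real m)) * (1 / poly (newton \<nu> (Suc k)) \<mu>))
        + g m * (1 / (\<i> * complex_of_real m - \<mu>))" for m
    proof -
      have "\<mu> \<noteq> \<i> * complex_of_real m" using ax by auto
      moreover have "\<mu> \<noteq> complex_of_real (\<nu> j)" if "j < N" for j
        using sp that by (auto simp: supp_points_def)
      ultimately show ?thesis by (simp add: cauchy_factor_eq distrib_left sum_distrib_left)
    qed
    have i1: "integrable lborel (\<lambda>m. g m * (1 / (\<i> * complex_of_real m - \<mu>)))"
    proof (rule Bochner_Integration.integrable_bound[of _ "\<lambda>m. norm (g m) * (1 / \<bar>Re \<mu>\<bar>)"])
      have [measurable]: "g \<in> borel_measurable borel" using borel_measurable_integrable[OF intg] by simp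
      show "(\<lambda>m. g m * (1 / (\<i> * complex_of_real m - \<mu>))) \<in> borel_measurable lborel" by measurable
      have b: "norm (1 / (\<i> * complex_of_real m - \<mu>)) \<le> 1 / \<bar>Re \<mu>\<bar>" for m
        using abs_Re_le_cmod[of "\<i> * complex_of_real m - \<mu>"] ax by (simp add: norm_divide frac_le)
      have "norm (g m * (1 / (\<i> * complex_of_real m - \<mu>))) \<le> norm (norm (g m) * (1 / \<bar>Re \<mu>\<bar>))" for m
        unfolding norm_mult[of "g m"] real_norm_def
        by (rule order_trans[OF mult_left_mono[OF b norm_ge_zero] abs_ge_self])
      then show "AE m in lborel. norm (g m * (1 / (\<i> * complex_of_real m - \<mu>))) \<le> norm (norm (g m) * (1 / \<bar>Re \<mu>\<bar>))"
        by (rule AE_I2)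
    qed (intro integrable_mult_left integrable_norm intg)
    have "(LINT m|lborel. g m * cauchy_factor N \<nu> \<mu> (\<i> * complex_of_real m)) =
        (LINT m|lborel. (\<Sum>k<N. (g m * poly (newton \<nu> k) (\<i> * complex_of_real m)) * (1 / poly (newton \<nu> (Suc k)) \<mu>))) + ?F \<mu>"
      unfolding e by (intro Bochner_Integration.integral_add i1 Bochner_Integration.integrable_sum integrable_mult_left gp)
    also have "(LINT m|lborel. (\<Sum>k<N. (g m * poly (newton \<nu> k) (\<i> * complex_of_real m)) * (1 / poly (newton \<nu> (Suc k)) \<mu>)))
        = (\<Sum>k<N. ?c k * (1 / poly (newton \<nu> (Suc k)) \<mu>))"
      by (subst Bochner_Integration.integral_sum[OF integrable_mult_left[OF gp]]) (simp only: integral_mult_left_zero)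
    finally show ?thesis by simp
  qed
  have "((\<lambda>\<mu>. f \<mu> * ?F \<mu>) has_contour_integral 0) \<gamma>"
  proof -
    have "connected (path_image \<gamma>)"
      using \<gamma> by (auto simp: encircles_once_def intro: connected_path_image valid_path_imp_path)
    moreover have "path_image \<gamma> \<subseteq> {\<mu>. 0 < Re \<mu>} \<union> {\<mu>. Re \<mu> < 0}"
      using \<gamma> by (fastforce simp: encircles_once_def imaginary_axis_def)
    ultimately have "{\<mu>. 0 < Re \<mu>} \<inter> path_image \<gamma> = {} \<or> {\<mu>. Re \<mu> < 0} \<inter> path_image \<gamma> = {}"
      by (intro connectedD open_halfspace_Re_gt open_halfspace_Re_lt) auto
    then obtain H where H: "H = {\<mu>. 0 < Re \<mu>} \<or> H = {\<mu>. Re \<mu> < 0}" "path_image \<gamma> \<subseteq> H"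
      using \<open>path_image \<gamma> \<subseteq> {\<mu>. 0 < Re \<mu>} \<union> {\<mu>. Re \<mu> < 0}\<close> by blast
    show ?thesis
    proof (rule Cauchy_theorem_convex_simple[of _ H])
      show "(\<lambda>\<mu>. f \<mu> * ?F \<mu>) holomorphic_on H"
        by (intro holomorphic_on_mult fhol holomorphic_cauchy_transform intg) (use H in auto)
      show "convex H" using H convex_halfspace_Re_gt[of 0] convex_halfspace_Re_lt[of 0] by auto
    qed (use H \<gamma> in \<open>auto simp: encircles_once_def\<close>)
  qed
  from contour_integral_unique[OF has_contour_integral_add[OF contour_integral_newton_sum[OF fhol \<nu> \<gamma>, of ?c] this]]
  have "contour_integral \<gamma> (\<lambda>\<mu>. f \<mu> * (\<Sum>k<N. ?c k / poly (newton \<nu> (Suc k)) \<mu>) + f \<mu> * ?F \<mu>) =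
    2 * of_real pi * \<i> * (\<Sum>k<N. ?c k * divdiff R \<nu> k f)" by simp
  also have "contour_integral \<gamma> (\<lambda>\<mu>. f \<mu> * (\<Sum>k<N. ?c k / poly (newton \<nu> (Suc k)) \<mu>) + f \<mu> * ?F \<mu>) =
    contour_integral \<gamma> (\<lambda>\<mu>. f \<mu> * (LINT m|lborel. g m * cauchy_factor N \<nu> \<mu> (\<i> * complex_of_real m)))"
    by (rule contour_integral_eq) (simp only: inner distrib_left)
  finally have 1: "contour_integral \<gamma> (\<lambda>\<mu>. f \<mu> * (LINT m|lborel. g m * cauchy_factor N \<nu> \<mu> (\<i> * complex_of_real m))) =
    2 * of_real pi * \<i> * (\<Sum>k<N. flow_Q R \<nu> s k x / complex_of_real (sqrt s) * (flow_R \<nu> t k y / complex_of_real (sqrt t)))"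
    unfolding f_def g_def integral_gauss_newton(2)[OF st(2)] divdiff_gauss[OF st(1)] by (simp only: mult.commute)
  show ?thesis
    unfolding corr_kernel_def 1[unfolded f_def g_def] kernel_tail_eq[OF st] flow_kernel_def sqrt_mult_sum'[OF st] ..
qed

text \<open>For distinct drifts the polynomial interpolating \<open>f\<close> has a Newton and a
  Lagrange form; the \<open>Phi N \<nu> j\<close> are the Lagrange basis. By uniqueness both give
  the same integral.\<close>

lemma corr_kernel_simple_eq:
  assumes \<nu>: "\<And>j. j < N \<Longrightarrow> \<bar>\<nu> j\<bar> < R" and weyl: "\<nu> \<in> weyl N" and N: "N \<ge> 1" and st: "s > 0" "t > 0"
  shows "corr_kernel_simple N \<nu> s x t y = flow_kernel R N \<nu> s x t y"
proof -
  define f where "f = (\<lambda>\<mu>. gauss s (complex_of_real x) (complex_of_real s * \<mu>))"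
  define g where "g = (\<lambda>m. gauss t (- \<i> * complex_of_real y) (complex_of_real (t * m)))"
  have f: "f holomorphic_on UNIV" unfolding f_def by (rule holomorphic_gauss[OF st(1)])
  have g: "integrable lborel (\<lambda>m. g m * poly p (\<i> * complex_of_real m))" for p
    unfolding g_def by (rule integral_gauss_newton(1)[OF st(2)])
  define q where "q = (\<lambda>j. \<Prod>k\<in>{..<N} - {j}. [:1 + complex_of_real (\<nu> j) / complex_of_real (\<nu> k - \<nu> j), - 1 / complex_of_real (\<nu> k - \<nu> j):])"
  have q: "Phi N \<nu> j z = poly (q j) z" for j z
    unfolding Phi_def q_def poly_prod by (intro prod.cong refl) (simp add: algebra_simps diff_divide_distrib)
  have inj: "inj_on \<nu> {..<N}" using weyl by (auto simp: weyl_def intro: strict_mono_on_imp_inj_on)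
  have qval: "poly (q j) (complex_of_real (\<nu> i)) = (if i = j then 1 else 0)" if "i < N" "j < N" for i j
  proof (cases "i = j")
    case False
    have "complex_of_real (\<nu> i) - complex_of_real (\<nu> j) \<noteq> 0" using inj that False by (auto simp: inj_on_def)
    then show ?thesis using that False
      unfolding q[symmetric] Phi_def by (auto intro!: bexI[of _ i] simp flip: of_real_diff)
  qed (simp add: q[symmetric] Phi_def)
  \<comment> \<open>The Newton form; \<open>p2\<close> is the Lagrange form.\<close>
  define p1 where "p1 = (\<Sum>k<N. Polynomial.smult (divdiff R \<nu> k f) (newton \<nu> k))"
  define p2 where "p2 = (\<Sum>j<N. Polynomial.smult (f (complex_of_real (\<nu> j))) (q j))"
  have "p1 = p2"
  proof (rule poly_eqI_degree[where A = "(\<lambda>i. complex_of_real (\<nu> i)) ` {..<N}"])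
    have "inj_on (\<lambda>i. complex_of_real (\<nu> i)) {..<N}" using inj by (auto simp: inj_on_def)
    then have card: "card ((\<lambda>i. complex_of_real (\<nu> i)) ` {..<N}) = N" by (simp add: card_image)
    show "degree p1 < card ((\<lambda>i. complex_of_real (\<nu> i)) ` {..<N})"
      unfolding card p1_def using N
      by (intro degree_sum_less) (auto intro!: le_less_trans[OF degree_smult_le] simp: degree_newton)
    have "degree (q j) < N" if "j < N" for j
    proof -
      have d1: "degree [:a, b:] \<le> 1" for a b :: complex by simp
      have "degree (q j) \<le> (\<Sum>k\<in>{..<N} - {j}. 1)"
        unfolding q_def by (rule order_trans[OF degree_prod_sum_le], simp, unfold o_def, rule sum_mono, rule d1)
      then show ?thesis using that N by simp
    qed
    then show "degree p2 < card ((\<lambda>i. complex_of_real (\<nu> i)) ` {..<N})"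
      unfolding card p2_def using N
      by (intro degree_sum_less) (auto intro!: le_less_trans[OF degree_smult_le])
    fix z assume "z \<in> (\<lambda>i. complex_of_real (\<nu> i)) ` {..<N}"
    then obtain i where i: "i < N" "z = complex_of_real (\<nu> i)" by auto
    have "poly p1 z = f z"
      using newton_interpolation[OF f, of z R N \<nu>] \<nu> i
      by (simp add: p1_def poly_sum poly_newton_eq_0 mult.commute)
    also have "\<dots> = poly p2 z"
      using i by (simp add: p2_def poly_sum qval if_distrib[of "\<lambda>c. _ * c"] cong: if_cong)
    finally show "poly p1 z = poly p2 z" .
  qed
  have fr: "complex_of_real (gauss s x (s * \<nu> j)) = f (complex_of_real (\<nu> j))" for j
    by (simp add: f_def of_real_gauss)
  have "(\<Sum>j<N. f (complex_of_real (\<nu> j)) * (LINT m|lborel. g m * poly (q j) (\<i> * complex_of_real m))) =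
      (LINT m|lborel. (\<Sum>j<N. f (complex_of_real (\<nu> j)) * (g m * poly (q j) (\<i> * complex_of_real m))))"
    by (subst Bochner_Integration.integral_sum[OF integrable_mult_right[OF g]]) (simp only: integral_mult_right_zero)
  also have "\<dots> = (LINT m|lborel. g m * poly p2 (\<i> * complex_of_real m))"
    by (simp add: p2_def poly_sum sum_distrib_left mult_ac)
  also have "\<dots> = (LINT m|lborel. (\<Sum>k<N. divdiff R \<nu> k f * (g m * poly (newton \<nu> k) (\<i> * complex_of_real m))))"
    unfolding \<open>p1 = p2\<close>[symmetric] by (simp add: p1_def poly_sum sum_distrib_left mult_ac)
  also have "\<dots> = (\<Sum>k<N. divdiff R \<nu> k f * (LINT m|lborel. g m * poly (newton \<nu> k) (\<i> * complex_of_real m)))"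
    by (subst Bochner_Integration.integral_sum[OF integrable_mult_right[OF g]]) (simp only: integral_mult_right_zero)
  also have "\<dots> = (\<Sum>k<N. flow_Q R \<nu> s k x / complex_of_real (sqrt s) * (flow_R \<nu> t k y / complex_of_real (sqrt t)))"
    unfolding f_def g_def integral_gauss_newton(2)[OF st(2)] divdiff_gauss[OF st(1)] ..
  finally have 1: "(\<Sum>j<N. complex_of_real (gauss s x (s * \<nu> j)) * (LINT m|lborel. g m * Phi N \<nu> j (\<i> * complex_of_real m))) =
    (\<Sum>k<N. flow_Q R \<nu> s k x / complex_of_real (sqrt s) * (flow_R \<nu> t k y / complex_of_real (sqrt t)))"
    unfolding fr q .
  show ?thesis
    unfolding corr_kernel_simple_def 1[unfolded g_def] kernel_tail_eq[OF st] flow_kernel_def sqrt_mult_sum[OF st] ..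
qed

section \<open>The kernel satisfies the Eynard-Mehta hypotheses\<close>

lemma has_bochner_integral_rescale:
  fixes F :: "real \<Rightarrow> complex"
  assumes "has_bochner_integral lborel F v" "s > 0"
  shows "has_bochner_integral lborel (\<lambda>z. F (z / s) / of_real s) v"
proof -
  have v: "(of_real s * v) /\<^sub>R \<bar>s\<bar> = v"
    using assms(2) by (simp add: scaleR_conv_of_real field_simps)
  have "has_bochner_integral lborel (\<lambda>z. F (z / s)) (of_real s * v)"
    using assms lborel_has_bochner_integral_real_affine_iff[of s "\<lambda>z. F (z / s)" "of_real s * v" 0]
    unfolding v by simp
  from has_bochner_integral_mult_left[OF this, of "1 / of_real s"] show ?thesis using assms(2) by simp
qed

text \<open>Under the divided difference, integration over \<open>\<xi>\<close> is forward flow for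
  time \<open>u\<close>, which undoes \<open>heat u\<close>; what remains is the duality
  \<open>divdiff_newton\<close>.\<close>

lemma has_bochner_integral_poly_divdiff:
  assumes u: "u > 0" and \<nu>: "\<And>j. j < N \<Longrightarrow> \<bar>\<nu> j\<bar> < R" and kl: "k < N" "l < N"
  shows "has_bochner_integral lborel (\<lambda>\<xi>. poly (heat u (newton \<nu> k)) (of_real \<xi>) *
    divdiff R \<nu> l (\<lambda>\<mu>. gauss u (complex_of_real \<xi>) \<mu>)) (if k = l then 1 else 0)"
proof -
  let ?p = "heat u (newton \<nu> k)"
  let ?G = "\<lambda>\<mu> \<xi>. gauss u (complex_of_real \<xi>) \<mu> * poly ?p (complex_of_real \<xi>)"
  obtain C where C: "norm \<mu> \<le> R \<Longrightarrow> norm (?G \<mu> x) \<le> C * exp (- (x\<^sup>2 / (8 * u)))" for \<mu> x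
    using gauss_poly_bound[OF u, of R ?p] by blast
  have "has_bochner_integral lborel (\<lambda>\<xi>. divdiff R \<nu> l (\<lambda>\<mu>. ?G \<mu> \<xi>)) (divdiff R \<nu> l (\<lambda>\<mu>. LINT \<xi>|lborel. ?G \<mu> \<xi>))"
  proof (rule has_bochner_integral_divdiff[where B = "\<lambda>x. C * exp (- (x\<^sup>2 / (8 * u)))"])
    show "continuous_on (sphere 0 R \<times> UNIV) (\<lambda>(\<mu>, \<xi>). ?G \<mu> \<xi>)"
      unfolding case_prod_unfold by (intro continuous_intros u)
    show "integrable lborel (\<lambda>x. C * exp (- (x\<^sup>2 / (8 * u))))" by (rule integrable_exp_square[OF u])
  qed (use \<nu> kl C in auto)
  also have "(\<lambda>\<mu>. LINT \<xi>|lborel. ?G \<mu> \<xi>) = poly (newton \<nu> k)"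
    using integral_gauss_poly[OF u] by (simp add: heat_heat heat_zero_time)
  also have "divdiff R \<nu> l (poly (newton \<nu> k)) = (if k = l then 1 else 0)"
    by (rule divdiff_newton[OF \<nu> kl])
  also have "(\<lambda>\<xi>. divdiff R \<nu> l (\<lambda>\<mu>. ?G \<mu> \<xi>)) =
      (\<lambda>\<xi>. poly ?p (of_real \<xi>) * divdiff R \<nu> l (\<lambda>\<mu>. gauss u (complex_of_real \<xi>) \<mu>))"
    unfolding divdiff_def cint_mult_left[symmetric] by (simp add: mult_ac)
  finally show ?thesis .
qed

lemma has_bochner_integral_poly_gauss:
  assumes "v < u"
  shows "has_bochner_integral lborel (\<lambda>\<xi>. poly (heat u f) (complex_of_real \<xi>) * gauss (u - v) (complex_of_real \<xi>) \<eta>)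
    (poly (heat v f) \<eta>)"
proof -
  have w: "u - v > 0" using assms by simp
  show ?thesis
    using integrable_gauss_poly[OF w, of \<eta> "heat u f"] integral_gauss_poly[OF w, of \<eta> "heat u f"]
    by (simp add: has_bochner_integral_iff mult.commute heat_heat)
qed

text \<open>The Chapman-Kolmogorov equation under the divided difference. The factor free of
  \<open>\<mu>\<close> is merely bounded; the decay comes from the other one, uniformly on the
  circle.\<close>

lemma has_bochner_integral_gauss_divdiff:
  assumes v: "0 < v" "v < u" and \<nu>: "\<And>j. j \<le> k \<Longrightarrow> \<bar>\<nu> j\<bar> < R"
  shows "has_bochner_integral lborel (\<lambda>\<zeta>. gauss (u - v) \<xi> (complex_of_real \<zeta>) *
    divdiff R \<nu> k (\<lambda>\<mu>. gauss v (complex_of_real \<zeta>) \<mu>)) (divdiff R \<nu> k (\<lambda>\<mu>. gauss u \<xi> \<mu>))"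
proof -
  let ?G = "\<lambda>\<mu> \<zeta>. gauss (u - v) \<xi> (complex_of_real \<zeta>) * gauss v (complex_of_real \<zeta>) \<mu>"
  have w: "u - v > 0" using v by simp
  obtain C where C: "norm \<mu> \<le> norm \<xi> \<Longrightarrow> norm (gauss (u - v) (complex_of_real x) \<mu> * poly 1 (of_real x)) \<le> C * exp (- (x\<^sup>2 / (8 * (u - v))))" for \<mu> x
    using gauss_poly_bound[OF w, of "norm \<xi>" 1] by blast
  obtain D where D: "norm \<mu> \<le> R \<Longrightarrow> norm (gauss v (complex_of_real x) \<mu> * poly 1 (of_real x)) \<le> D * exp (- (x\<^sup>2 / (8 * v)))" for \<mu> x
    using gauss_poly_bound[OF v(1), of R 1] by blast
  have C0: "norm (gauss (u - v) \<xi> (complex_of_real x)) \<le> \<bar>C\<bar>" for x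
  proof -
    have "norm (gauss (u - v) \<xi> (complex_of_real x)) \<le> C * exp (- (x\<^sup>2 / (8 * (u - v))))"
      using C[of \<xi> x] by (simp add: gauss_commute[of _ \<xi>])
    also have "\<dots> \<le> \<bar>C\<bar> * 1" using w by (intro mult_mono) auto
    finally show ?thesis by simp
  qed
  have D0: "norm (gauss v (complex_of_real x) \<mu>) \<le> D * exp (- (x\<^sup>2 / (8 * v)))" if "norm \<mu> = R" for \<mu> x
    using D[of \<mu> x] that by simp
  have "has_bochner_integral lborel (\<lambda>\<zeta>. divdiff R \<nu> k (\<lambda>\<mu>. ?G \<mu> \<zeta>)) (divdiff R \<nu> k (\<lambda>\<mu>. LINT \<zeta>|lborel. ?G \<mu> \<zeta>))"
  proof (rule has_bochner_integral_divdiff[where B = "\<lambda>x. \<bar>C\<bar> * (D * exp (- (x\<^sup>2 / (8 * v))))"])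
    show "continuous_on (sphere 0 R \<times> UNIV) (\<lambda>(\<mu>, \<zeta>). ?G \<mu> \<zeta>)"
      unfolding case_prod_unfold by (intro continuous_intros v w)
    show "norm (?G \<mu> x) \<le> \<bar>C\<bar> * (D * exp (- (x\<^sup>2 / (8 * v))))" if "norm \<mu> = R" for \<mu> x
      unfolding norm_mult by (intro mult_mono C0 D0 that) auto
    show "integrable lborel (\<lambda>x. \<bar>C\<bar> * (D * exp (- (x\<^sup>2 / (8 * v)))))"
      by (intro integrable_mult_right integrable_exp_square v)
  qed (use \<nu> in auto)
  also have "(\<lambda>\<mu>. LINT \<zeta>|lborel. ?G \<mu> \<zeta>) = (\<lambda>\<mu>. gauss u \<xi> \<mu>)"
    using has_bochner_integral_integral_eq[OF has_bochner_integral_gauss_gauss[OF w v(1)]] by simp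
  also have "(\<lambda>\<zeta>. divdiff R \<nu> k (\<lambda>\<mu>. ?G \<mu> \<zeta>)) =
      (\<lambda>\<zeta>. gauss (u - v) \<xi> (complex_of_real \<zeta>) * divdiff R \<nu> k (\<lambda>\<mu>. gauss v (complex_of_real \<zeta>) \<mu>))"
    unfolding divdiff_def cint_mult_left[symmetric] by (simp add: mult_ac)
  finally show ?thesis .
qed

lemma continuous_on_flow_Q:
  assumes "s > 0" and \<nu>: "\<And>j. j \<le> k \<Longrightarrow> \<bar>\<nu> j\<bar> < R"
  shows "continuous_on UNIV (flow_Q R \<nu> s k)"
proof -
  have "R \<ge> 0" using \<nu>[of k] by auto
  then have "continuous_on UNIV (\<lambda>x. divdiff R \<nu> k (\<lambda>\<mu>. gauss (1 / s) (complex_of_real (x / s)) \<mu>))"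
    using assms unfolding case_prod_unfold
    by (intro continuous_on_divdiff) (auto simp: case_prod_unfold intro!: continuous_intros)
  then show ?thesis
    using assms unfolding flow_Q_def[abs_def] by (intro continuous_intros) auto
qed

lemma continuous_on_flow_R: "t > 0 \<Longrightarrow> continuous_on UNIV (flow_R \<nu> t k)"
  unfolding flow_R_def[abs_def] by (intro continuous_intros) auto

lemma continuous_on_flow_P:
  assumes "0 < s" "s < t" "continuous_on A f" "continuous_on A g"
  shows "continuous_on A (\<lambda>p. flow_P s t (f p) (g p))"
proof -
  have "1 / s - 1 / t > 0" using assms by (simp add: frac_less2)
  then show ?thesis
    unfolding flow_P_def using assms by (intro continuous_intros) auto
qed

lemma measurable_flow_P: "(\<lambda>(x, y). flow_P s t x y) \<in> borel_measurable (borel \<Otimes>\<^sub>M borel)"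
  unfolding flow_P_def case_prod_unfold by measurable

text \<open>After rescaling \<open>z\<close> by the intermediate time, the relations become the
  duality of Newton polynomials, the group law of the heat flow and Chapman-Kolmogorov. Two square
  roots meeting at one time supply the Jacobian.\<close>

lemma eynard_mehta_flow:
  assumes \<nu>: "\<And>j. j < N \<Longrightarrow> \<bar>\<nu> j\<bar> < R" and t: "\<And>m. m < M \<Longrightarrow> 0 < t m" "strict_mono_on {..<M} t"
  shows "eynard_mehta N M (\<lambda>m. flow_Q R \<nu> (t m)) (\<lambda>m. flow_R \<nu> (t m)) (\<lambda>m n. flow_P (t m) (t n))"
proof -
  have lt: "t m < t n" if "m < n" "n < M" for m n
    using t(2) that by (auto simp: strict_mono_on_def)
  have inv: "1 / t n < 1 / t m" if "m < n" "n < M" for m n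
    using lt[OF that] t(1)[of m] that by (intro frac_less2) auto
  have sq: "complex_of_real (sqrt (t m)) * complex_of_real (sqrt (t m)) = complex_of_real (t m)" if "m < M" for m
    using t(1)[OF that] by (simp flip: of_real_mult)
  show ?thesis
  proof
    fix m assume m: "m < M"
    note tm = t(1)[OF m]
    show "flow_Q R \<nu> (t m) k \<in> borel_measurable borel" if "k < N" for k
      by (rule borel_measurable_continuous_onI[OF continuous_on_flow_Q[OF tm]]) (use \<nu> that in auto)
    show "flow_R \<nu> (t m) k \<in> borel_measurable borel" for k
      by (rule borel_measurable_continuous_onI[OF continuous_on_flow_R[OF tm]])
    show "has_bochner_integral lborel (\<lambda>z. flow_R \<nu> (t m) k z * flow_Q R \<nu> (t m) l z) (if k = l then 1 else 0)"
      if "k < N" "l < N" for k l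
    proof -
      have "has_bochner_integral lborel (\<lambda>z. poly (heat (1 / t m) (newton \<nu> k)) (of_real (z / t m)) *
          divdiff R \<nu> l (\<lambda>\<mu>. gauss (1 / t m) (complex_of_real (z / t m)) \<mu>) / of_real (t m)) (if k = l then 1 else 0)"
        by (rule has_bochner_integral_rescale[OF has_bochner_integral_poly_divdiff[OF _ \<nu> that] tm]) (use tm in auto)
      then show ?thesis unfolding flow_R_def flow_Q_def times_divide_times_eq sq[OF m] .
    qed
  next
    fix m n assume mn: "m < n" "n < M"
    then have m: "m < M" by simp
    have pos: "t m > 0" "t n > 0" using t(1) mn by auto
    show "(\<lambda>(x, y). flow_P (t m) (t n) x y) \<in> borel_measurable (borel \<Otimes>\<^sub>M borel)"
      by (rule measurable_flow_P)
    show "has_bochner_integral lborel (\<lambda>z. flow_R \<nu> (t m) k z * flow_P (t m) (t n) z y) (flow_R \<nu> (t n) k y)" for k y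
    proof -
      have "has_bochner_integral lborel (\<lambda>z. poly (heat (1 / t m) (newton \<nu> k)) (of_real (z / t m)) *
          gauss (1 / t m - 1 / t n) (complex_of_real (z / t m)) (of_real (y / t n)) / of_real (t m))
          (poly (heat (1 / t n) (newton \<nu> k)) (of_real (y / t n)))"
        using has_bochner_integral_rescale[OF has_bochner_integral_poly_gauss[OF inv[OF mn]] pos(1)] by simp
      from has_bochner_integral_mult_left[OF this, of "1 / complex_of_real (sqrt (t n))"]
      show ?thesis unfolding flow_R_def flow_P_def times_divide_times_eq of_real_mult mult.assoc[symmetric] sq[OF m] by simp
    qed
    show "has_bochner_integral lborel (\<lambda>z. flow_P (t m) (t n) x z * flow_Q R \<nu> (t n) k z) (flow_Q R \<nu> (t m) k x)"
      if "k < N" for k x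
    proof -
      have "has_bochner_integral lborel (\<lambda>z. gauss (1 / t m - 1 / t n) (complex_of_real (x / t m)) (of_real (z / t n)) *
          divdiff R \<nu> k (\<lambda>\<mu>. gauss (1 / t n) (complex_of_real (z / t n)) \<mu>) / of_real (t n))
          (divdiff R \<nu> k (\<lambda>\<mu>. gauss (1 / t m) (complex_of_real (x / t m)) \<mu>))"
        by (rule has_bochner_integral_rescale[OF has_bochner_integral_gauss_divdiff[OF _ inv[OF mn]] pos(2)])
           (use \<nu> that pos in auto)
      from has_bochner_integral_mult_left[OF this, of "1 / complex_of_real (sqrt (t m))"]
      show ?thesis unfolding flow_Q_def flow_P_def times_divide_times_eq of_real_mult mult.assoc sq[OF mn(2)]
        by (simp add: mult_ac)
    qed
  next
    fix l m n x y assume lmn: "l < m" "m < n" "n < M"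
    then have m: "m < M" by simp
    have pos: "t m > 0" "t l > 0" "t n > 0" using t(1) lmn by auto
    have w: "1 / t l - 1 / t m > 0" "1 / t m - 1 / t n > 0" using inv[of l m] inv[of m n] lmn by auto
    have "has_bochner_integral lborel (\<lambda>z. gauss (1 / t l - 1 / t m) (complex_of_real (x / t l)) (complex_of_real (z / t m)) *
        gauss (1 / t m - 1 / t n) (complex_of_real (z / t m)) (complex_of_real (y / t n)) / of_real (t m))
        (gauss (1 / t l - 1 / t n) (complex_of_real (x / t l)) (complex_of_real (y / t n)))"
      using has_bochner_integral_rescale[OF has_bochner_integral_gauss_gauss[OF w] pos(1)] by simp
    from has_bochner_integral_mult_left[OF this, of "1 / (complex_of_real (sqrt (t l)) * complex_of_real (sqrt (t n)))"]
    show "has_bochner_integral lborel (\<lambda>z. flow_P (t l) (t m) x z * flow_P (t m) (t n) z y) (flow_P (t l) (t n) x y)"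
      unfolding flow_P_def times_divide_times_eq of_real_mult
      by (simp add: sq[OF m, symmetric] mult_ac)
  qed
qed

section \<open>The joint density as a determinant\<close>

text \<open>For distinct nodes the matrix of values has the factor \<open>g (\<nu> i)\<close> in row
  \<open>i\<close>, and the Vandermonde product can be cancelled. Merging nodes are reached by
  continuity in \<open>s\<close> at \<open>s = 0\<close>.\<close>

lemma det_divdiff_exp_mult:
  assumes \<nu>: "\<nu> \<in> weyl_closed N" and R: "\<And>j. j < N \<Longrightarrow> \<bar>\<nu> j\<bar> + real N < R" and N: "N \<ge> 1"
    and g: "g holomorphic_on UNIV"
  shows "det_fun N (\<lambda>k j. divdiff R \<nu> k (\<lambda>\<mu>. exp (of_real (y j) * \<mu>) * g \<mu>)) =
    (\<Prod>k<N. g (of_real (\<nu> k))) * conf_det R N \<nu> y"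
proof -
  \<comment> \<open>For \<open>s \<le> 1\<close> the nodes move by at most \<open>N\<close>; this is
    why \<open>R\<close> exceeds the drifts by \<open>real N\<close>.\<close>
  define z where "z = (\<lambda>s j. \<nu> j + s * real (Suc j))"
  define L where "L = (\<lambda>s. det_fun N (\<lambda>k j. divdiff R (z s) k (\<lambda>\<mu>. exp (of_real (y j) * \<mu>) * g \<mu>)))"
  define H where "H = (\<lambda>s. (\<Prod>k<N. g (of_real (z s k))) * conf_det R N (z s) y)"
  have R0: "R \<ge> 0" using R[of 0] N by auto
  have zR: "\<bar>z s j\<bar> < R" if "s \<in> {0..1}" "j < N" for s j
  proof -
    have "\<bar>s * real (Suc j)\<bar> \<le> 1 * real N" unfolding abs_mult using that by (intro mult_mono) auto
    then show ?thesis using R[OF that(2)] abs_triangle_ineq[of "\<nu> j" "s * real (Suc j)"] by (simp add: z_def)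
  qed
  have gc: "continuous_on A g" for A
    using holomorphic_on_imp_continuous_on[OF g] continuous_on_subset by blast
  have zc: "continuous_on A (\<lambda>s. z s j)" for A j unfolding z_def by (intro continuous_intros)
  have "continuous_on {0..1} L"
    unfolding L_def
  proof (intro continuous_on_det_fun continuous_on_divdiff[OF R0] zc)
    show "continuous_on ({0..1} \<times> sphere 0 R) (\<lambda>(s, \<mu>). exp (of_real (y j) * \<mu>) * g \<mu>)" for j
      unfolding case_prod_unfold by (intro continuous_intros continuous_on_compose2[OF gc[of UNIV]]) auto
  qed (use zR in auto)
  moreover have "continuous_on {0..1} H"
    unfolding H_def
    by (intro continuous_intros continuous_on_compose2[OF gc[of UNIV]] continuous_on_conf_det[OF R0] zc) (use zR in auto)
  ultimately have cont: "continuous_on (closure {0<..1::real}) (\<lambda>s. L s - H s)"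
    by (simp add: closure_greaterThanAtMost) (intro continuous_intros)
  have eq: "L s - H s = 0" if s: "s \<in> {0<..1}" for s
  proof -
    have zw: "z s \<in> weyl N"
    proof -
      have "z s i < z s j" if "i < j" "j < N" for i j
      proof -
        have "\<nu> i \<le> \<nu> j" using \<nu> that by (auto simp: weyl_closed_def monotone_on_def)
        moreover have "s * real (Suc i) < s * real (Suc j)" using s that by simp
        ultimately show ?thesis by (simp only: z_def add_le_less_mono)
      qed
      then show ?thesis by (auto simp: weyl_def strict_mono_on_def)
    qed
    have zR': "\<bar>z s j\<bar> < R" if "j < N" for j using zR[of s j] s that by auto
    have V: "of_real (vand N (z s)) \<noteq> (0 :: complex)" using vand_pos[OF zw] by simp
    have "of_real (vand N (z s)) * L s = det_fun N (\<lambda>i j. exp (of_real (y j) * of_real (z s i)) * g (of_real (z s i)))"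
      unfolding L_def of_real_vand
      by (rule det_fun_newton[symmetric, where f = "\<lambda>j \<mu>. exp (of_real (y j) * \<mu>) * g \<mu>"])
         (auto intro!: holomorphic_intros g zR')
    also have "\<dots> = ldet {..<N} (\<lambda>i j. g (of_real (z s i)) * complex_of_real (exp (z s i * y j)) * 1)"
      unfolding det_fun_eq_ldet by (simp add: exp_of_real[symmetric] mult.commute)
    also have "\<dots> = (\<Prod>i<N. g (of_real (z s i))) * of_real (exp_det N (z s) y)"
      by (subst ldet_scale) (simp_all add: exp_det_def det_fun_eq_ldet ldet_of_real)
    also have "\<dots> = of_real (vand N (z s)) * H s"
    proof -
      have e: "complex_of_real (exp_det N (z s) y) = of_real (vand N (z s)) * conf_det R N (z s) y"
        by (rule exp_det_eq_conf_det[OF zR'])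
      show ?thesis unfolding H_def e by (simp only: mult_ac)
    qed
    finally have "L s = H s" using mult_left_cancel[OF V] by blast
    then show ?thesis by simp
  qed
  have "L 0 - H 0 = 0"
    by (rule continuous_constant_on_closure[OF cont eq]) (auto simp: closure_greaterThanAtMost)
  then show ?thesis by (simp add: L_def H_def z_def)
qed

text \<open>Heat flow keeps Newton polynomials monic, so that a unit triangular matrix reduces them
  to monomials; the drifts disappear.\<close>

lemma det_flow_R:
  assumes "t > 0"
  shows "det_fun N (\<lambda>k j. flow_R \<nu> t k (y j)) = (1 / of_real (sqrt t)) ^ N * of_real (det_fun N (\<lambda>k j. (y j / t) ^ k))"
proof -
  let ?c = "\<lambda>k. coeff (heat (1 / t) (newton \<nu> k))"
  have d: "degree (heat (1 / t) (newton \<nu> k)) \<le> k" "?c k k = 1" for k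
    using degree_heat[of "1 / t" "newton \<nu> k"] coeff_newton[of \<nu> k] by (auto simp: degree_newton)
  have p: "poly (heat (1 / t) (newton \<nu> k)) z = (\<Sum>l<N. ?c k l * z ^ l)" if "k < N" for k z
    unfolding poly_altdef using d(1)[of k] that
    by (intro sum.mono_neutral_left) (auto intro: coeff_eq_0)
  have "det_fun N (\<lambda>k j. flow_R \<nu> t k (y j)) =
      ldet {..<N} (\<lambda>k j. 1 / of_real (sqrt t) * (\<Sum>l<N. ?c k l * of_real (y j / t) ^ l) * 1)"
    unfolding det_fun_eq_ldet flow_R_def by (rule ldet_cong) (simp add: p)
  also have "\<dots> = (1 / of_real (sqrt t)) ^ N * det_fun N (\<lambda>k j. \<Sum>l<N. ?c k l * of_real (y j / t) ^ l)"
    by (subst ldet_scale) (simp_all add: det_fun_eq_ldet)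
  also have "det_fun N (\<lambda>k j. \<Sum>l<N. ?c k l * of_real (y j / t) ^ l) =
      (\<Prod>k<N. ?c k k) * det_fun N (\<lambda>l j. of_real (y j / t) ^ l)"
    by (rule det_fun_triangular_mult) (use d(1) in \<open>auto intro: coeff_eq_0 le_less_trans\<close>)
  also have "\<dots> = of_real (det_fun N (\<lambda>k j. (y j / t) ^ k))"
    by (simp add: d of_real_det_fun)
  finally show ?thesis .
qed

text \<open>\<open>flow_P\<close> is the transition density of the Brownian bridge, up to a scalar.\<close>

lemma flow_P_eq:
  assumes "0 < s" "s < t"
  shows "flow_P s t x y = complex_of_real (sqrt s / sqrt t * gauss s x 0 * gauss (t - s) y x / gauss t y 0)"
proof -
  have pos: "t > 0" "t - s > 0" using assms by auto
  have c: "sqrt s / sqrt t * (1 / sqrt (2 * pi * s)) * (1 / sqrt (2 * pi * (t - s))) / (1 / sqrt (2 * pi * t)) =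
      1 / sqrt (2 * pi * (t - s))"
    using assms pos by (simp add: real_sqrt_mult)
  have e: "- ((sqrt (s / t) * y - sqrt (t / s) * x)\<^sup>2 / (2 * (t - s))) =
      - ((x - 0)\<^sup>2 / (2 * s)) + - ((y - x)\<^sup>2 / (2 * (t - s))) - - ((y - 0)\<^sup>2 / (2 * t))"
  proof -
    have sq: "(sqrt (s / t))\<^sup>2 = s / t" "(sqrt (t / s))\<^sup>2 = t / s" "sqrt (s / t) * sqrt (t / s) = 1"
      using assms pos by (simp_all flip: real_sqrt_mult)
    have "(sqrt (s / t) * y - sqrt (t / s) * x)\<^sup>2 =
        (sqrt (s / t))\<^sup>2 * y\<^sup>2 + (sqrt (t / s))\<^sup>2 * x\<^sup>2 - 2 * (sqrt (s / t) * sqrt (t / s)) * (x * y)"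
      by (simp add: power2_eq_square algebra_simps)
    also have "\<dots> = s / t * y\<^sup>2 + t / s * x\<^sup>2 - 2 * (x * y)" unfolding sq by simp
    finally have 1: "(sqrt (s / t) * y - sqrt (t / s) * x)\<^sup>2 = \<dots>" .
    define d where "d = t - s"
    have d: "t = s + d" "d \<noteq> 0" "s + d \<noteq> 0" "s \<noteq> 0" using assms by (auto simp: d_def)
    show ?thesis unfolding 1 d_def[symmetric] unfolding d(1) using d(2-4)
      by (simp add: divide_simps) (simp add: algebra_simps power2_eq_square)
  qed
  have "flow_P s t x y = kernel_tail s x t y" using assms pos by (simp add: kernel_tail_eq)
  also have "\<dots> = complex_of_real (gauss (t - s) (sqrt (s / t) * y) (sqrt (t / s) * x))"
    using assms by (simp add: kernel_tail_def)
  also have "gauss (t - s) (sqrt (s / t) * y) (sqrt (t / s) * x) =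
      sqrt s / sqrt t * gauss s x 0 * gauss (t - s) y x / gauss t y 0"
  proof -
    have g: "gauss r a b = 1 / sqrt (2 * pi * r) * exp (- ((a - b)\<^sup>2 / (2 * r)))" for r a b :: real
      by (simp add: gauss_def)
    have ac: "k * (a * A) * (b * B) / (c * C) = (k * a * b / c) * (A * B / C)" for k a b c A B C :: real
      by simp
    have "gauss (t - s) (sqrt (s / t) * y) (sqrt (t / s) * x) = 1 / sqrt (2 * pi * (t - s)) *
        exp (- ((x - 0)\<^sup>2 / (2 * s)) + - ((y - x)\<^sup>2 / (2 * (t - s))) - - ((y - 0)\<^sup>2 / (2 * t)))"
      unfolding e[symmetric] by (simp add: gauss_def)
    also have "\<dots> = sqrt s / sqrt t * gauss s x 0 * gauss (t - s) y x / gauss t y 0"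
      unfolding g ac c exp_diff exp_add ..
    finally show ?thesis .
  qed
  finally show ?thesis .
qed

lemma det_flow_P:
  assumes "0 < s" "s < t"
  shows "det_fun N (\<lambda>i j. flow_P s t (x i) (y j)) =
    (of_real (sqrt s) / of_real (sqrt t)) ^ N * (of_real (\<Prod>j<N. gauss s (x j) 0) / of_real (\<Prod>j<N. gauss t (y j) 0))
      * of_real (karlin_mcgregor N (t - s) y x)"
proof -
  have "det_fun N (\<lambda>i j. flow_P s t (x i) (y j)) = complex_of_real (ldet {..<N}
      (\<lambda>i j. (sqrt s / sqrt t * gauss s (x i) 0) * gauss (t - s) (y j) (x i) * (1 / gauss t (y j) 0)))"
    unfolding flow_P_eq[OF assms] det_fun_eq_ldet ldet_of_real by simp
  also have "ldet {..<N} (\<lambda>i j. (sqrt s / sqrt t * gauss s (x i) 0) * gauss (t - s) (y j) (x i) * (1 / gauss t (y j) 0)) =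
      (\<Prod>i<N. sqrt s / sqrt t * gauss s (x i) 0) * (\<Prod>j<N. 1 / gauss t (y j) 0) * det_fun N (\<lambda>i j. gauss (t - s) (y j) (x i))"
    unfolding det_fun_eq_ldet by (rule ldet_scale) simp
  also have "det_fun N (\<lambda>i j. gauss (t - s) (y j) (x i)) = karlin_mcgregor N (t - s) y x"
    unfolding karlin_mcgregor_def by (rule det_fun_transpose)
  finally show ?thesis
    by (simp add: prod.distrib prod_dividef power_divide)
qed

text \<open>The Gaussian at \<open>t * \<mu>\<close> splits into \<open>gauss t x 0\<close>, the
  exponential \<open>exp (x * \<mu>)\<close> and \<open>exp (- t * \<mu>\<^sup>2 / 2)\<close>. The
  last factor, evaluated at the drifts, becomes \<open>drift_factor\<close>.\<close>

lemma det_flow_Q: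
  assumes t: "t > 0" and \<nu>: "\<nu> \<in> weyl_closed N" and R: "\<And>j. j < N \<Longrightarrow> \<bar>\<nu> j\<bar> + real N < R" and N: "N \<ge> 1"
  shows "det_fun N (\<lambda>i j. flow_Q R \<nu> t j (x i)) =
    of_real (sqrt t) ^ N * of_real (\<Prod>j<N. gauss t (x j) 0) * (of_real (drift_factor N t \<nu>) * conf_det R N \<nu> x)"
proof -
  let ?g = "\<lambda>\<mu>. exp (- (of_real t * \<mu>\<^sup>2 / 2)) :: complex"
  have f: "flow_Q R \<nu> t k x = of_real (sqrt t) * of_real (gauss t x 0) * divdiff R \<nu> k (\<lambda>\<mu>. exp (of_real x * \<mu>) * ?g \<mu>)" for k x
  proof -
    have pw: "gauss t (complex_of_real x) (complex_of_real t * \<mu>) = of_real (gauss t x 0) * (exp (of_real x * \<mu>) * ?g \<mu>)" for \<mu>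
    proof -
      have "- ((complex_of_real x - complex_of_real t * \<mu>)\<^sup>2 / complex_of_real (2 * t)) =
          - ((complex_of_real x - 0)\<^sup>2 / complex_of_real (2 * t)) + (of_real x * \<mu> + - (of_real t * \<mu>\<^sup>2 / 2))"
        using t by (simp add: field_simps power2_eq_square)
      then show ?thesis
        unfolding of_real_gauss of_real_0 unfolding gauss_def by (simp only: exp_add mult.assoc)
    qed
    have "flow_Q R \<nu> t k x = of_real (sqrt t) * divdiff R \<nu> k (\<lambda>\<mu>. gauss t (complex_of_real x) (complex_of_real t * \<mu>))"
      unfolding divdiff_gauss[OF t] using t by simp
    also have "divdiff R \<nu> k (\<lambda>\<mu>. gauss t (complex_of_real x) (complex_of_real t * \<mu>)) =
        of_real (gauss t x 0) * divdiff R \<nu> k (\<lambda>\<mu>. exp (of_real x * \<mu>) * ?g \<mu>)"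
      unfolding pw divdiff_def cint_mult_left[symmetric] by simp
    finally show ?thesis by simp
  qed
  have "det_fun N (\<lambda>i j. flow_Q R \<nu> t j (x i)) = det_fun N (\<lambda>j i. flow_Q R \<nu> t j (x i))"
    by (rule det_fun_transpose)
  also have "\<dots> = ldet {..<N} (\<lambda>k i. of_real (sqrt t) * divdiff R \<nu> k (\<lambda>\<mu>. exp (of_real (x i) * \<mu>) * ?g \<mu>) * of_real (gauss t (x i) 0))"
    unfolding f det_fun_eq_ldet by (simp only: mult_ac)
  also have "\<dots> = of_real (sqrt t) ^ N * of_real (\<Prod>j<N. gauss t (x j) 0) *
      det_fun N (\<lambda>k i. divdiff R \<nu> k (\<lambda>\<mu>. exp (of_real (x i) * \<mu>) * ?g \<mu>))"
    by (subst ldet_scale) (simp_all add: det_fun_eq_ldet)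
  also have "det_fun N (\<lambda>k i. divdiff R \<nu> k (\<lambda>\<mu>. exp (of_real (x i) * \<mu>) * ?g \<mu>)) =
      (\<Prod>k<N. ?g (of_real (\<nu> k))) * conf_det R N \<nu> x"
    by (rule det_divdiff_exp_mult[OF \<nu> R N]) (auto intro!: holomorphic_intros)
  also have "(\<Prod>k<N. ?g (of_real (\<nu> k))) = of_real (drift_factor N t \<nu>)"
  proof -
    have "(\<Prod>k<N. ?g (of_real (\<nu> k))) = complex_of_real (\<Prod>k<N. exp (- (t * (\<nu> k)\<^sup>2 / 2)))"
      by (simp add: exp_of_real[symmetric])
    also have "(\<Prod>k<N. exp (- (t * (\<nu> k)\<^sup>2 / 2))) = drift_factor N t \<nu>"
      unfolding drift_factor_def exp_sum[OF finite_lessThan, symmetric]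
      by (simp add: sum_negf sum_distrib_left sum_divide_distrib)
    finally show ?thesis .
  qed
  finally show ?thesis .
qed

lemma prod_telescope:
  fixes a :: "nat \<Rightarrow> complex"
  assumes "\<And>m. m \<le> L \<Longrightarrow> a m \<noteq> 0"
  shows "(\<Prod>m<L. a (Suc m) / a m) = a L / a 0"
  using assms by (induction L) auto

lemma drift_factor_telescope:
  "drift_factor N (t 0) \<nu> * (\<Prod>m<L. drift_factor N (t (Suc m) - t m) \<nu>) = drift_factor N (t L) \<nu>"
proof (induction L)
  case (Suc L)
  have "drift_factor N (t L) \<nu> * drift_factor N (t (Suc L) - t L) \<nu> = drift_factor N (t (Suc L)) \<nu>"
    unfolding drift_factor_def exp_add[symmetric] by (simp add: algebra_simps diff_divide_distrib)
  then show ?case using Suc by (simp add: mult.assoc[symmetric])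
qed simp

lemma joint_density_weyl_eq:
  assumes \<nu>: "\<nu> \<in> weyl_closed N" and N: "N \<ge> 1" and R: "\<And>j. j < N \<Longrightarrow> \<bar>\<nu> j\<bar> + real N < R"
    and t: "\<And>m. m < M \<Longrightarrow> 0 < t m" "strict_mono_on {..<M} t" and M: "M \<ge> 1"
    and x: "\<And>m. m < M \<Longrightarrow> x m \<in> weyl N"
  shows "complex_of_real (joint_density_weyl N \<nu> M t x) =
    det_fun N (\<lambda>i j. flow_R \<nu> (t 0) i (x 0 j))
    * (\<Prod>m<M - 1. det_fun N (\<lambda>i j. flow_P (t m) (t (Suc m)) (x m i) (x (Suc m) j)))
    * det_fun N (\<lambda>i j. flow_Q R \<nu> (t (M - 1)) j (x (M - 1) i))" (is ?th1)
    and "joint_density_weyl N \<nu> M t x \<ge> 0" (is ?th2)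
proof -
  have R': "\<bar>\<nu> j\<bar> < R" if "j < N" for j using R[OF that] by linarith
  have R0: "R > 0" using R[of 0] N by linarith
  have lt: "t m < t (Suc m)" if "m < M - 1" for m
  proof -
    have "m < M" "Suc m < M" using that by auto
    then show ?thesis using t(2) by (auto simp: strict_mono_on_def)
  qed
  define L where "L = M - 1"
  have L: "L < M" "M - 1 = L" using M by (auto simp: L_def)
  \<comment> \<open>The quotients of \<open>G\<close> telescope in the transition densities.
    \<open>S\<close> and \<open>F\<close> telescope in the determinants: \<open>S\<close>
    disappears, and of \<open>F\<close> only \<open>F 0\<close> is left, the Gaussian factor of the
    first transition.\<close>
  define G where "G = (\<lambda>m. conf_det R N \<nu> (x m))"
  define S where "S = (\<lambda>m. complex_of_real (sqrt (t m)) ^ N)"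
  define F where "F = (\<lambda>m. complex_of_real (\<Prod>j<N. gauss (t m) (x m j) 0))"
  define q where "q = (\<lambda>m. complex_of_real (karlin_mcgregor N (t (Suc m) - t m) (x (Suc m)) (x m)))"
  define V where "V = complex_of_real (det_fun N (\<lambda>k j. (x 0 j / t 0) ^ k))"
  define D where "D = (\<lambda>t. complex_of_real (drift_factor N t \<nu>))"
  have Gnz: "G m \<noteq> 0" if "m < M" for m
    unfolding G_def by (rule conf_det_nz[OF \<nu> x[OF that] R'])
  have Snz: "S m \<noteq> 0" if "m < M" for m using t(1)[OF that] by (simp add: S_def)
  have Fnz: "F m \<noteq> 0" if "m < M" for m
  proof -
    have "(\<Prod>j<N. gauss (t m) (x m j) 0) \<noteq> 0" using gauss_pos[OF t(1)[OF that]] by (simp add: less_imp_neq[symmetric])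
    then show ?thesis unfolding F_def by (simp only: of_real_eq_0_iff not_False_eq_True)
  qed
  have tr0: "complex_of_real (transition N \<nu> (t 0) (x 0) (\<lambda>_. 0)) = D (t 0) * G 0 * (F 0 * V)"
    unfolding D_def G_def F_def V_def by (rule transition_0(1)) (use t x \<nu> R' R0 M in auto)
  have trm: "complex_of_real (transition N \<nu> (t (Suc m) - t m) (x (Suc m)) (x m)) =
      D (t (Suc m) - t m) * (G (Suc m) / G m) * q m" if "m < L" for m
    unfolding D_def G_def q_def by (rule transition_weyl(1)) (use lt x \<nu> R' R0 that L in auto)
  have "complex_of_real (joint_density_weyl N \<nu> M t x) =
      (D (t 0) * G 0 * (F 0 * V)) * (\<Prod>m<L. D (t (Suc m) - t m) * (G (Suc m) / G m) * q m)"
    unfolding joint_density_weyl_def L(2) of_real_mult of_real_prod tr0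
    by (intro arg_cong2[where f = "(*)"] refl prod.cong) (use trm in auto)
  also have "\<dots> = (D (t 0) * (\<Prod>m<L. D (t (Suc m) - t m))) * (G 0 * (\<Prod>m<L. G (Suc m) / G m)) * (F 0 * V) * (\<Prod>m<L. q m)"
    unfolding prod.distrib by (simp only: mult_ac)
  also have "D (t 0) * (\<Prod>m<L. D (t (Suc m) - t m)) = D (t L)"
    unfolding D_def drift_factor_telescope[of N t \<nu> L, symmetric] by simp
  also have "G 0 * (\<Prod>m<L. G (Suc m) / G m) = G L"
    using prod_telescope[of L G] Gnz L M by simp
  finally have 1: "complex_of_real (joint_density_weyl N \<nu> M t x) = D (t L) * G L * (F 0 * V) * (\<Prod>m<L. q m)" .
  have r: "det_fun N (\<lambda>i j. flow_R \<nu> (t 0) i (x 0 j)) = 1 / S 0 * V"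
    unfolding S_def V_def by (subst det_flow_R) (use t M in \<open>auto simp: power_one_over\<close>)
  have p: "det_fun N (\<lambda>i j. flow_P (t m) (t (Suc m)) (x m i) (x (Suc m) j)) = S m / S (Suc m) * (F m / F (Suc m)) * q m"
    if "m < L" for m
    unfolding S_def F_def q_def by (subst det_flow_P) (use t lt that L in \<open>auto simp: power_divide\<close>)
  have qq: "det_fun N (\<lambda>i j. flow_Q R \<nu> (t L) j (x L i)) = S L * F L * (D (t L) * G L)"
    unfolding S_def F_def D_def G_def by (rule det_flow_Q[OF t(1)[OF L(1)] \<nu> R N])
  \<comment> \<open>Written with reciprocals, because \<open>prod_telescope\<close> has the later
    index in the numerator.\<close>
  have "(\<Prod>m<L. det_fun N (\<lambda>i j. flow_P (t m) (t (Suc m)) (x m i) (x (Suc m) j))) =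
      (\<Prod>m<L. (1 / S (Suc m)) / (1 / S m) * ((1 / F (Suc m)) / (1 / F m)) * q m)"
    by (intro prod.cong refl) (use p in auto)
  also have "\<dots> = (1 / S L) / (1 / S 0) * ((1 / F L) / (1 / F 0)) * (\<Prod>m<L. q m)"
    unfolding prod.distrib using prod_telescope[of L "\<lambda>m. 1 / S m"] prod_telescope[of L "\<lambda>m. 1 / F m"] Snz Fnz L(1)
    by (simp only: divide_eq_0_iff zero_neq_one) (auto simp: less_le_trans)
  finally have pp: "(\<Prod>m<L. det_fun N (\<lambda>i j. flow_P (t m) (t (Suc m)) (x m i) (x (Suc m) j))) =
      (1 / S L) / (1 / S 0) * ((1 / F L) / (1 / F 0)) * (\<Prod>m<L. q m)" .
  show ?th1
    unfolding L(2) 1 r pp qq using Snz[OF L(1)] Fnz[OF L(1)] Snz[of 0] M by (simp add: field_simps)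
  have "transition N \<nu> (t (Suc m) - t m) (x (Suc m)) (x m) \<ge> 0" if "m < L" for m
    by (rule transition_weyl(2)[where R = R]) (use lt x \<nu> R' R0 that L in auto)
  moreover have "transition N \<nu> (t 0) (x 0) (\<lambda>_. 0) \<ge> 0"
    by (rule transition_0(2)[where R = R]) (use t x \<nu> R' R0 M in auto)
  ultimately show ?th2
    unfolding joint_density_weyl_def L(2) by (intro mult_nonneg_nonneg prod_nonneg) auto
qed

section \<open>Correlation functions\<close>

lemma rearrange_permutation:
  assumes "inj_on x {..<N}"
  shows "rearrange N x \<in> weyl N" and "\<exists>p. p permutes {..<N} \<and> (\<forall>j<N. rearrange N x j = x (p j))"
proof -
  let ?l = "map x [0..<N]"
  have d: "distinct ?l" using assms by (simp add: distinct_map atLeast0LessThan)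
  then have "sorted_wrt (<) (sort ?l)" by (simp add: strict_sorted_iff)
  then show "rearrange N x \<in> weyl N"
    by (auto simp: weyl_def rearrange_def strict_mono_on_def sorted_wrt_iff_nth_less)
  have "mset (sort ?l) = mset ?l" by simp
  then obtain p where p: "p permutes {..<length ?l}" "permute_list p ?l = sort ?l"
    by (metis mset_eq_permutation)
  have "rearrange N x j = x (p j)" if j: "j < N" for j
  proof -
    have "p j < N" using permutes_in_image[OF p(1), of j] j by simp
    then show ?thesis
      using permute_list_nth[OF p(1), of j] j p(2) by (simp add: rearrange_def)
  qed
  then show "\<exists>p. p permutes {..<N} \<and> (\<forall>j<N. rearrange N x j = x (p j))"
    using p(1) by auto
qed

lemma bij_betw_levelwise:
  assumes "\<And>m. m < M \<Longrightarrow> p m permutes {..<N}"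
  shows "bij_betw (\<lambda>(m, j). (m, p m j)) ({..<M} \<times> {..<N}) ({..<M::nat} \<times> {..<N::nat})"
proof (rule bij_betw_byWitness[where f' = "\<lambda>(m, j). (m, inv_into UNIV (p m) j)"])
  show "(\<lambda>(m, j). (m, p m j)) ` ({..<M} \<times> {..<N}) \<subseteq> {..<M} \<times> {..<N}"
    using permutes_in_image[OF assms] by auto
  show "(\<lambda>(m, j). (m, inv_into UNIV (p m) j)) ` ({..<M} \<times> {..<N}) \<subseteq> {..<M} \<times> {..<N}"
    using permutes_in_image[OF permutes_inv[OF assms]] by auto
qed (use permutes_inverses[OF assms] in auto)

lemma set_block_indices: "set (block_indices M Ns) = (SIGMA m:{..<M}. {..<Ns m})"
  by (auto simp: block_indices_def)

lemma distinct_block_indices: "distinct (block_indices M Ns)"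
proof (induction M)
  case (Suc M)
  have "block_indices (Suc M) Ns = block_indices M Ns @ map (Pair M) [0..<Ns M]"
    by (simp add: block_indices_def)
  then show ?case
    using Suc by (auto simp: set_block_indices distinct_map inj_on_def)
qed (simp add: block_indices_def)

lemma block_det_eq_ldet: "block_det M Ns f = ldet (SIGMA m:{..<M}. {..<Ns m}) f"
proof -
  let ?L = "block_indices M Ns"
  have "bij_betw (\<lambda>i. ?L ! i) {..<length ?L} (SIGMA m:{..<M}. {..<Ns m})"
    using bij_betw_nth[OF distinct_block_indices refl refl] by (simp add: set_block_indices)
  then show ?thesis
    unfolding block_det_def det_fun_eq_ldet by (rule ldet_reindex[symmetric]) simp
qed

locale drifted_times =
  fixes N M :: nat and \<nu> :: "nat \<Rightarrow> real" and R :: real and t :: "nat \<Rightarrow> real"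
  assumes N: "N \<ge> 1" and M: "M \<ge> 1" and \<nu>: "\<nu> \<in> weyl_closed N"
    and R: "\<And>j. j < N \<Longrightarrow> \<bar>\<nu> j\<bar> + real N < R"
    and t: "\<And>m. m < M \<Longrightarrow> 0 < t m" "strict_mono_on {..<M} t"
begin

sublocale eynard_mehta N M "\<lambda>m. flow_Q R \<nu> (t m)" "\<lambda>m. flow_R \<nu> (t m)" "\<lambda>m n. flow_P (t m) (t n)"
proof (rule eynard_mehta_flow)
  show "\<bar>\<nu> j\<bar> < R" if "j < N" for j using R[OF that] by linarith
qed (use t in auto)

lemma ker_eq_flow_kernel:
  assumes "m < M" "n < M"
  shows "ker m n x y = flow_kernel R N \<nu> (t m) x (t n) y"
proof -
  have "m < n \<longleftrightarrow> t m < t n"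
    using strict_mono_on_less[OF t(2), of m n] assms by simp
  then show ?thesis by (simp add: ker_def flow_kernel_def)
qed

text \<open>Permuting the particles within each time acts on rows and columns alike and leaves
  \<open>ker_det\<close> unchanged, so sorting is harmless. If two particles coincide at one time,
  two rows agree and both sides are 0.\<close>

lemma joint_density_eq_ker_det:
  "complex_of_real (joint_density N \<nu> M t x) = ker_det ({..<M} \<times> {..<N}) (\<lambda>(m, j). x m j)"
  "joint_density N \<nu> M t x \<ge> 0"
proof -
  let ?I = "{..<M} \<times> {..<N}"
  have "complex_of_real (joint_density N \<nu> M t x) = ker_det ?I (\<lambda>(m, j). x m j) \<and> joint_density N \<nu> M t x \<ge> 0"
  proof (cases "\<forall>m<M. inj_on (x m) {..<N}")
    case True
    define y where "y = (\<lambda>m. rearrange N (x m))"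
    have y: "y m \<in> weyl N" if "m < M" for m
      unfolding y_def using True that by (intro rearrange_permutation) auto
    have "\<forall>m. \<exists>p. m < M \<longrightarrow> p permutes {..<N} \<and> (\<forall>j<N. y m j = x m (p j))"
      unfolding y_def using True rearrange_permutation(2) by blast
    then obtain p where "\<forall>m. m < M \<longrightarrow> p m permutes {..<N} \<and> (\<forall>j<N. y m j = x m (p m j))"
      by metis
    then have p: "p m permutes {..<N}" "\<And>j. j < N \<Longrightarrow> y m j = x m (p m j)" if "m < M" for m
      using that by auto
    have "ker_det ?I (\<lambda>(m, j). x m j) = ldet ?I (\<lambda>a b. ker (fst a) (fst b) (y (fst a) (snd a)) (y (fst b) (snd b)))"
    proof -
      have "bij_betw (\<lambda>(m, j). (m, p m j)) ?I ?I" by (rule bij_betw_levelwise) (rule p)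
      from ldet_reindex[OF this] have "ker_det ?I (\<lambda>(m, j). x m j) = ldet ?I (\<lambda>a b.
          ker (fst (case a of (m, j) \<Rightarrow> (m, p m j))) (fst (case b of (m, j) \<Rightarrow> (m, p m j)))
            (case (case a of (m, j) \<Rightarrow> (m, p m j)) of (m, j) \<Rightarrow> x m j)
            (case (case b of (m, j) \<Rightarrow> (m, p m j)) of (m, j) \<Rightarrow> x m j))"
        unfolding ker_det_def by simp
      also have "\<dots> = ldet ?I (\<lambda>a b. ker (fst a) (fst b) (y (fst a) (snd a)) (y (fst b) (snd b)))"
        by (rule ldet_cong) (use p in \<open>auto simp: split_beta\<close>)
      finally show ?thesis .
    qed
    also have "\<dots> = ker_det ?I (\<lambda>(m, j). y m j)"
      unfolding ker_det_def by (simp add: case_prod_unfold)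
    also have "\<dots> = complex_of_real (joint_density_weyl N \<nu> M t y)"
      unfolding ker_det_full[OF M N] by (simp add: joint_density_weyl_eq(1)[OF \<nu> N R t M y])
    finally have "ker_det ?I (\<lambda>(m, j). x m j) = complex_of_real (joint_density_weyl N \<nu> M t y)" .
    moreover have "joint_density N \<nu> M t x = joint_density_weyl N \<nu> M t y"
      unfolding joint_density_def y_def by (rule if_P[OF True])
    ultimately show ?thesis
      using joint_density_weyl_eq(2)[OF \<nu> N R t M y] by simp
  next
    case False
    then obtain m i j where ij: "m < M" "i < N" "j < N" "i \<noteq> j" "x m i = x m j"
      by (auto simp: inj_on_def)
    have "ker_det ?I (\<lambda>(m, j). x m j) = 0"
      unfolding ker_det_def
      by (rule ldet_equal_rows[where a = "(m, i)" and b = "(m, j)"]) (use ij in auto)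
    moreover have "joint_density N \<nu> M t x = 0"
      unfolding joint_density_def by (rule if_not_P[OF False])
    ultimately show ?thesis by simp
  qed
  then show "complex_of_real (joint_density N \<nu> M t x) = ker_det ?I (\<lambda>(m, j). x m j)"
    "joint_density N \<nu> M t x \<ge> 0" by auto
qed

text \<open>The weights collected in \<open>nn_integral_ker_det\<close> are exactly the factorials
  by which the correlation function is normalized.\<close>

lemma correlation_eq_block_det:
  assumes Ns: "\<And>m. m < M \<Longrightarrow> Ns m \<le> N"
  shows "complex_of_real (correlation N \<nu> M t Ns x) =
    block_det M Ns (\<lambda>(m, j) (n, k). flow_kernel R N \<nu> (t m) (x m j) (t n) (x n k))"
proof -
  let ?I = "{..<M} \<times> {..<N}"
  define S where "S = (SIGMA m:{..<M}. {..<Ns m})"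
  define J where "J = (SIGMA m:{..<M}. {Ns m..<N})"
  define w where "w = (\<lambda>(m, j). x m j)"
  define c where "c = (\<Prod>m<M. 1 / fact (N - Ns m) :: real)"
  let ?z = "\<lambda>z b. if b \<in> S then w b else z b"
  let ?D = "\<lambda>z. Re (ker_det (S \<union> J) (?z z))"
  have SJ: "S \<union> J = ?I" using Ns by (force simp: S_def J_def)
  have disj: "J \<inter> S = {}" by (auto simp: S_def J_def)
  have fin: "finite J" by (simp add: J_def)
  have nonneg: "nonneg_det (S \<union> J)"
    unfolding nonneg_det_def SJ
  proof
    fix w
    show "\<exists>r\<ge>0. ker_det ?I w = complex_of_real r"
      using joint_density_eq_ker_det[of "\<lambda>m j. w (m, j)"] by (auto simp: case_prod_unfold)
  qed
  have joint: "joint_density N \<nu> M t (\<lambda>m j. if j < Ns m then x m j else z (m, j)) = ?D z" for z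
  proof -
    have "ker_det ?I (\<lambda>(m, j). if j < Ns m then x m j else z (m, j)) = ker_det ?I (?z z)"
    proof -
      have "(case b of (m, j) \<Rightarrow> if j < Ns m then x m j else z (m, j)) = ?z z b" if "b \<in> ?I" for b
        using that by (auto simp: S_def w_def split: if_splits)
      then show ?thesis unfolding ker_det_def by (intro ldet_cong) (simp only:)
    qed
    then show ?thesis
      unfolding SJ joint_density_eq_ker_det(1)[of "\<lambda>m j. if j < Ns m then x m j else z (m, j)", symmetric]
      by (metis Re_complex_of_real joint_density_eq_ker_det(1))
  qed
  have D0: "?D z \<ge> 0" for z using joint_density_eq_ker_det(2) by (simp flip: joint)
  have c0: "c \<ge> 0" unfolding c_def by (intro prod_nonneg) auto
  have cardI: "card {b\<in>S \<union> J. fst b = m} = N" if "m < M" for m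
  proof -
    have "{b\<in>S \<union> J. fst b = m} = Pair m ` {..<N}" unfolding SJ using that by auto
    then show ?thesis by (simp add: card_image inj_on_def)
  qed
  have cardS: "card {b\<in>S. fst b = m} = Ns m" if "m < M" for m
  proof -
    have "{b\<in>S. fst b = m} = Pair m ` {..<Ns m}" unfolding S_def using that by auto
    then show ?thesis by (simp add: card_image inj_on_def)
  qed
  have sub: "S \<union> J \<subseteq> ?I" using SJ by simp
  \<comment> \<open>Every time slice of the full index set has \<open>N\<close> elements, so the
    weights on the left are \<open>fact 0 = 1\<close>.\<close>
  have main: "nonneg_det S" "(\<integral>\<^sup>+ z. ennreal (?D z) \<partial>Pi\<^sub>M J (\<lambda>_. lborel)) =
      ennreal ((\<Prod>m<M. fact (N - Ns m)) * Re (ker_det S w))"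
    using nn_integral_ker_det[OF fin disj sub nonneg] cardI cardS by simp_all
  obtain r where r: "r \<ge> 0" "ker_det S w = complex_of_real r"
    using main(1) unfolding nonneg_det_def by meson
  have meas: "?D \<in> borel_measurable (Pi\<^sub>M J (\<lambda>_. lborel))"
    using measurable_ker_det[OF fin sub] by measurable
  have "correlation N \<nu> M t Ns x = (LINT z|Pi\<^sub>M J (\<lambda>_. lborel). ?D z * c)"
    unfolding correlation_def joint J_def c_def ..
  also have "\<dots> = (LINT z|Pi\<^sub>M J (\<lambda>_. lborel). ?D z) * c" by simp
  also have "(LINT z|Pi\<^sub>M J (\<lambda>_. lborel). ?D z) = enn2real (\<integral>\<^sup>+ z. ennreal (?D z) \<partial>Pi\<^sub>M J (\<lambda>_. lborel))"
    by (rule integral_eq_nn_integral[OF meas]) (use D0 in auto)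
  also have "\<dots> = (\<Prod>m<M. fact (N - Ns m)) * r"
    unfolding main(2) using r by (simp add: prod_nonneg)
  also have "\<dots> * c = r * ((\<Prod>m<M. fact (N - Ns m)) * c)" by simp
  also have "(\<Prod>m<M. fact (N - Ns m)) * c = 1"
    unfolding c_def prod.distrib[symmetric] by simp
  finally have "complex_of_real (correlation N \<nu> M t Ns x) = ker_det S w" using r by simp
  also have "\<dots> = block_det M Ns (\<lambda>(m, j) (n, k). flow_kernel R N \<nu> (t m) (x m j) (t n) (x n k))"
    unfolding block_det_eq_ldet S_def[symmetric] ker_det_def
    by (rule ldet_cong) (auto simp: S_def w_def ker_eq_flow_kernel)
  finally show ?thesis .
qed

end

lemma continuous_on_flow_kernel:
  assumes \<nu>: "\<And>j. j < N \<Longrightarrow> \<bar>\<nu> j\<bar> < R" and st: "s > 0" "t > 0"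
  shows "continuous_on UNIV (\<lambda>(x, y). flow_kernel R N \<nu> s x t y)"
proof -
  have "continuous_on UNIV (\<lambda>p. flow_Q R \<nu> s k (fst p))" if "k < N" for k
    using \<nu> that by (intro continuous_on_compose2[OF continuous_on_flow_Q[OF st(1)]] continuous_intros) auto
  moreover have "continuous_on UNIV (\<lambda>p. flow_R \<nu> t k (snd p))" for k
    by (intro continuous_on_compose2[OF continuous_on_flow_R[OF st(2)]] continuous_intros) auto
  moreover have "continuous_on UNIV (\<lambda>p. if s < t then flow_P s t (fst p) (snd p) else 0)"
    by (cases "s < t") (auto intro!: continuous_on_flow_P continuous_intros st)
  ultimately show ?thesis
    unfolding flow_kernel_def case_prod_unfold by (intro continuous_on_diff continuous_on_sum continuous_on_mult) auto
qed

lemma determinantal_flow_kernel: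
  assumes N: "N \<ge> 1" and \<nu>: "\<nu> \<in> weyl_closed N" and R: "\<And>j. j < N \<Longrightarrow> \<bar>\<nu> j\<bar> + real N < R"
    and K: "\<And>s x t y. s > 0 \<Longrightarrow> t > 0 \<Longrightarrow> K s x t y = flow_kernel R N \<nu> s x t y"
  shows "determinantal N \<nu> K"
  unfolding determinantal_def
proof (intro conjI allI impI)
  have R': "\<bar>\<nu> j\<bar> < R" if "j < N" for j using R[OF that] by linarith
  show "continuous_on UNIV (\<lambda>(x, y). K s x t y)" if "s > 0" "t > 0" for s t
    using continuous_on_flow_kernel[OF R' that] by (simp add: K[OF that])
next
  fix M :: nat and Ns :: "nat \<Rightarrow> nat" and t :: "nat \<Rightarrow> real" and x :: "nat \<Rightarrow> nat \<Rightarrow> real"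
  assume M: "1 \<le> M" and Ns: "\<forall>m<M. 1 \<le> Ns m \<and> Ns m \<le> N" and t: "\<forall>m<M. 0 < t m" "strict_mono_on {..<M} t"
  interpret drifted_times N M \<nu> R t
    by unfold_locales (use N M \<nu> R t in auto)
  have "complex_of_real (correlation N \<nu> M t Ns x) =
      block_det M Ns (\<lambda>(m, j) (n, k). flow_kernel R N \<nu> (t m) (x m j) (t n) (x n k))"
    by (rule correlation_eq_block_det) (use Ns in auto)
  also have "\<dots> = block_det M Ns (\<lambda>(m, j) (n, k). K (t m) (x m j) (t n) (x n k))"
    unfolding block_det_eq_ldet by (rule ldet_cong) (use t in \<open>auto simp: K\<close>)
  finally show "complex_of_real (correlation N \<nu> M t Ns x) =
      block_det M Ns (\<lambda>(m, j) (n, k). K (t m) (x m j) (t n) (x n k))" .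
qed

theorem proposition2p2:
  fixes N :: nat and \<nu> :: "nat \<Rightarrow> real"
  assumes "N \<ge> 1" and "\<nu> \<in> weyl_closed N"
  shows
    "(\<forall>\<gamma>. encircles_once \<gamma> (supp_points N \<nu>) imaginary_axis \<longrightarrow>
        determinantal N \<nu> (corr_kernel N \<nu> \<gamma>)) \<and>
     (\<forall>\<Gamma>. contour_family N \<nu> \<Gamma> \<longrightarrow> determinantal N \<nu> (corr_kernel_swapped N \<nu> \<Gamma>)) \<and>
     (\<nu> \<in> weyl N \<longrightarrow>
        (\<forall>s>0. \<forall>t>0. \<forall>x y.
           (\<forall>\<gamma>. encircles_once \<gamma> (supp_points N \<nu>) imaginary_axis \<longrightarrow>
              corr_kernel N \<nu> \<gamma> s x t y = corr_kernel_simple N \<nu> s x t y) \<and>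
           (\<forall>\<Gamma>. contour_family N \<nu> \<Gamma> \<longrightarrow>
              corr_kernel_swapped N \<nu> \<Gamma> s x t y = corr_kernel_simple N \<nu> s x t y)))"
proof -
  obtain R0 where R0: "\<And>j. j < N \<Longrightarrow> \<bar>\<nu> j\<bar> < R0" using exists_bound[of N \<nu> \<nu>] by metis
  \<comment> \<open>The slack \<open>real N\<close> leaves room for the node perturbation in
    \<open>det_divdiff_exp_mult\<close>.\<close>
  define R where "R = R0 + real N"
  have R: "\<bar>\<nu> j\<bar> + real N < R" "\<bar>\<nu> j\<bar> < R" if "j < N" for j
    using R0[OF that] by (auto simp: R_def)
  note eqs = corr_kernel_eq[OF R(2)] corr_kernel_swapped_eq[OF R(2)] corr_kernel_simple_eq[OF R(2) _ assms(1)]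
  show ?thesis
    by (intro conjI allI impI determinantal_flow_kernel[OF assms R(1)]) (simp_all add: eqs)
qed

end
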